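(* For $K$ sufficiently large (i.e. there exists $K_0<\infty$ such that for all $K\ge K_0$), $$\mathbb{P}\left(\exists\, \tau\in[0,1] \text{ such that } \limsup_{t\to\infty}\frac{|S_0^{\tau}(t)|}{\sqrt{t}}\le K\right)=1 .$$
   Context: Dynamical discrete web (DyDW): let $\mathbb{Z}^2_{\mathrm{even}}=\{(x,t)\in\mathbb{Z}^2: x+t \text{ even}\}$, where $x$ is space and $t$ is (random walk) time. To each $z\in\mathbb{Z}^2_{\mathrm{even}}$ assign, independently over $z$, a right-continuous process $(\xi_z^\tau)_{\tau\ge 0}$ with values in $\{-1,+1\}$: $\xi_z^0$ is uniform on $\{\pm1\}$, and at each ring of a rate one Poisson clock attached to $z$ the value is replaced by a fresh independent uniform $\pm1$ variable (which may agree with the old value). All clocks, initial values and resampled values are independent. The parameter $\tau$ is called dynamical time. For fixed $\tau$, draw an arrow from each $(x,t)\in\mathbb{Z}^2_{\mathrm{even}}$ to $(x+\xi_{(x,t)}^\tau,t+1)$; $S_{z}^{\tau}(\cdot)$ denotes the path that starts at $z$ and follows the arrows at dynamical time $\tau$ (linearly interpolated between integer times). $S_0^\tau:=S_{(0,0)}^\tau$ is the path from the origin. *)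

theory Defs
  imports "HOL-Probability.Probability"
begin

text \<open>A site is a pair (space, random walk time).\<close>

type_synonym site = "int \<times> int"

definition even_lattice :: "site set" where
  "even_lattice = {(x, t). even (x + t)}"

text \<open>
  The rate one Poisson clock at a site is given by its interarrival times gap z 0, gap z 1, ...,
  which are i.i.d. exponential of parameter 1. The initial value at z is mark z 0, and
  mark z (Suc n) is the fresh value drawn at the ring with index n (rings being indexed from 0).
  Joint independence is stated for a family with values in a single space, so the integer marks
  are embedded into the reals there. Off the even lattice gap and mark are unconstrained.
\<close>

locale dynamical_discrete_web = prob_space M
  for M :: "'w measure"
    and gap :: "site \<Rightarrow> nat \<Rightarrow> 'w \<Rightarrow> real"
    and mark :: "site \<Rightarrow> nat \<Rightarrow> 'w \<Rightarrow> int" +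
  assumes gap_exponential:
      "z \<in> even_lattice \<Longrightarrow> distributed M lborel (gap z n) (exponential_density 1)"
    and mark_range:
      "z \<in> even_lattice \<Longrightarrow> \<omega> \<in> space M \<Longrightarrow> mark z n \<omega> \<in> {-1, 1}"
    and mark_uniform:
      "z \<in> even_lattice \<Longrightarrow> v \<in> {-1, 1} \<Longrightarrow> prob {\<omega> \<in> space M. mark z n \<omega> = v} = 1 / 2"
    and independent:
      "indep_vars (\<lambda>_. borel)
         (\<lambda>i \<omega>. case i of Inl (z, n) \<Rightarrow> gap z n \<omega> | Inr (z, n) \<Rightarrow> real_of_int (mark z n \<omega>))
         ((even_lattice \<times> (UNIV :: nat set)) <+> (even_lattice \<times> (UNIV :: nat set)))"

definition ring_time :: "(site \<Rightarrow> nat \<Rightarrow> 'w \<Rightarrow> real) \<Rightarrow> site \<Rightarrow> nat \<Rightarrow> 'w \<Rightarrow> real" where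
  "ring_time gap z n \<omega> = (\<Sum>i\<le>n. gap z i \<omega>)"

text \<open>
  For a site of the even lattice this set is finite almost surely; on the exceptional null event
  card returns the junk value 0.
\<close>

definition ring_count :: "(site \<Rightarrow> nat \<Rightarrow> 'w \<Rightarrow> real) \<Rightarrow> site \<Rightarrow> real \<Rightarrow> 'w \<Rightarrow> nat" where
  "ring_count gap z \<tau> \<omega> = card {n. ring_time gap z n \<omega> \<le> \<tau>}"

definition spin ::
  "(site \<Rightarrow> nat \<Rightarrow> 'w \<Rightarrow> real) \<Rightarrow> (site \<Rightarrow> nat \<Rightarrow> 'w \<Rightarrow> int) \<Rightarrow> real \<Rightarrow> 'w \<Rightarrow> site \<Rightarrow> int" where
  "spin gap mark \<tau> \<omega> z = mark z (ring_count gap z \<tau> \<omega>) \<omega>"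

definition follow_arrow :: "(site \<Rightarrow> int) \<Rightarrow> site \<Rightarrow> site" where
  "follow_arrow \<xi> = (\<lambda>(x, t). (x + \<xi> (x, t), t + 1))"

definition position :: "(site \<Rightarrow> int) \<Rightarrow> site \<Rightarrow> nat \<Rightarrow> int" where
  "position \<xi> z n = fst ((follow_arrow \<xi> ^^ n) z)"

text \<open>The path is only meaningful for times t not before the starting time snd z.\<close>

definition arrow_path :: "(site \<Rightarrow> int) \<Rightarrow> site \<Rightarrow> real \<Rightarrow> real" where
  "arrow_path \<xi> z t =
     (let s = t - of_int (snd z); n = nat \<lfloor>s\<rfloor>
      in (1 - frac s) * of_int (position \<xi> z n) + frac s * of_int (position \<xi> z (Suc n)))"

definition dydw_path ::
  "(site \<Rightarrow> nat \<Rightarrow> 'w \<Rightarrow> real) \<Rightarrow> (site \<Rightarrow> nat \<Rightarrow> 'w \<Rightarrow> int) \<Rightarrow> site \<Rightarrow> real \<Rightarrow> 'w \<Rightarrow> real \<Rightarrow> real" where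
  "dydw_path gap mark z \<tau> \<omega> = arrow_path (spin gap mark \<tau> \<omega>) z"

end

theory Submission imports Defs begin

text \<open>
  Cut random walk time into the windows [4^m, 4^(m+1)]. If the path moves by less than 8 * 2^m in
  every late window, then its limsup is at most 16. For a fixed dynamical time the confinement of
  a window is encoded in a nonnegative martingale, the cosine eigenfunction of the killed walk,
  and the product W of these martingales over the windows l, ..., n-1 has mean 1.

  For two dynamical times at distance d the steps of the two paths are correlated only
  when the paths are at the same site. By Tanaka's formula they meet O(2^m / d) times in window m,
  so the window contributes at most the factor min (10/9) (1 + 2^-m / d) to the mean of W W'.
  Since 10/9 < sqrt 2, the product of these factors is at most 1 + 3 (2^l d)^(-1/2), and the
  average of W over dynamical times in [1/2, 1] has mean 1 and second moment tending to 1 as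
  l grows. Hence good dynamical times exist with probability tending to 1, uniformly in n.

  To pass to the limit in n, one also asks that no clock near the path rings within a tiny margin
  of the dynamical time. This costs little mass, since W is a martingale, and it keeps the
  windows confined at an accumulation point of good times.
\<close>

text \<open>At a fixed dynamical time the law of the iterated logarithm rules out such confinement,
  so a good time is exceptional and has to come from a second moment bound over many dynamical
  times. The obstacle is the singularity at small distance d. Roughly log2 (1 / (2^l d)) windows are
  too short for two walks at distance d to decouple, and each of them may cost the full supremum of
  one weight. With supremum 10/9 the total is about (2^l d)^(-a) with a = log2 (10/9), which is
  integrable in d because a < 1; the proof works with the exponent 1/2. A wider strip has an
  eigenvalue closer to 1 and hence a smaller supremum: this is where a large K enters, and
  half-width 8 * 2^m brings the supremum down to 10/9.

  A bounded second moment would only give positive probability. It has to tend to 1, and discarding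
  the windows below l achieves this, since d always appears multiplied by 2^l. The average runs over
  finitely many rational dynamical times, so no measurability in the dynamical time comes up, and it
  stays in [1/2, 1] to leave room for the margins on the left.\<close>

section \<open>The confinement martingale\<close>

text \<open>
  The frequency is chosen such that theta m * (8 * 2^m) = pi / 2: the cosine vanishes exactly
  where the walk is killed.
\<close>

definition theta :: "nat \<Rightarrow> real" where
  "theta m = pi / (16 * 2 ^ m)"

text \<open>Displacement is measured from the position at the start of the window, so that every
  window brings a new factor starting at 1, whatever happened before.\<close>

definition alive :: "nat \<Rightarrow> (nat \<Rightarrow> int) \<Rightarrow> nat \<Rightarrow> bool" where
  "alive m p j \<longleftrightarrow> (\<forall>i\<le>j. \<bar>p (4 ^ m + i) - p (4 ^ m)\<bar> < 8 * 2 ^ m)"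

definition weight :: "nat \<Rightarrow> (nat \<Rightarrow> int) \<Rightarrow> nat \<Rightarrow> real" where
  "weight m p j = (if alive m p j
     then cos (theta m * of_int (p (4 ^ m + j) - p (4 ^ m))) / cos (theta m) ^ j else 0)"

text \<open>The coefficient of the next step in the increment of \<open>weight\<close>, which makes
  \<open>weight\<close> a discrete stochastic integral against the walk
  (\<open>weight_Suc\<close>).\<close>

definition slope :: "nat \<Rightarrow> (nat \<Rightarrow> int) \<Rightarrow> nat \<Rightarrow> real" where
  "slope m p j = (if alive m p j
     then - (sin (theta m) * sin (theta m * of_int (p (4 ^ m + j) - p (4 ^ m)))) / cos (theta m) ^ Suc j
     else 0)"

definition total_weight :: "nat \<Rightarrow> nat \<Rightarrow> (nat \<Rightarrow> int) \<Rightarrow> real" where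
  "total_weight l n p = (\<Prod>m=l..<n. weight m p (3 * 4 ^ m))"

lemma theta_pos: "0 < theta m"
  by (simp add: theta_def)

lemma theta_le: "theta m \<le> 1 / (4 * 2 ^ m)"
  using pi_less_4 by (simp add: theta_def field_simps)

lemma theta_lt_half_pi: "theta m < pi / 2"
proof -
  have "(1::real) \<le> 2 ^ m" by simp
  then have "(1::real) < 8 * 2 ^ m" by linarith
  then show ?thesis by (simp add: theta_def field_simps)
qed

lemma cos_theta_pos: "0 < cos (theta m)"
  using cos_gt_zero_pi[of "theta m"] theta_pos[of m] theta_lt_half_pi[of m] by simp

lemma cos_ge_one_minus_square: "1 - x\<^sup>2 / 2 \<le> cos (x::real)"
proof -
  have "cos x = 1 - 2 * (sin (x / 2))\<^sup>2"
    using cos_double_sin[of "x / 2"] by simp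
  moreover have "(sin (x / 2))\<^sup>2 \<le> (x / 2)\<^sup>2"
    using abs_sin_x_le_abs_x[of "x / 2"] by (metis abs_le_square_iff)
  ultimately show ?thesis by (simp add: power2_eq_square)
qed

text \<open>Diffusive scaling: the square of the angle is of order 4^-m and the window has 3 * 4^m
  steps, so the normalisation loses a factor bounded uniformly in m.\<close>

lemma cos_theta_power_ge:
  assumes "j \<le> 3 * 4 ^ m"
  shows "9 / 10 \<le> cos (theta m) ^ j"
proof -
  have sq: "(theta m)\<^sup>2 \<le> 1 / (16 * 4 ^ m)"
  proof -
    have "(theta m)\<^sup>2 \<le> (1 / (4 * 2 ^ m))\<^sup>2"
      using theta_le[of m] theta_pos[of m] by (intro power_mono) auto
    also have "\<dots> = 1 / (16 * 4 ^ m)"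
      by (simp add: power2_eq_square power_mult_distrib[symmetric] field_simps)
    finally show ?thesis .
  qed
  have "(theta m)\<^sup>2 \<le> 1"
  proof -
    have "(1::real) \<le> 4 ^ m" by simp
    then have "(1::real) \<le> 16 * 4 ^ m" by linarith
    then have "1 / (16 * 4 ^ m) \<le> (1::real)" by simp
    with sq show ?thesis by linarith
  qed
  then have small: "(theta m)\<^sup>2 / 2 \<le> 1" by linarith
  \<comment> \<open>The subtracted term equals 3/32 < 1/10. This is the origin of 9/10 here and of
    10/9 later.\<close>
  have "9 / 10 \<le> 1 - real (3 * 4 ^ m) * (1 / (16 * 4 ^ m) / 2)"
    by simp
  also have "\<dots> \<le> 1 - real (3 * 4 ^ m) * ((theta m)\<^sup>2 / 2)"
    using sq by (intro diff_left_mono mult_left_mono) auto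
  also have "\<dots> = 1 + real (3 * 4 ^ m) * (- ((theta m)\<^sup>2 / 2))" by simp
  also have "\<dots> \<le> (1 + - ((theta m)\<^sup>2 / 2)) ^ (3 * 4 ^ m)"
    using small by (intro Bernoulli_inequality) simp
  also have "\<dots> \<le> cos (theta m) ^ (3 * 4 ^ m)"
    using small cos_ge_one_minus_square[of "theta m"] by (intro power_mono) auto
  also have "\<dots> \<le> cos (theta m) ^ j"
    using assms cos_theta_pos[of m] by (intro power_decreasing) (auto simp: less_imp_le)
  finally show ?thesis .
qed

lemma weight_0: "weight m p 0 = 1"
  by (simp add: weight_def alive_def)

lemma abs_theta_mult_lt:
  assumes "\<bar>x\<bar> < 8 * 2 ^ m"
  shows "\<bar>theta m * of_int x\<bar> < pi / 2"
proof -
  have "\<bar>theta m * of_int x\<bar> = theta m * of_int \<bar>x\<bar>"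
    using theta_pos[of m] by (simp add: abs_mult)
  also have "\<dots> < theta m * (8 * 2 ^ m)"
  proof -
    have "real_of_int \<bar>x\<bar> < real_of_int (8 * 2 ^ m)" using assms by (simp only: of_int_less_iff)
    then show ?thesis using theta_pos[of m] by (intro mult_strict_left_mono) auto
  qed
  also have "\<dots> = pi / 2" by (simp add: theta_def)
  finally show ?thesis .
qed

text \<open>While the walk is alive the angle stays strictly inside (-pi/2, pi/2), where the cosine
  is positive. This lets a positive weight be read back as confinement.\<close>

lemma weight_pos_iff: "0 < weight m p j \<longleftrightarrow> alive m p j"
proof
  assume "alive m p j"
  then have "\<bar>p (4 ^ m + j) - p (4 ^ m)\<bar> < 8 * 2 ^ m" by (auto simp: alive_def)
  then have "\<bar>theta m * of_int (p (4 ^ m + j) - p (4 ^ m))\<bar> < pi / 2"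
    by (rule abs_theta_mult_lt)
  then have "0 < cos (theta m * of_int (p (4 ^ m + j) - p (4 ^ m)))"
    by (intro cos_gt_zero_pi) linarith+
  with \<open>alive m p j\<close> show "0 < weight m p j"
    using cos_theta_pos[of m] by (simp add: weight_def)
qed (auto simp: weight_def split: if_splits)

lemma weight_nonneg: "0 \<le> weight m p j"
  by (metis weight_pos_iff weight_def less_eq_real_def)

lemma weight_le:
  assumes "j \<le> 3 * 4 ^ m"
  shows "weight m p j \<le> 10 / 9"
proof (cases "alive m p j")
  case True
  have c: "9 / 10 \<le> cos (theta m) ^ j" by (rule cos_theta_power_ge[OF assms])
  have "weight m p j \<le> 1 / cos (theta m) ^ j"
    using True c by (simp add: weight_def divide_right_mono)
  also have "\<dots> \<le> 1 / (9 / 10)" using c by (intro divide_left_mono) auto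
  finally show ?thesis by simp
qed (simp add: weight_def)

text \<open>The factors are theta m, at most 1/4 * 2^-m, and 10/9 from the normalisation. The square
  of this bound, of order 4^-m, has to beat a number of meetings of order 2^m.\<close>

lemma abs_slope_le:
  assumes "j < 3 * 4 ^ m"
  shows "\<bar>slope m p j\<bar> \<le> 5 / 18 / 2 ^ m"
proof (cases "alive m p j")
  case True
  have c: "9 / 10 \<le> cos (theta m) ^ Suc j"
    using assms by (intro cos_theta_power_ge) simp
  let ?y = "theta m * of_int (p (4 ^ m + j) - p (4 ^ m))"
  have "\<bar>slope m p j\<bar> = \<bar>sin (theta m)\<bar> * \<bar>sin ?y\<bar> / cos (theta m) ^ Suc j"
    using True cos_theta_pos[of m] unfolding slope_def
    by (simp add: abs_mult abs_divide power_abs del: power_Suc)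
  also have "\<dots> \<le> theta m * 1 / cos (theta m) ^ Suc j"
    using abs_sin_x_le_abs_x[of "theta m"] theta_pos[of m] c
    by (intro divide_right_mono mult_mono) auto
  also have "\<dots> \<le> (1 / (4 * 2 ^ m)) * 1 / (9 / 10)"
    using c theta_le[of m] theta_pos[of m] by (intro frac_le) auto
  also have "\<dots> = 5 / 18 / 2 ^ m" by simp
  finally show ?thesis .
qed (simp add: slope_def)

text \<open>The addition formula for the cosine: for a sign s, cos (theta * s) does not depend on s
  and sin (theta * s) is s times sin theta. The same formula covers the step at which the walk is
  killed.\<close>

lemma weight_Suc:
  assumes "\<bar>p (4 ^ m + Suc j) - p (4 ^ m + j)\<bar> = 1"
  shows "weight m p (Suc j) =
    weight m p j + of_int (p (4 ^ m + Suc j) - p (4 ^ m + j)) * slope m p j"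
proof (cases "alive m p j")
  case False
  then have "\<not> alive m p (Suc j)" unfolding alive_def by (meson le_SucI)
  with False show ?thesis by (simp add: weight_def slope_def)
next
  case True
  define x where "x = p (4 ^ m + j) - p (4 ^ m)"
  define s where "s = p (4 ^ m + Suc j) - p (4 ^ m + j)"
  define th where "th = theta m"
  have s: "s = 1 \<or> s = -1" using assms unfolding s_def by linarith
  have xs: "p (4 ^ m + Suc j) - p (4 ^ m) = x + s" by (simp add: x_def s_def)
  have "\<bar>x\<bar> < 8 * 2 ^ m" using True by (auto simp: alive_def x_def)
  have wS: "weight m p (Suc j) = cos (th * of_int (x + s)) / cos th ^ Suc j"
  proof (cases "alive m p (Suc j)")
    case True
    then show ?thesis unfolding weight_def xs th_def by simp
  next
    case False
    \<comment> \<open>A unit step from the open strip can leave it only by landing exactly on the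
      boundary, where the cosine already vanishes; setting the weight to 0 therefore changes
      nothing.\<close>
    then have "8 * 2 ^ m \<le> \<bar>x + s\<bar>" using True unfolding alive_def xs[symmetric]
      by (metis le_Suc_eq not_le)
    with s \<open>\<bar>x\<bar> < 8 * 2 ^ m\<close> have "\<bar>x + s\<bar> = 8 * 2 ^ m" by linarith
    then have "x + s = 8 * 2 ^ m \<or> x + s = - (8 * 2 ^ m)" by linarith
    then have "real_of_int (x + s) = 8 * 2 ^ m \<or> real_of_int (x + s) = - (8 * 2 ^ m)"
      by (auto dest: arg_cong[of _ _ real_of_int])
    then have "cos (th * of_int (x + s)) = cos (th * (8 * 2 ^ m))"
    proof
      assume "real_of_int (x + s) = - (8 * 2 ^ m)"
      then show ?thesis using cos_minus[of "th * (8 * 2 ^ m)"] by simp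
    qed simp
    also have "th * (8 * 2 ^ m) = pi / 2" by (simp add: th_def theta_def)
    finally show ?thesis using False by (simp add: weight_def)
  qed
  have sc: "sin (th * of_int s) = of_int s * sin th" "cos (th * of_int s) = cos th"
    using s by auto
  have "cos (th * of_int (x + s)) = cos (th * of_int x) * cos th - of_int s * (sin th * sin (th * of_int x))"
    using cos_add[of "th * of_int x" "th * of_int s"] by (simp add: sc distrib_left mult_ac)
  then have "weight m p (Suc j) =
      cos (th * of_int x) / cos th ^ j + of_int s * (- (sin th * sin (th * of_int x)) / cos th ^ Suc j)"
    unfolding wS using cos_theta_pos[of m] by (simp add: th_def field_simps)
  then show ?thesis
    using True unfolding weight_def slope_def x_def[symmetric] s_def[symmetric] th_def by simp
qed

lemma total_weight_nonneg: "0 \<le> total_weight l n p"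
  unfolding total_weight_def by (intro prod_nonneg) (simp add: weight_nonneg)

lemma total_weight_le: "total_weight l n p \<le> (10 / 9) ^ (n - l)"
proof -
  have "total_weight l n p \<le> (\<Prod>m=l..<n. 10 / 9)"
    unfolding total_weight_def by (intro prod_mono) (simp add: weight_nonneg weight_le[unfolded le_divide_eq])
  then show ?thesis by simp
qed

lemma total_weight_Suc:
  "l \<le> n \<Longrightarrow> total_weight l (Suc n) p = total_weight l n p * weight n p (3 * 4 ^ n)"
  by (simp add: total_weight_def)

lemma total_weight_pos_imp_alive:
  assumes "0 < total_weight l n p" "l \<le> m" "m < n"
  shows "alive m p (3 * 4 ^ m)"
proof -
  have "weight m p (3 * 4 ^ m) \<noteq> 0"
    using assms unfolding total_weight_def by (metis atLeastLessThan_iff finite_atLeastLessThan less_irrefl prod_zero_iff)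
  then show ?thesis using weight_pos_iff[of m p "3 * 4 ^ m"] weight_nonneg[of m p "3 * 4 ^ m"] by simp
qed

section \<open>Numerical bounds for the product over windows and the sum over pairs of times\<close>

text \<open>Remove the lowest window. With y = 2^-l / d and r = sqrt y, passing to the next window
  halves y, so the claim reduces to min (10/9) (1 + y) * (1 + 3 * sqrt (1/2) * r) <= 1 + 3 * r. For
  large r this needs 10/9 < sqrt 2.\<close>

lemma prod_min_le:
  fixes d :: real
  assumes "0 < d"
  shows "(\<Prod>m=l..<n. min (10 / 9) (1 + 1 / 2 ^ m / d)) \<le> 1 + 3 * sqrt (1 / 2 ^ l / d)"
proof (induction "n - l" arbitrary: l)
  case 0
  then show ?case using assms by simp
next
  case (Suc k)
  then have "l < n" by simp
  define y where "y = 1 / 2 ^ l / d"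
  have "0 < y" using assms by (simp add: y_def)
  define r where "r = sqrt y"
  have r: "0 < r" "y = r * r" using \<open>0 < y\<close> by (auto simp: r_def)
  have s2: "sqrt (1/2) \<le> 71 / 100"
    by (rule real_le_lsqrt) (auto simp: power2_eq_square)
  have "sqrt (1 / 2 ^ Suc l / d) = sqrt (1/2) * r"
    by (simp add: r_def y_def real_sqrt_mult[symmetric])
  also have "\<dots> \<le> 71 / 100 * r" using s2 r by (intro mult_right_mono) auto
  finally have half: "sqrt (1 / 2 ^ Suc l / d) \<le> 71 / 100 * r" .
  have "(\<Prod>m=l..<n. min (10 / 9) (1 + 1 / 2 ^ m / d))
      = min (10 / 9) (1 + y) * (\<Prod>m=Suc l..<n. min (10 / 9) (1 + 1 / 2 ^ m / d))"
    using \<open>l < n\<close> by (simp add: prod.atLeast_Suc_lessThan y_def)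
  also have "\<dots> \<le> min (10 / 9) (1 + y) * (1 + 3 * sqrt (1 / 2 ^ Suc l / d))"
    using Suc(1)[of "Suc l"] Suc(2) \<open>0 < y\<close> by (intro mult_left_mono) auto
  also have "\<dots> \<le> min (10 / 9) (1 + y) * (1 + 3 * (71 / 100 * r))"
    using half \<open>0 < y\<close> by (intro mult_left_mono) auto
  also have "\<dots> \<le> 1 + 3 * r"
  \<comment> \<open>For small r the factor 1 + y is used, with y = r * r <= r / 4. For large r the
    factor 10/9 is used, and its excess 1/9 is absorbed because 10/9 * 213/100 is well below
    3.\<close>
  proof (cases "r \<le> 1 / 4")
    case True
    have "min (10 / 9) (1 + y) * (1 + 3 * (71 / 100 * r)) \<le> (1 + y) * (1 + 3 * (71 / 100 * r))"
      using r by (intro mult_right_mono) auto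
    also have "\<dots> = 1 + r * r + 213 / 100 * r + 213 / 100 * r * (r * r)"
      by (simp add: r algebra_simps)
    also have "\<dots> \<le> 1 + 1 / 4 * r + 213 / 100 * r + 213 / 100 * r * (1 / 4 * (1 / 4))"
      using True r by (intro add_mono mult_left_mono mult_right_mono mult_mono) auto
    also have "\<dots> \<le> 1 + 3 * r" using r by simp
    finally show ?thesis .
  next
    case False
    have "min (10 / 9) (1 + y) * (1 + 3 * (71 / 100 * r)) \<le> 10 / 9 * (1 + 3 * (71 / 100 * r))"
      using r by (intro mult_right_mono min.cobounded1) auto
    also have "\<dots> \<le> 1 + 3 * r" using False by simp
    finally show ?thesis .
  qed
  finally show ?case by (simp add: r_def y_def)
qed

text \<open>Telescoping: by the inequality of the means each term is at most twice the increment of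
  the square root.\<close>

lemma sum_inverse_sqrt_le: "(\<Sum>d=1..n. 1 / sqrt (real d)) \<le> 2 * sqrt (real n)"
proof (induction n)
  case (Suc n)
  have "2 * sqrt (real n) * sqrt (real (Suc n)) \<le> (sqrt (real n))\<^sup>2 + (sqrt (real (Suc n)))\<^sup>2"
    by (rule sum_squares_bound)
  then have "1 / sqrt (real (Suc n)) \<le> 2 * sqrt (real (Suc n)) - 2 * sqrt (real n)"
    by (simp add: field_simps)
  with Suc show ?case by simp
qed simp

text \<open>A Riemann sum for the integral of |s - t|^(-1/2) over the unit square, whose singularity
  is integrable. Each row splits at the diagonal into two sums of 1 / sqrt d.\<close>

lemma sum_offdiagonal_le:
  "(\<Sum>i<n. \<Sum>j\<in>{..<n} - {i}. sqrt (real n / \<bar>real i - real j\<bar>)) \<le> 4 * (real n)\<^sup>2"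
proof -
  have "(\<Sum>j\<in>{..<n} - {i}. sqrt (real n / \<bar>real i - real j\<bar>)) \<le> 4 * real n" if "i < n" for i
  proof -
    have split: "{..<n} - {i} = {..<i} \<union> {Suc i..<n}" using that by auto
    have "(\<Sum>j\<in>{..<n} - {i}. 1 / sqrt \<bar>real i - real j\<bar>)
        = (\<Sum>j<i. 1 / sqrt \<bar>real i - real j\<bar>) + (\<Sum>j=Suc i..<n. 1 / sqrt \<bar>real i - real j\<bar>)"
      unfolding split by (rule sum.union_disjoint) auto
    also have "(\<Sum>j<i. 1 / sqrt \<bar>real i - real j\<bar>) = (\<Sum>d=1..i. 1 / sqrt (real d))"
      by (rule sum.reindex_bij_witness[where i="\<lambda>d. i - d" and j="\<lambda>j. i - j"]) (auto simp: of_nat_diff)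
    also have "(\<Sum>j=Suc i..<n. 1 / sqrt \<bar>real i - real j\<bar>) = (\<Sum>d=1..n - Suc i. 1 / sqrt (real d))"
      by (rule sum.reindex_bij_witness[where i="\<lambda>d. i + d" and j="\<lambda>j. j - i"]) (auto simp: of_nat_diff)
    also have "(\<Sum>d=1..i. 1 / sqrt (real d)) + (\<Sum>d=1..n - Suc i. 1 / sqrt (real d))
        \<le> 2 * sqrt (real n) + 2 * sqrt (real n)"
      using that by (intro add_mono order.trans[OF sum_inverse_sqrt_le]) auto
    finally have *: "(\<Sum>j\<in>{..<n} - {i}. 1 / sqrt \<bar>real i - real j\<bar>) \<le> 4 * sqrt (real n)" by simp
    have "(\<Sum>j\<in>{..<n} - {i}. sqrt (real n / \<bar>real i - real j\<bar>))
        = sqrt (real n) * (\<Sum>j\<in>{..<n} - {i}. 1 / sqrt \<bar>real i - real j\<bar>)"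
      by (simp add: sum_distrib_left real_sqrt_divide)
    also have "\<dots> \<le> sqrt (real n) * (4 * sqrt (real n))"
      using * by (intro mult_left_mono) auto
    also have "\<dots> = 4 * real n" by simp
    finally show ?thesis .
  qed
  then have "(\<Sum>i<n. \<Sum>j\<in>{..<n} - {i}. sqrt (real n / \<bar>real i - real j\<bar>)) \<le> (\<Sum>i<n. 4 * real n)"
    by (intro sum_mono) auto
  then show ?thesis by (simp add: power2_eq_square)
qed

section \<open>Two correlated walks\<close>

lemma measurable_count_space_combine:
  fixes X :: "'a \<Rightarrow> 'b :: countable"
  assumes "X \<in> measurable N (count_space UNIV)" "Y \<in> measurable N (count_space UNIV)"
  shows "(\<lambda>\<omega>. f (X \<omega>) (Y \<omega>)) \<in> measurable N (count_space UNIV)"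
proof (rule measurable_compose_countable[OF _ assms(1)])
  show "(\<lambda>\<omega>. f i (Y \<omega>)) \<in> measurable N (count_space UNIV)" for i
    by (rule measurable_compose[OF assms(2)]) simp
qed

text \<open>
  The environment seen by time t is F t, and P, Q are the paths at two dynamical times
  with correlation rho between the two arrows at one site.
\<close>

locale walk_pair = prob_space M
  for M :: "'w measure" +
  fixes F :: "nat \<Rightarrow> 'w measure" and P Q :: "nat \<Rightarrow> 'w \<Rightarrow> int" and rho :: real
  assumes subalg: "\<And>t. subalgebra M (F t)"
    and filtration: "\<And>s t. s \<le> t \<Longrightarrow> sets (F s) \<subseteq> sets (F t)"
    and measurable_P: "\<And>t. P t \<in> measurable (F t) (count_space UNIV)"
    and measurable_Q: "\<And>t. Q t \<in> measurable (F t) (count_space UNIV)"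
    and P_0: "\<And>\<omega>. \<omega> \<in> space M \<Longrightarrow> P 0 \<omega> = 0"
    and Q_0: "\<And>\<omega>. \<omega> \<in> space M \<Longrightarrow> Q 0 \<omega> = 0"
    and step_P: "\<And>\<omega> t. \<omega> \<in> space M \<Longrightarrow> \<bar>P (Suc t) \<omega> - P t \<omega>\<bar> = 1"
    and step_Q: "\<And>\<omega> t. \<omega> \<in> space M \<Longrightarrow> \<bar>Q (Suc t) \<omega> - Q t \<omega>\<bar> = 1"
    and mean_P: "\<And>t (Y :: 'w \<Rightarrow> real) C. Y \<in> borel_measurable (F t) \<Longrightarrow> (\<And>\<omega>. \<omega> \<in> space M \<Longrightarrow> \<bar>Y \<omega>\<bar> \<le> C) \<Longrightarrow>
       expectation (\<lambda>\<omega>. Y \<omega> * of_int (P (Suc t) \<omega> - P t \<omega>)) = 0"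
    and mean_Q: "\<And>t (Y :: 'w \<Rightarrow> real) C. Y \<in> borel_measurable (F t) \<Longrightarrow> (\<And>\<omega>. \<omega> \<in> space M \<Longrightarrow> \<bar>Y \<omega>\<bar> \<le> C) \<Longrightarrow>
       expectation (\<lambda>\<omega>. Y \<omega> * of_int (Q (Suc t) \<omega> - Q t \<omega>)) = 0"
    and covariance: "\<And>t (Y :: 'w \<Rightarrow> real) C. Y \<in> borel_measurable (F t) \<Longrightarrow> (\<And>\<omega>. \<omega> \<in> space M \<Longrightarrow> \<bar>Y \<omega>\<bar> \<le> C) \<Longrightarrow>
       expectation (\<lambda>\<omega>. Y \<omega> * (of_int (P (Suc t) \<omega> - P t \<omega>) * of_int (Q (Suc t) \<omega> - Q t \<omega>)))
         = rho * expectation (\<lambda>\<omega>. Y \<omega> * of_bool (P t \<omega> = Q t \<omega>))"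
    and rho_bounds: "0 \<le> rho" "rho \<le> 1"
begin

text \<open>Boundedness is included so that products remain integrable and can serve as test
  functions in \<open>mean_P\<close>, \<open>mean_Q\<close> and \<open>covariance\<close>, which
  express conditional expectations by testing.\<close>

definition adapted :: "nat \<Rightarrow> ('w \<Rightarrow> real) \<Rightarrow> bool" where
  "adapted t Y \<longleftrightarrow> Y \<in> borel_measurable (F t) \<and> (\<exists>C. \<forall>\<omega>\<in>space M. \<bar>Y \<omega>\<bar> \<le> C)"

lemma space_F [simp]: "space (F t) = space M"
  using subalg[of t] by (simp add: subalgebra_def)

lemma measurable_F_mono: "s \<le> t \<Longrightarrow> Y \<in> measurable (F s) N \<Longrightarrow> Y \<in> measurable (F t) N"
  using filtration[of s t] by (auto simp: measurable_def)

lemma measurable_from_F: "Y \<in> measurable (F s) N \<Longrightarrow> Y \<in> measurable M N"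
  using subalg[of s] by (auto simp: measurable_def subalgebra_def)

lemma adapted_mono: "s \<le> t \<Longrightarrow> adapted s Y \<Longrightarrow> adapted t Y"
  by (auto simp: adapted_def intro: measurable_F_mono)

lemma adapted_const: "adapted t (\<lambda>_. c)"
  by (auto simp: adapted_def)

lemma adapted_add:
  assumes "adapted t Y" "adapted t Z" shows "adapted t (\<lambda>\<omega>. Y \<omega> + Z \<omega>)"
proof -
  obtain C D where "\<forall>\<omega>\<in>space M. \<bar>Y \<omega>\<bar> \<le> C" "\<forall>\<omega>\<in>space M. \<bar>Z \<omega>\<bar> \<le> D"
    using assms by (auto simp: adapted_def)
  then have "\<bar>Y \<omega> + Z \<omega>\<bar> \<le> C + D" if "\<omega> \<in> space M" for \<omega>
    using that abs_triangle_ineq[of "Y \<omega>" "Z \<omega>"] by fastforce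
  then show ?thesis using assms unfolding adapted_def by (blast intro: borel_measurable_add)
qed

lemma adapted_mult:
  assumes "adapted t Y" "adapted t Z" shows "adapted t (\<lambda>\<omega>. Y \<omega> * Z \<omega>)"
proof -
  obtain C D where "\<forall>\<omega>\<in>space M. \<bar>Y \<omega>\<bar> \<le> C" "\<forall>\<omega>\<in>space M. \<bar>Z \<omega>\<bar> \<le> D"
    using assms by (auto simp: adapted_def)
  then have "\<bar>Y \<omega> * Z \<omega>\<bar> \<le> C * D" if "\<omega> \<in> space M" for \<omega>
    unfolding abs_mult using that by (intro mult_mono') auto
  then show ?thesis using assms unfolding adapted_def by (blast intro: borel_measurable_times)
qed

lemma adapted_diff: "adapted t Y \<Longrightarrow> adapted t Z \<Longrightarrow> adapted t (\<lambda>\<omega>. Y \<omega> - Z \<omega>)"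
  using adapted_add[of t Y "\<lambda>\<omega>. -1 * Z \<omega>"] adapted_mult[OF adapted_const[of t "-1"], of Z] by simp

lemma adapted_power2: "adapted t Y \<Longrightarrow> adapted t (\<lambda>\<omega>. (Y \<omega>)\<^sup>2)"
  unfolding power2_eq_square by (rule adapted_mult)

lemma adapted_abs: "adapted t Y \<Longrightarrow> adapted t (\<lambda>\<omega>. \<bar>Y \<omega>\<bar>)"
  by (auto simp: adapted_def)

lemma adapted_sgn: "adapted t Y \<Longrightarrow> adapted t (\<lambda>\<omega>. sgn (Y \<omega>))"
  by (auto simp: adapted_def sgn_if intro!: exI[of _ 1])

lemma adapted_integrable:
  assumes "adapted t Y" shows "integrable M Y"
proof -
  obtain C where "\<forall>\<omega>\<in>space M. \<bar>Y \<omega>\<bar> \<le> C" using assms by (auto simp: adapted_def)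
  then show ?thesis using assms
    by (intro integrable_const_bound[of _ C]) (auto simp: adapted_def intro: measurable_from_F)
qed

text \<open>The hypotheses are symmetric in the two walks, so whatever is proved for
  \<open>P\<close> transfers to \<open>Q\<close>.\<close>

lemma swap_pair: "walk_pair M F Q P rho"
proof
  fix t C and Y :: "'w \<Rightarrow> real"
  assume *: "Y \<in> borel_measurable (F t)" "\<And>\<omega>. \<omega> \<in> space M \<Longrightarrow> \<bar>Y \<omega>\<bar> \<le> C"
  show "expectation (\<lambda>\<omega>. Y \<omega> * (of_int (Q (Suc t) \<omega> - Q t \<omega>) * of_int (P (Suc t) \<omega> - P t \<omega>)))
         = rho * expectation (\<lambda>\<omega>. Y \<omega> * of_bool (Q t \<omega> = P t \<omega>))"
    using covariance[OF *] by (simp add: mult.commute eq_commute)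
qed (fact subalg filtration measurable_P measurable_Q P_0 Q_0 step_P step_Q mean_P mean_Q rho_bounds)+

lemma abs_P_le: "\<omega> \<in> space M \<Longrightarrow> \<bar>P t \<omega>\<bar> \<le> int t"
proof (induction t)
  case (Suc t)
  then show ?case using step_P[of \<omega> t] by linarith
qed (simp add: P_0)

lemma even_diff: "\<omega> \<in> space M \<Longrightarrow> even (P t \<omega> - Q t \<omega>)"
proof (induction t)
  case (Suc t)
  have "odd (P (Suc t) \<omega> - P t \<omega>)" "odd (Q (Suc t) \<omega> - Q t \<omega>)"
    using step_P[OF Suc(2), of t] step_Q[OF Suc(2), of t] by presburger+
  then show ?case using Suc by simp
qed (simp add: P_0 Q_0)

lemma adapted_P: "s \<le> t \<Longrightarrow> adapted t (\<lambda>\<omega>. of_int (P s \<omega>))"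
proof -
  assume "s \<le> t"
  have [measurable]: "P s \<in> measurable (F t) (count_space UNIV)"
    by (rule measurable_F_mono[OF \<open>s \<le> t\<close> measurable_P])
  have "\<bar>real_of_int (P s \<omega>)\<bar> \<le> real s" if "\<omega> \<in> space M" for \<omega>
    using abs_P_le[OF that, of s] by linarith
  then show ?thesis by (auto simp: adapted_def)
qed

lemma measurable_alive:
  "(\<lambda>\<omega>. alive m (\<lambda>t. P t \<omega>) j) \<in> measurable (F (4 ^ m + j)) (count_space UNIV)"
proof -
  have P: "P i \<in> measurable (F (4 ^ m + j)) (count_space UNIV)" if "i \<le> 4 ^ m + j" for i
    by (rule measurable_F_mono[OF that measurable_P])
  have "Measurable.pred (F (4 ^ m + j)) (\<lambda>\<omega>. \<forall>i\<in>{..j}. \<bar>P (4 ^ m + i) \<omega> - P (4 ^ m) \<omega>\<bar> < 8 * 2 ^ m)"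
  proof (rule pred_intros_finite(3))
    fix i assume "i \<in> {..j}"
    then have "4 ^ m + i \<le> 4 ^ m + j" by auto
    from measurable_count_space_combine[where f="\<lambda>x y. \<bar>x - y\<bar> < 8 * 2 ^ m", OF P[OF this] P[OF le_add1]]
    show "Measurable.pred (F (4 ^ m + j)) (\<lambda>\<omega>. \<bar>P (4 ^ m + i) \<omega> - P (4 ^ m) \<omega>\<bar> < 8 * 2 ^ m)" .
  qed (rule finite_atMost)
  then show ?thesis unfolding alive_def atMost_iff Ball_def .
qed

lemma adapted_weight:
  assumes "j \<le> 3 * 4 ^ m"
  shows "adapted (4 ^ m + j) (\<lambda>\<omega>. weight m (\<lambda>t. P t \<omega>) j)"
proof -
  have P [measurable]: "P (4 ^ m + j) \<in> measurable (F (4 ^ m + j)) (count_space UNIV)"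
    "P (4 ^ m) \<in> measurable (F (4 ^ m + j)) (count_space UNIV)"
    by (rule measurable_F_mono[OF _ measurable_P], simp)+
  note [measurable] = measurable_alive[of m j]
  have "(\<lambda>\<omega>. weight m (\<lambda>t. P t \<omega>) j) \<in> borel_measurable (F (4 ^ m + j))"
    unfolding weight_def by measurable
  moreover have "\<bar>weight m (\<lambda>t. P t \<omega>) j\<bar> \<le> 10 / 9" for \<omega>
    using weight_le[OF assms] weight_nonneg by (simp add: abs_of_nonneg)
  ultimately show ?thesis unfolding adapted_def by blast
qed

lemma adapted_slope:
  assumes "j < 3 * 4 ^ m"
  shows "adapted (4 ^ m + j) (\<lambda>\<omega>. slope m (\<lambda>t. P t \<omega>) j)"
proof -
  have P [measurable]: "P (4 ^ m + j) \<in> measurable (F (4 ^ m + j)) (count_space UNIV)"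
    "P (4 ^ m) \<in> measurable (F (4 ^ m + j)) (count_space UNIV)"
    by (rule measurable_F_mono[OF _ measurable_P], simp)+
  note [measurable] = measurable_alive[of m j]
  have "(\<lambda>\<omega>. slope m (\<lambda>t. P t \<omega>) j) \<in> borel_measurable (F (4 ^ m + j))"
    unfolding slope_def by measurable
  moreover have "\<bar>slope m (\<lambda>t. P t \<omega>) j\<bar> \<le> 5 / 18 / 2 ^ m" for \<omega>
    using abs_slope_le[OF assms] by simp
  ultimately show ?thesis unfolding adapted_def by blast
qed

lemma adapted_total_weight: "l \<le> n \<Longrightarrow> adapted (4 ^ n) (\<lambda>\<omega>. total_weight l n (\<lambda>t. P t \<omega>))"
proof (induction rule: dec_induct)
  case base
  show ?case by (simp add: total_weight_def adapted_const)
next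
  case (step n)
  then show ?case
    using adapted_mult[OF adapted_mono[OF _ step(3), of "4 * 4 ^ n"] adapted_weight[of "3 * 4 ^ n" n, simplified]]
    by (simp add: total_weight_Suc)
qed

lemma weight_Suc_P:
  assumes "\<omega> \<in> space M"
  shows "weight m (\<lambda>t. P t \<omega>) (Suc j) = weight m (\<lambda>t. P t \<omega>) j
     + slope m (\<lambda>t. P t \<omega>) j * of_int (P (Suc (4 ^ m + j)) \<omega> - P (4 ^ m + j) \<omega>)"
  using weight_Suc[of "\<lambda>t. P t \<omega>" m j] step_P[OF assms] by (simp add: mult.commute)

lemma expectation_step_P: "adapted t Y \<Longrightarrow> expectation (\<lambda>\<omega>. Y \<omega> * of_int (P (Suc t) \<omega> - P t \<omega>)) = 0"
  using mean_P unfolding adapted_def by blast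

lemma expectation_step_Q: "adapted t Y \<Longrightarrow> expectation (\<lambda>\<omega>. Y \<omega> * of_int (Q (Suc t) \<omega> - Q t \<omega>)) = 0"
  using mean_Q unfolding adapted_def by blast

text \<open>The martingale property: the increment is \<open>slope\<close> times the next step, and
  both \<open>slope\<close> and Y are known before that step. Testing against Y says that the
  conditional mean given the past of the window is 1.\<close>

lemma expectation_weight:
  assumes Y: "adapted (4 ^ m) Y" and "j \<le> 3 * 4 ^ m"
  shows "expectation (\<lambda>\<omega>. Y \<omega> * weight m (\<lambda>t. P t \<omega>) j) = expectation Y"
  using assms(2)
proof (induction j)
  case 0
  show ?case by (simp add: weight_0)
next
  case (Suc j)
  have Yj: "adapted (4 ^ m + j) Y" using adapted_mono[OF _ Y] by simp
  have a: "adapted (4 ^ m + j) (\<lambda>\<omega>. Y \<omega> * slope m (\<lambda>t. P t \<omega>) j)"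
    using Suc by (intro adapted_mult Yj adapted_slope) simp
  have i1: "integrable M (\<lambda>\<omega>. Y \<omega> * weight m (\<lambda>t. P t \<omega>) j)"
    using Suc by (intro adapted_integrable[of "4 ^ m + j"] adapted_mult Yj adapted_weight) simp
  have s: "adapted (Suc (4 ^ m + j)) (\<lambda>\<omega>. real_of_int (P (Suc (4 ^ m + j)) \<omega> - P (4 ^ m + j) \<omega>))"
    unfolding of_int_diff by (intro adapted_diff adapted_P) auto
  have i2: "integrable M (\<lambda>\<omega>. Y \<omega> * slope m (\<lambda>t. P t \<omega>) j * of_int (P (Suc (4 ^ m + j)) \<omega> - P (4 ^ m + j) \<omega>))"
    by (rule adapted_integrable[OF adapted_mult[OF adapted_mono[OF _ a] s]]) simp
  have "expectation (\<lambda>\<omega>. Y \<omega> * weight m (\<lambda>t. P t \<omega>) (Suc j))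
      = expectation (\<lambda>\<omega>. Y \<omega> * weight m (\<lambda>t. P t \<omega>) j
         + Y \<omega> * slope m (\<lambda>t. P t \<omega>) j * of_int (P (Suc (4 ^ m + j)) \<omega> - P (4 ^ m + j) \<omega>))"
    by (intro Bochner_Integration.integral_cong) (auto simp: weight_Suc_P distrib_left mult.assoc)
  also have "\<dots> = expectation (\<lambda>\<omega>. Y \<omega> * weight m (\<lambda>t. P t \<omega>) j)"
    using Bochner_Integration.integral_add[OF i1 i2] expectation_step_P[OF a] by simp
  finally show ?case using Suc by simp
qed

text \<open>Windows are integrated out from the last one down. A general Y is kept in order to
  remove only the windows after an event of interest.\<close>

lemma expectation_total_weight:
  assumes "l \<le> n" and Y: "adapted (4 ^ l) Y"
  shows "expectation (\<lambda>\<omega>. Y \<omega> * total_weight l n (\<lambda>t. P t \<omega>)) = expectation Y"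
  using assms(1)
proof (induction rule: dec_induct)
  case base
  show ?case by (simp add: total_weight_def)
next
  case (step n)
  have "adapted (4 ^ n) (\<lambda>\<omega>. Y \<omega> * total_weight l n (\<lambda>t. P t \<omega>))"
    using step by (intro adapted_mult adapted_total_weight adapted_mono[OF _ Y]) auto
  from expectation_weight[OF this order_refl] step show ?case
    by (simp add: total_weight_Suc mult.assoc)
qed


section \<open>Meetings of two walks and the joint mean of their weights\<close>

abbreviation step_of_P :: "nat \<Rightarrow> 'w \<Rightarrow> real" where
  "step_of_P t \<omega> \<equiv> of_int (P (Suc t) \<omega> - P t \<omega>)"

abbreviation step_of_Q :: "nat \<Rightarrow> 'w \<Rightarrow> real" where
  "step_of_Q t \<omega> \<equiv> of_int (Q (Suc t) \<omega> - Q t \<omega>)"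

abbreviation gap_PQ :: "nat \<Rightarrow> 'w \<Rightarrow> real" where
  "gap_PQ t \<omega> \<equiv> of_int (P t \<omega>) - of_int (Q t \<omega>)"

abbreviation meet :: "nat \<Rightarrow> 'w \<Rightarrow> real" where
  "meet t \<omega> \<equiv> of_bool (P t \<omega> = Q t \<omega>)"

lemma adapted_Q: "s \<le> t \<Longrightarrow> adapted t (\<lambda>\<omega>. of_int (Q s \<omega>))"
  by (rule walk_pair.adapted_P[OF swap_pair, unfolded walk_pair.adapted_def[OF swap_pair], folded adapted_def])

lemma adapted_weight_Q:
  "j \<le> 3 * 4 ^ m \<Longrightarrow> adapted (4 ^ m + j) (\<lambda>\<omega>. weight m (\<lambda>t. Q t \<omega>) j)"
  by (rule walk_pair.adapted_weight[OF swap_pair, unfolded walk_pair.adapted_def[OF swap_pair], folded adapted_def])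

lemma adapted_slope_Q:
  "j < 3 * 4 ^ m \<Longrightarrow> adapted (4 ^ m + j) (\<lambda>\<omega>. slope m (\<lambda>t. Q t \<omega>) j)"
  by (rule walk_pair.adapted_slope[OF swap_pair, unfolded walk_pair.adapted_def[OF swap_pair], folded adapted_def])

lemma adapted_total_weight_Q: "l \<le> n \<Longrightarrow> adapted (4 ^ n) (\<lambda>\<omega>. total_weight l n (\<lambda>t. Q t \<omega>))"
  by (rule walk_pair.adapted_total_weight[OF swap_pair, unfolded walk_pair.adapted_def[OF swap_pair], folded adapted_def])

lemma weight_Suc_Q:
  assumes "\<omega> \<in> space M"
  shows "weight m (\<lambda>t. Q t \<omega>) (Suc j) = weight m (\<lambda>t. Q t \<omega>) j
     + slope m (\<lambda>t. Q t \<omega>) j * step_of_Q (4 ^ m + j) \<omega>"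
  by (rule walk_pair.weight_Suc_P[OF swap_pair assms])

lemma adapted_gap: "s \<le> t \<Longrightarrow> adapted t (gap_PQ s)"
  by (intro adapted_diff adapted_P adapted_Q)

lemma adapted_meet: "adapted t (meet t)"
proof -
  note [measurable] = measurable_P[of t] measurable_Q[of t]
  have "meet t \<in> borel_measurable (F t)" by measurable
  then show ?thesis unfolding adapted_def by (auto intro!: exI[of _ 1])
qed

text \<open>A function of both walks after one step is affine in each of the two signs. The linear
  terms average out, and the product of the signs is felt only at a meeting, with factor
  rho.\<close>

lemma expectation_expand:
  assumes "adapted t A" "adapted t B" "adapted t C" "adapted t E"
  shows "expectation (\<lambda>\<omega>. A \<omega> + B \<omega> * step_of_P t \<omega> + C \<omega> * step_of_Q t \<omega>
           + E \<omega> * (step_of_P t \<omega> * step_of_Q t \<omega>))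
       = expectation A + rho * expectation (\<lambda>\<omega>. E \<omega> * meet t \<omega>)"
proof -
  have sP: "adapted (Suc t) (step_of_P t)"
    unfolding of_int_diff by (intro adapted_diff adapted_P) auto
  have sQ: "adapted (Suc t) (step_of_Q t)"
    unfolding of_int_diff by (intro adapted_diff adapted_Q) auto
  note up = assms[THEN adapted_mono[OF le_SucI[OF order_refl]]]
  have i: "integrable M A" "integrable M (\<lambda>\<omega>. B \<omega> * step_of_P t \<omega>)"
    "integrable M (\<lambda>\<omega>. C \<omega> * step_of_Q t \<omega>)"
    "integrable M (\<lambda>\<omega>. E \<omega> * (step_of_P t \<omega> * step_of_Q t \<omega>))"
    by (rule adapted_integrable[OF up(1)] adapted_integrable[OF adapted_mult[OF up(2) sP]]
        adapted_integrable[OF adapted_mult[OF up(3) sQ]]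
        adapted_integrable[OF adapted_mult[OF up(4) adapted_mult[OF sP sQ]]])+
  have z: "expectation (\<lambda>\<omega>. B \<omega> * step_of_P t \<omega>) = 0" "expectation (\<lambda>\<omega>. C \<omega> * step_of_Q t \<omega>) = 0"
    "expectation (\<lambda>\<omega>. E \<omega> * (step_of_P t \<omega> * step_of_Q t \<omega>)) = rho * expectation (\<lambda>\<omega>. E \<omega> * meet t \<omega>)"
    using assms(4) covariance[of E t] unfolding adapted_def
    by (rule_tac expectation_step_P[OF assms(2)], rule_tac expectation_step_Q[OF assms(3)], blast)
  show ?thesis
    using i by (simp add: z del: of_int_diff)
qed

lemma unit_step_cases:
  "\<omega> \<in> space M \<Longrightarrow> step_of_P t \<omega> = 1 \<or> step_of_P t \<omega> = -1"
  "\<omega> \<in> space M \<Longrightarrow> step_of_Q t \<omega> = 1 \<or> step_of_Q t \<omega> = -1"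
  using step_P[of \<omega> t] step_Q[of \<omega> t] by (auto simp: abs_if split: if_splits)

text \<open>
  Tanaka's formula. Off the diagonal the difference is an even nonzero integer, which a pair of
  unit steps cannot carry across 0.
\<close>

lemma expectation_abs_gap_Suc:
  assumes Y: "adapted t Y"
  shows "expectation (\<lambda>\<omega>. Y \<omega> * \<bar>gap_PQ (Suc t) \<omega>\<bar>)
       = expectation (\<lambda>\<omega>. Y \<omega> * \<bar>gap_PQ t \<omega>\<bar>) + (1 - rho) * expectation (\<lambda>\<omega>. Y \<omega> * meet t \<omega>)"
proof -
  have g: "adapted t (gap_PQ t)" by (rule adapted_gap) simp
  have m: "adapted t (\<lambda>\<omega>. Y \<omega> * meet t \<omega>)" by (rule adapted_mult[OF Y adapted_meet])
  have a: "adapted t (\<lambda>\<omega>. Y \<omega> * \<bar>gap_PQ t \<omega>\<bar>)" by (rule adapted_mult[OF Y adapted_abs[OF g]])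
  have s: "adapted t (\<lambda>\<omega>. Y \<omega> * sgn (gap_PQ t \<omega>))" by (rule adapted_mult[OF Y adapted_sgn[OF g]])
  have "expectation (\<lambda>\<omega>. Y \<omega> * \<bar>gap_PQ (Suc t) \<omega>\<bar>) =
    expectation (\<lambda>\<omega>. (Y \<omega> * \<bar>gap_PQ t \<omega>\<bar> + Y \<omega> * meet t \<omega>)
      + (Y \<omega> * sgn (gap_PQ t \<omega>)) * step_of_P t \<omega> + (-1 * (Y \<omega> * sgn (gap_PQ t \<omega>))) * step_of_Q t \<omega>
      + (-1 * (Y \<omega> * meet t \<omega>)) * (step_of_P t \<omega> * step_of_Q t \<omega>))"
  proof (rule Bochner_Integration.integral_cong[OF refl])
    fix \<omega> assume \<omega>: "\<omega> \<in> space M"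
    define x where "x = P t \<omega>"
    define y where "y = Q t \<omega>"
    define a where "a = P (Suc t) \<omega> - P t \<omega>"
    define b where "b = Q (Suc t) \<omega> - Q t \<omega>"
    have ab: "a = 1 \<or> a = -1" "b = 1 \<or> b = -1"
      using step_P[OF \<omega>, of t] step_Q[OF \<omega>, of t] unfolding a_def b_def by linarith+
    have S: "P (Suc t) \<omega> = x + a" "Q (Suc t) \<omega> = y + b" by (auto simp: x_def y_def a_def b_def)
    have "even (x - y)" using even_diff[OF \<omega>] by (simp add: x_def y_def)
    then have "x = y \<or> x - y \<ge> 2 \<or> x - y \<le> -2" by presburger
    \<comment> \<open>For equal positions this is |a - b| = 1 - a * b for signs. Otherwise |x - y|
      >= 2 >= |a - b|, so the sign of the difference can be kept.\<close>
    then have "\<bar>(real_of_int x + a) - (real_of_int y + b)\<bar> = \<bar>real_of_int x - y\<bar> + of_bool (x = y)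
      + sgn (real_of_int x - y) * a - sgn (real_of_int x - y) * b - of_bool (x = y) * (a * b)"
      using ab by (auto simp: sgn_if)
    then have e: "\<bar>gap_PQ (Suc t) \<omega>\<bar> = \<bar>gap_PQ t \<omega>\<bar> + meet t \<omega>
      + sgn (gap_PQ t \<omega>) * step_of_P t \<omega> - sgn (gap_PQ t \<omega>) * step_of_Q t \<omega>
      - meet t \<omega> * (step_of_P t \<omega> * step_of_Q t \<omega>)"
      unfolding a_def[symmetric] b_def[symmetric] x_def[symmetric] y_def[symmetric] S by simp
    have alg: "z * (A + c + s * p - s * q - c * (p * q))
      = (z * A + z * c) + (z * s) * p + (-1 * (z * s)) * q + (-1 * (z * c)) * (p * q)"
      for z A c s p q :: real by (simp add: algebra_simps)
    show "Y \<omega> * \<bar>gap_PQ (Suc t) \<omega>\<bar> = (Y \<omega> * \<bar>gap_PQ t \<omega>\<bar> + Y \<omega> * meet t \<omega>)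
      + (Y \<omega> * sgn (gap_PQ t \<omega>)) * step_of_P t \<omega> + (-1 * (Y \<omega> * sgn (gap_PQ t \<omega>))) * step_of_Q t \<omega>
      + (-1 * (Y \<omega> * meet t \<omega>)) * (step_of_P t \<omega> * step_of_Q t \<omega>)"
      unfolding e by (rule alg)
  qed
  also have "\<dots> = expectation (\<lambda>\<omega>. Y \<omega> * \<bar>gap_PQ t \<omega>\<bar> + Y \<omega> * meet t \<omega>)
      + rho * expectation (\<lambda>\<omega>. -1 * (Y \<omega> * meet t \<omega>) * meet t \<omega>)"
    by (rule expectation_expand[OF adapted_add[OF a m] s adapted_mult[OF adapted_const s]
        adapted_mult[OF adapted_const m]])
  also have "expectation (\<lambda>\<omega>. -1 * (Y \<omega> * meet t \<omega>) * meet t \<omega>) = - expectation (\<lambda>\<omega>. Y \<omega> * meet t \<omega>)"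
    unfolding Bochner_Integration.integral_minus[symmetric]
    by (intro Bochner_Integration.integral_cong) auto
  finally show ?thesis
    using adapted_integrable[OF a] adapted_integrable[OF m] by (simp add: algebra_simps)
qed

text \<open>The square gains 2 - 2 * a * b plus terms linear in the steps a, b. As rho >= 0, the
  correlation only slows the separation and may be dropped.\<close>

lemma expectation_square_gap_le:
  assumes Y: "adapted u Y" and pos: "\<And>\<omega>. \<omega> \<in> space M \<Longrightarrow> 0 \<le> Y \<omega>"
  shows "expectation (\<lambda>\<omega>. Y \<omega> * (gap_PQ (u + j) \<omega> - gap_PQ u \<omega>)\<^sup>2) \<le> 2 * real j * expectation Y"
proof (induction j)
  case (Suc j)
  let ?t = "u + j"
  let ?d = "\<lambda>\<omega>. gap_PQ ?t \<omega> - gap_PQ u \<omega>"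
  have Yt: "adapted ?t Y" by (rule adapted_mono[OF _ Y]) simp
  have d: "adapted ?t ?d" by (intro adapted_diff[OF adapted_gap adapted_gap]) auto
  have d2: "adapted ?t (\<lambda>\<omega>. Y \<omega> * (?d \<omega>)\<^sup>2)" by (rule adapted_mult[OF Yt adapted_power2[OF d]])
  have Yd: "adapted ?t (\<lambda>\<omega>. Y \<omega> * ?d \<omega>)" by (rule adapted_mult[OF Yt d])
  have "expectation (\<lambda>\<omega>. Y \<omega> * (gap_PQ (Suc ?t) \<omega> - gap_PQ u \<omega>)\<^sup>2) =
    expectation (\<lambda>\<omega>. (Y \<omega> * (?d \<omega>)\<^sup>2 + 2 * Y \<omega>)
      + (2 * (Y \<omega> * ?d \<omega>)) * step_of_P ?t \<omega> + (-2 * (Y \<omega> * ?d \<omega>)) * step_of_Q ?t \<omega>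
      + (-2 * Y \<omega>) * (step_of_P ?t \<omega> * step_of_Q ?t \<omega>))"
  proof (rule Bochner_Integration.integral_cong[OF refl])
    fix \<omega> assume \<omega>: "\<omega> \<in> space M"
    define a where "a = step_of_P ?t \<omega>"
    define b where "b = step_of_Q ?t \<omega>"
    have "a * a = 1" "b * b = 1"
      using unit_step_cases[OF \<omega>, of ?t] unfolding a_def b_def by auto
    moreover have "gap_PQ (Suc ?t) \<omega> - gap_PQ u \<omega> = ?d \<omega> + a - b" by (simp add: a_def b_def)
    moreover have "(x + a - b)\<^sup>2 = x\<^sup>2 + a * a + b * b + 2 * x * a - 2 * x * b - 2 * (a * b)" for x :: real
      by (simp add: power2_eq_square algebra_simps)
    ultimately have e: "(gap_PQ (Suc ?t) \<omega> - gap_PQ u \<omega>)\<^sup>2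
      = (?d \<omega>)\<^sup>2 + 1 + 1 + 2 * ?d \<omega> * a - 2 * ?d \<omega> * b - 2 * (a * b)" by metis
    show "Y \<omega> * (gap_PQ (Suc ?t) \<omega> - gap_PQ u \<omega>)\<^sup>2 =
      (Y \<omega> * (?d \<omega>)\<^sup>2 + 2 * Y \<omega>)
      + (2 * (Y \<omega> * ?d \<omega>)) * step_of_P ?t \<omega> + (-2 * (Y \<omega> * ?d \<omega>)) * step_of_Q ?t \<omega>
      + (-2 * Y \<omega>) * (step_of_P ?t \<omega> * step_of_Q ?t \<omega>)"
      unfolding e a_def[symmetric] b_def[symmetric] by algebra
  qed
  also have "\<dots> = expectation (\<lambda>\<omega>. Y \<omega> * (?d \<omega>)\<^sup>2 + 2 * Y \<omega>)
      + rho * expectation (\<lambda>\<omega>. -2 * Y \<omega> * meet ?t \<omega>)"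
    by (rule expectation_expand[OF adapted_add[OF d2 adapted_mult[OF adapted_const Yt]]
        adapted_mult[OF adapted_const Yd] adapted_mult[OF adapted_const Yd] adapted_mult[OF adapted_const Yt]])
  also have "\<dots> = expectation (\<lambda>\<omega>. Y \<omega> * (?d \<omega>)\<^sup>2) + 2 * expectation Y
      - 2 * (rho * expectation (\<lambda>\<omega>. Y \<omega> * meet ?t \<omega>))"
    using adapted_integrable[OF d2] adapted_integrable[OF Y] by (simp add: mult.assoc)
  also have "\<dots> \<le> expectation (\<lambda>\<omega>. Y \<omega> * (?d \<omega>)\<^sup>2) + 2 * expectation Y"
    using rho_bounds(1) pos by (simp add: integral_nonneg_AE AE_I2)
  also have "\<dots> \<le> 2 * real j * expectation Y + 2 * expectation Y" using Suc by simp
  finally show ?case by (simp add: algebra_simps)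
qed simp

text \<open>Summing Tanaka's formula over the window bounds the meetings by the growth of the
  absolute difference, hence by its increment over the window. Only this increment is known to be of
  order 2^m under the weight Y; the difference at the start need not be.\<close>

lemma expected_meetings_le:
  assumes Y: "adapted (4 ^ m) Y" and pos: "\<And>\<omega>. \<omega> \<in> space M \<Longrightarrow> 0 \<le> Y \<omega>"
  shows "(1 - rho) * (\<Sum>j<3 * 4 ^ m. expectation (\<lambda>\<omega>. Y \<omega> * meet (4 ^ m + j) \<omega>))
    \<le> 5 / 2 * 2 ^ m * expectation Y"
proof -
  \<comment> \<open>The scale \<open>?s\<close> is a convenient value near the root 6^(1/2) * 2^m of
    the mean square bound. With x <= x^2 / (2 * s) + s / 2 it yields 2^m + 3/2 * 2^m, whence the
    5/2.\<close>
  let ?u = "4 ^ m :: nat" and ?T = "3 * 4 ^ m :: nat" and ?s = "3 * 2 ^ m :: real"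
  let ?d = "\<lambda>\<omega>. gap_PQ (?u + ?T) \<omega> - gap_PQ ?u \<omega>"
  have YT: "adapted (?u + ?T) Y" by (rule adapted_mono[OF _ Y]) simp
  have d: "adapted (?u + ?T) ?d" by (intro adapted_diff[OF adapted_gap adapted_gap]) auto
  have d2: "adapted (?u + ?T) (\<lambda>\<omega>. Y \<omega> * (?d \<omega>)\<^sup>2)" by (rule adapted_mult[OF YT adapted_power2[OF d]])
  have tel: "expectation (\<lambda>\<omega>. Y \<omega> * \<bar>gap_PQ (?u + k) \<omega>\<bar>) = expectation (\<lambda>\<omega>. Y \<omega> * \<bar>gap_PQ ?u \<omega>\<bar>)
      + (1 - rho) * (\<Sum>j<k. expectation (\<lambda>\<omega>. Y \<omega> * meet (?u + j) \<omega>))" for k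
  proof (induction k)
    case (Suc k)
    have "adapted (?u + k) Y" by (rule adapted_mono[OF _ Y]) simp
    from expectation_abs_gap_Suc[OF this] Suc show ?case by (simp add: distrib_left)
  qed simp
  have iA: "integrable M (\<lambda>\<omega>. Y \<omega> * \<bar>gap_PQ (?u + ?T) \<omega>\<bar>)"
    by (rule adapted_integrable[OF adapted_mult[OF YT adapted_abs[OF adapted_gap]]]) simp
  have iB: "integrable M (\<lambda>\<omega>. Y \<omega> * \<bar>gap_PQ ?u \<omega>\<bar>)"
    by (rule adapted_integrable[OF adapted_mult[OF Y adapted_abs[OF adapted_gap]]]) simp
  have iC: "integrable M (\<lambda>\<omega>. Y \<omega> * (?d \<omega>)\<^sup>2 / (2 * ?s) + Y \<omega> * (?s / 2))"
    using adapted_integrable[OF d2] adapted_integrable[OF Y] by simp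
  have "(1 - rho) * (\<Sum>j<?T. expectation (\<lambda>\<omega>. Y \<omega> * meet (?u + j) \<omega>))
      = expectation (\<lambda>\<omega>. Y \<omega> * \<bar>gap_PQ (?u + ?T) \<omega>\<bar> - Y \<omega> * \<bar>gap_PQ ?u \<omega>\<bar>)"
    using tel[of ?T] iA iB by simp
  also have "\<dots> \<le> expectation (\<lambda>\<omega>. Y \<omega> * (?d \<omega>)\<^sup>2 / (2 * ?s) + Y \<omega> * (?s / 2))"
  proof (rule integral_mono[OF _ iC])
    show "integrable M (\<lambda>\<omega>. Y \<omega> * \<bar>gap_PQ (?u + ?T) \<omega>\<bar> - Y \<omega> * \<bar>gap_PQ ?u \<omega>\<bar>)"
      using iA iB by (rule Bochner_Integration.integrable_diff)
    fix \<omega> assume \<omega>: "\<omega> \<in> space M"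
    have am: "x \<le> x\<^sup>2 / (2 * ?s) + ?s / 2" for x :: real
    proof -
      have "2 * x * ?s \<le> x\<^sup>2 + ?s\<^sup>2" by (rule sum_squares_bound)
      moreover have "0 < ?s" by simp
      ultimately show ?thesis by (simp add: field_simps power2_eq_square)
    qed
    have "\<bar>gap_PQ (?u + ?T) \<omega>\<bar> - \<bar>gap_PQ ?u \<omega>\<bar> \<le> \<bar>?d \<omega>\<bar>" by (rule abs_triangle_ineq2)
    also have "\<dots> \<le> (?d \<omega>)\<^sup>2 / (2 * ?s) + ?s / 2" using am[of "\<bar>?d \<omega>\<bar>"] by simp
    finally have "Y \<omega> * (\<bar>gap_PQ (?u + ?T) \<omega>\<bar> - \<bar>gap_PQ ?u \<omega>\<bar>) \<le> Y \<omega> * ((?d \<omega>)\<^sup>2 / (2 * ?s) + ?s / 2)"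
      using pos[OF \<omega>] by (rule mult_left_mono)
    then show "Y \<omega> * \<bar>gap_PQ (?u + ?T) \<omega>\<bar> - Y \<omega> * \<bar>gap_PQ ?u \<omega>\<bar> \<le> Y \<omega> * (?d \<omega>)\<^sup>2 / (2 * ?s) + Y \<omega> * (?s / 2)"
      by (simp only: right_diff_distrib distrib_left times_divide_eq_right)
  qed
  also have "\<dots> = expectation (\<lambda>\<omega>. Y \<omega> * (?d \<omega>)\<^sup>2) / (2 * ?s) + expectation Y * (?s / 2)"
    using adapted_integrable[OF d2] adapted_integrable[OF Y] by simp
  also have "\<dots> \<le> (2 * real ?T * expectation Y) / (2 * ?s) + expectation Y * (?s / 2)"
    using expectation_square_gap_le[OF Y pos, of ?T] by (intro add_right_mono divide_right_mono) auto
  also have "\<dots> = 5 / 2 * 2 ^ m * expectation Y"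
  proof -
    have "(4::real) ^ m = 2 ^ m * 2 ^ m" by (simp add: power_mult_distrib[symmetric])
    then show ?thesis by (simp add: field_simps)
  qed
  finally show ?thesis .
qed

text \<open>The product of the two weights changes in mean only through the product of the slopes at
  a meeting. The factor rho <= 1 is then discarded.\<close>

lemma expectation_weight_pair_le_meetings:
  assumes Y: "adapted (4 ^ m) Y" and pos: "\<And>\<omega>. \<omega> \<in> space M \<Longrightarrow> 0 \<le> Y \<omega>" and "k \<le> 3 * 4 ^ m"
  shows "expectation (\<lambda>\<omega>. Y \<omega> * (weight m (\<lambda>t. P t \<omega>) k * weight m (\<lambda>t. Q t \<omega>) k))
     \<le> expectation Y + (5 / 18 / 2 ^ m)\<^sup>2 * (\<Sum>j<k. expectation (\<lambda>\<omega>. Y \<omega> * meet (4 ^ m + j) \<omega>))"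
  using assms(3)
proof (induction k)
  case 0
  show ?case by (simp add: weight_0)
next
  case (Suc k)
  let ?t = "4 ^ m + k"
  define wP where "wP = (\<lambda>\<omega>. weight m (\<lambda>t. P t \<omega>) k)"
  define wQ where "wQ = (\<lambda>\<omega>. weight m (\<lambda>t. Q t \<omega>) k)"
  define sP where "sP = (\<lambda>\<omega>. slope m (\<lambda>t. P t \<omega>) k)"
  define sQ where "sQ = (\<lambda>\<omega>. slope m (\<lambda>t. Q t \<omega>) k)"
  have ad: "adapted ?t Y" "adapted ?t wP" "adapted ?t wQ" "adapted ?t sP" "adapted ?t sQ"
    using Suc adapted_mono[OF _ Y, of ?t] adapted_weight[of k m] adapted_weight_Q[of k m]
      adapted_slope[of k m] adapted_slope_Q[of k m]
    unfolding wP_def wQ_def sP_def sQ_def by auto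
  have bd: "\<bar>sP \<omega>\<bar> \<le> 5 / 18 / 2 ^ m" "\<bar>sQ \<omega>\<bar> \<le> 5 / 18 / 2 ^ m" for \<omega>
    using Suc abs_slope_le[of k m] unfolding sP_def sQ_def by auto
  have "expectation (\<lambda>\<omega>. Y \<omega> * (weight m (\<lambda>t. P t \<omega>) (Suc k) * weight m (\<lambda>t. Q t \<omega>) (Suc k)))
    = expectation (\<lambda>\<omega>. Y \<omega> * (wP \<omega> * wQ \<omega>) + (Y \<omega> * (sP \<omega> * wQ \<omega>)) * step_of_P ?t \<omega>
       + (Y \<omega> * (wP \<omega> * sQ \<omega>)) * step_of_Q ?t \<omega> + (Y \<omega> * (sP \<omega> * sQ \<omega>)) * (step_of_P ?t \<omega> * step_of_Q ?t \<omega>))"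
  proof (rule Bochner_Integration.integral_cong[OF refl])
    fix \<omega> assume \<omega>: "\<omega> \<in> space M"
    show "Y \<omega> * (weight m (\<lambda>t. P t \<omega>) (Suc k) * weight m (\<lambda>t. Q t \<omega>) (Suc k))
      = Y \<omega> * (wP \<omega> * wQ \<omega>) + (Y \<omega> * (sP \<omega> * wQ \<omega>)) * step_of_P ?t \<omega>
       + (Y \<omega> * (wP \<omega> * sQ \<omega>)) * step_of_Q ?t \<omega> + (Y \<omega> * (sP \<omega> * sQ \<omega>)) * (step_of_P ?t \<omega> * step_of_Q ?t \<omega>)"
      unfolding weight_Suc_P[OF \<omega>] weight_Suc_Q[OF \<omega>] wP_def wQ_def sP_def sQ_def by algebra
  qed
  also have "\<dots> = expectation (\<lambda>\<omega>. Y \<omega> * (wP \<omega> * wQ \<omega>))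
      + rho * expectation (\<lambda>\<omega>. Y \<omega> * (sP \<omega> * sQ \<omega>) * meet ?t \<omega>)"
    using ad by (intro expectation_expand adapted_mult)
  also have "\<dots> \<le> expectation (\<lambda>\<omega>. Y \<omega> * (wP \<omega> * wQ \<omega>))
      + 1 * expectation (\<lambda>\<omega>. (5 / 18 / 2 ^ m)\<^sup>2 * (Y \<omega> * meet ?t \<omega>))"
  proof -
    have "rho * expectation (\<lambda>\<omega>. Y \<omega> * (sP \<omega> * sQ \<omega>) * meet ?t \<omega>)
      \<le> rho * expectation (\<lambda>\<omega>. (5 / 18 / 2 ^ m)\<^sup>2 * (Y \<omega> * meet ?t \<omega>))"
    proof (intro mult_left_mono integral_mono rho_bounds)
      show "integrable M (\<lambda>\<omega>. Y \<omega> * (sP \<omega> * sQ \<omega>) * meet ?t \<omega>)"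
        using ad by (intro adapted_integrable[of ?t] adapted_mult adapted_meet)
      show "integrable M (\<lambda>\<omega>. (5 / 18 / 2 ^ m)\<^sup>2 * (Y \<omega> * meet ?t \<omega>))"
        using ad by (intro adapted_integrable[of ?t] adapted_mult adapted_meet adapted_const)
      fix \<omega> assume \<omega>: "\<omega> \<in> space M"
      have "sP \<omega> * sQ \<omega> \<le> \<bar>sP \<omega>\<bar> * \<bar>sQ \<omega>\<bar>" by (metis abs_ge_self abs_mult)
      also have "\<dots> \<le> (5 / 18 / 2 ^ m) * (5 / 18 / 2 ^ m)" using bd by (intro mult_mono) auto
      finally have "Y \<omega> * (sP \<omega> * sQ \<omega>) * meet ?t \<omega> \<le> Y \<omega> * (5 / 18 / 2 ^ m)\<^sup>2 * meet ?t \<omega>"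
        unfolding power2_eq_square using pos[OF \<omega>] by (intro mult_right_mono mult_left_mono) auto
      then show "Y \<omega> * (sP \<omega> * sQ \<omega>) * meet ?t \<omega> \<le> (5 / 18 / 2 ^ m)\<^sup>2 * (Y \<omega> * meet ?t \<omega>)"
        by (simp only: mult_ac)
    qed
    also have "\<dots> \<le> 1 * expectation (\<lambda>\<omega>. (5 / 18 / 2 ^ m)\<^sup>2 * (Y \<omega> * meet ?t \<omega>))"
      using rho_bounds pos by (intro mult_right_mono integral_nonneg_AE) auto
    finally show ?thesis by simp
  qed
  also have "\<dots> \<le> expectation Y + (5 / 18 / 2 ^ m)\<^sup>2 * (\<Sum>j<k. expectation (\<lambda>\<omega>. Y \<omega> * meet (4 ^ m + j) \<omega>))
      + 1 * expectation (\<lambda>\<omega>. (5 / 18 / 2 ^ m)\<^sup>2 * (Y \<omega> * meet ?t \<omega>))"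
    using Suc unfolding wP_def wQ_def by simp
  finally show ?case by (simp add: distrib_left del: power_divide)
qed

text \<open>Two bounds are needed because the meeting estimate is poor when 2^m d is small; there
  the crude bound takes over. In the application rho = exp (-d), so 1 - rho is comparable to
  d.\<close>

lemma expectation_weight_pair_le:
  assumes Y: "adapted (4 ^ m) Y" and pos: "\<And>\<omega>. \<omega> \<in> space M \<Longrightarrow> 0 \<le> Y \<omega>"
    and d: "0 < d" "d / 2 \<le> 1 - rho"
  shows "expectation (\<lambda>\<omega>. Y \<omega> * (weight m (\<lambda>t. P t \<omega>) (3 * 4 ^ m) * weight m (\<lambda>t. Q t \<omega>) (3 * 4 ^ m)))
     \<le> expectation Y * min (10 / 9) (1 + 1 / 2 ^ m / d)"
proof -
  let ?wP = "\<lambda>\<omega>. weight m (\<lambda>t. P t \<omega>) (3 * 4 ^ m)" and ?wQ = "\<lambda>\<omega>. weight m (\<lambda>t. Q t \<omega>) (3 * 4 ^ m)"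
  let ?m = "\<Sum>j<3 * 4 ^ m. expectation (\<lambda>\<omega>. Y \<omega> * meet (4 ^ m + j) \<omega>)"
  have EY: "0 \<le> expectation Y" using pos by (intro integral_nonneg_AE) auto
  have m0: "0 \<le> ?m" using pos by (intro sum_nonneg integral_nonneg_AE) auto
  have ad: "adapted (4 ^ m + 3 * 4 ^ m) Y" "adapted (4 ^ m + 3 * 4 ^ m) ?wP" "adapted (4 ^ m + 3 * 4 ^ m) ?wQ"
    using adapted_mono[OF _ Y, of "4 ^ m + 3 * 4 ^ m"] adapted_weight[of "3 * 4 ^ m" m]
      adapted_weight_Q[of "3 * 4 ^ m" m] by auto
  \<comment> \<open>Crude bound: one weight is replaced by its supremum, the other still has mean
    1.\<close>
  have "expectation (\<lambda>\<omega>. Y \<omega> * (?wP \<omega> * ?wQ \<omega>)) \<le> expectation (\<lambda>\<omega>. (Y \<omega> * ?wP \<omega>) * (10 / 9))"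
  proof (rule integral_mono)
    show "integrable M (\<lambda>\<omega>. Y \<omega> * (?wP \<omega> * ?wQ \<omega>))"
      using ad by (intro adapted_integrable adapted_mult)
    show "integrable M (\<lambda>\<omega>. (Y \<omega> * ?wP \<omega>) * (10 / 9))"
      using ad by (intro adapted_integrable adapted_mult adapted_const)
    fix \<omega> assume "\<omega> \<in> space M"
    then show "Y \<omega> * (?wP \<omega> * ?wQ \<omega>) \<le> (Y \<omega> * ?wP \<omega>) * (10 / 9)"
      unfolding mult.assoc[symmetric] using pos
      by (intro mult_left_mono weight_le mult_nonneg_nonneg weight_nonneg) auto
  qed
  also have "\<dots> = expectation Y * (10 / 9)"
    using expectation_weight[OF Y order_refl] by simp
  finally have 1: "expectation (\<lambda>\<omega>. Y \<omega> * (?wP \<omega> * ?wQ \<omega>)) \<le> expectation Y * (10 / 9)" .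
  have "d / 2 * ?m \<le> (1 - rho) * ?m" using d m0 by (intro mult_right_mono) auto
  also have "\<dots> \<le> 5 / 2 * 2 ^ m * expectation Y" by (rule expected_meetings_le[OF Y pos])
  finally have "?m \<le> 5 * 2 ^ m * expectation Y / d" using d by (simp add: field_simps)
  then have "(5 / 18 / 2 ^ m)\<^sup>2 * ?m \<le> (5 / 18 / 2 ^ m)\<^sup>2 * (5 * 2 ^ m * expectation Y / d)"
    by (intro mult_left_mono) auto
  \<comment> \<open>Here (5/18)^2 * 5 = 125/324: a squared slope of order 4^-m times about 2^m / d
    meetings. The numerical factor is then rounded up to 1.\<close>
  also have "\<dots> = 125 / 324 * (expectation Y * (1 / 2 ^ m / d))"
    by (simp add: power2_eq_square field_simps)
  also have "\<dots> \<le> 1 * (expectation Y * (1 / 2 ^ m / d))"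
    using EY d by (intro mult_right_mono) auto
  finally have "expectation (\<lambda>\<omega>. Y \<omega> * (?wP \<omega> * ?wQ \<omega>)) \<le> expectation Y * (1 + 1 / 2 ^ m / d)"
    using expectation_weight_pair_le_meetings[OF Y pos order_refl] by (simp add: distrib_left)
  with 1 show ?thesis by (simp add: min_def)
qed

lemma expectation_total_weight_pair_le:
  assumes "l \<le> n" and d: "0 < d" "d / 2 \<le> 1 - rho"
  shows "expectation (\<lambda>\<omega>. total_weight l n (\<lambda>t. P t \<omega>) * total_weight l n (\<lambda>t. Q t \<omega>))
    \<le> 1 + 3 * sqrt (1 / 2 ^ l / d)"
proof -
  have "expectation (\<lambda>\<omega>. total_weight l n (\<lambda>t. P t \<omega>) * total_weight l n (\<lambda>t. Q t \<omega>))
    \<le> (\<Prod>m=l..<n. min (10 / 9) (1 + 1 / 2 ^ m / d))"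
    using assms(1)
  proof (induction rule: dec_induct)
    case base
    show ?case by (simp add: total_weight_def prob_space)
  next
    case (step n)
    let ?Y = "\<lambda>\<omega>. total_weight l n (\<lambda>t. P t \<omega>) * total_weight l n (\<lambda>t. Q t \<omega>)"
    have "adapted (4 ^ n) ?Y"
      using step by (intro adapted_mult adapted_total_weight adapted_total_weight_Q) auto
    then have "expectation (\<lambda>\<omega>. ?Y \<omega> * (weight n (\<lambda>t. P t \<omega>) (3 * 4 ^ n) * weight n (\<lambda>t. Q t \<omega>) (3 * 4 ^ n)))
        \<le> expectation ?Y * min (10 / 9) (1 + 1 / 2 ^ n / d)"
      using d by (intro expectation_weight_pair_le) (auto simp: total_weight_nonneg)
    also have "\<dots> \<le> (\<Prod>m=l..<n. min (10 / 9) (1 + 1 / 2 ^ m / d)) * min (10 / 9) (1 + 1 / 2 ^ n / d)"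
      using step d by (intro mult_right_mono) auto
    finally show ?case using step by (simp add: total_weight_Suc mult_ac)
  qed
  also have "\<dots> \<le> 1 + 3 * sqrt (1 / 2 ^ l / d)" by (rule prod_min_le[OF d(1)])
  finally show ?thesis .
qed

end

section \<open>Clocks and arrows\<close>

context prob_space
begin

lemma integrable_bounded:
  fixes Y :: "'a \<Rightarrow> real"
  assumes "Y \<in> borel_measurable M" "\<And>\<omega>. \<omega> \<in> space M \<Longrightarrow> \<bar>Y \<omega>\<bar> \<le> C"
  shows "integrable M Y"
  using assms by (intro integrable_const_bound[of _ C]) auto

lemma expectation_of_bool: "expectation (\<lambda>\<omega>. of_bool (Q \<omega>)) = prob {\<omega>\<in>space M. Q \<omega>}"
proof -
  have "expectation (\<lambda>\<omega>. of_bool (Q \<omega>)) = expectation (indicator {\<omega>\<in>space M. Q \<omega>})"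
    by (intro Bochner_Integration.integral_cong) (auto simp: indicator_def)
  also have "\<dots> = prob ({\<omega>\<in>space M. Q \<omega>} \<inter> space M)" by simp
  also have "{\<omega>\<in>space M. Q \<omega>} \<inter> space M = {\<omega>\<in>space M. Q \<omega>}" by auto
  finally show ?thesis .
qed

text \<open>Split according to the value of the index: pointwise only one term of the series is
  nonzero, and since |Z| <= 1 the probabilities dominate the terms, so sum and expectation may be
  exchanged. A spin has this form, being a mark read at a random ring count.\<close>

lemma expectation_random_index:
  fixes Z :: "nat \<Rightarrow> 'a \<Rightarrow> real"
  assumes N: "N \<in> measurable M (count_space UNIV)"
    and Z: "\<And>n. Z n \<in> borel_measurable M" "\<And>n \<omega>. \<omega> \<in> space M \<Longrightarrow> \<bar>Z n \<omega>\<bar> \<le> 1"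
    and indep: "\<And>n. expectation (\<lambda>\<omega>. of_bool (N \<omega> = n) * Z n \<omega>) = prob {\<omega>\<in>space M. N \<omega> = n} * c n"
  shows "(\<lambda>n. prob {\<omega>\<in>space M. N \<omega> = n} * c n) sums expectation (\<lambda>\<omega>. Z (N \<omega>) \<omega>)"
proof -
  note [measurable] = N Z(1)
  let ?f = "\<lambda>n \<omega>. of_bool (N \<omega> = n) * Z n \<omega>"
  have int: "integrable M (?f n)" for n
    using Z(2)[of _ n] by (intro integrable_bounded[of _ 1]) (auto simp: of_bool_def)
  have point: "(\<lambda>n. ?f n \<omega>) sums Z (N \<omega>) \<omega>" for \<omega>
    using sums_single[of "N \<omega>" "\<lambda>n. Z n \<omega>"] by (rule sums_cong[THEN iffD1, rotated]) simp
  have pn: "(\<lambda>n. prob {\<omega>\<in>space M. N \<omega> = n}) sums prob (\<Union>n. {\<omega>\<in>space M. N \<omega> = n})"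
    by (intro finite_measure_UNION) (auto simp: disjoint_family_on_def)
  have "(\<lambda>n. expectation (?f n)) sums expectation (\<lambda>\<omega>. \<Sum>n. ?f n \<omega>)"
  proof (rule sums_integral[OF int])
    have "summable (\<lambda>n. norm (?f n \<omega>))" for \<omega>
      by (rule summable_finite[of "{N \<omega>}"]) auto
    then show "AE \<omega> in M. summable (\<lambda>n. norm (?f n \<omega>))" by simp
    show "summable (\<lambda>n. expectation (\<lambda>\<omega>. norm (?f n \<omega>)))"
    proof (rule summable_comparison_test')
      show "summable (\<lambda>n. prob {\<omega>\<in>space M. N \<omega> = n})" using pn by (rule sums_summable)
      fix n
      have "expectation (\<lambda>\<omega>. norm (?f n \<omega>)) \<le> expectation (\<lambda>\<omega>. of_bool (N \<omega> = n))"
        using Z(2)[of _ n]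
        by (intro integral_mono integrable_norm int integrable_bounded[of _ 1]) (auto simp: of_bool_def)
      then show "norm (expectation (\<lambda>\<omega>. norm (?f n \<omega>))) \<le> prob {\<omega>\<in>space M. N \<omega> = n}"
        by (simp add: expectation_of_bool del: of_bool_eq_0_iff)
    qed
  qed
  then show ?thesis using point by (simp add: indep sums_iff)
qed

text \<open>Memorylessness from a random starting point: given X = x <= s, the gap exceeds t - x
  with probability exp (x - t) = exp (s - t) * exp (x - s). In the application X is the time of the
  last ring before s.\<close>

lemma exponential_overshoot:
  assumes Y: "distributed M lborel Y (exponential_density 1)" and XY: "indep_var borel X borel Y"
    and "s \<le> t"
  shows "prob {\<omega>\<in>space M. X \<omega> \<le> s \<and> t < X \<omega> + Y \<omega>}
       = exp (s - t) * prob {\<omega>\<in>space M. X \<omega> \<le> s \<and> s < X \<omega> + Y \<omega>}"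
proof -
  have [measurable]: "X \<in> borel_measurable M" "Y \<in> borel_measurable M"
    using indep_var_rv1[OF XY] indep_var_rv2[OF XY] by auto
  interpret X: prob_space "distr M borel X" by (rule prob_space_distr) simp
  interpret Y: prob_space "distr M borel Y" by (rule prob_space_distr) simp
  have pair: "distr M borel X \<Otimes>\<^sub>M distr M borel Y = distr M (borel \<Otimes>\<^sub>M borel) (\<lambda>\<omega>. (X \<omega>, Y \<omega>))"
    using XY by (simp add: indep_var_distribution_eq)
  have tail: "emeasure M {\<omega>\<in>space M. X \<omega> \<le> s \<and> t < X \<omega> + Y \<omega>}
      = (\<integral>\<^sup>+ x. indicator {..s} x * ennreal (exp (x - t)) \<partial>distr M borel X)" if "s \<le> t" for t
  proof -
    let ?A = "{p :: real \<times> real. fst p \<le> s \<and> t < fst p + snd p}"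
    have "Measurable.pred (borel \<Otimes>\<^sub>M borel) (\<lambda>p :: real \<times> real. fst p \<le> s \<and> t < fst p + snd p)"
      by measurable
    then have [measurable]: "?A \<in> sets (borel \<Otimes>\<^sub>M borel)"
      by (simp add: pred_def space_pair_measure)
    have "emeasure M {\<omega>\<in>space M. X \<omega> \<le> s \<and> t < X \<omega> + Y \<omega>}
        = emeasure (distr M (borel \<Otimes>\<^sub>M borel) (\<lambda>\<omega>. (X \<omega>, Y \<omega>))) ?A"
      by (subst emeasure_distr) (auto intro!: arg_cong[where f="emeasure M"])
    also have "\<dots> = (\<integral>\<^sup>+ x. emeasure (distr M borel Y) (Pair x -` ?A) \<partial>distr M borel X)"
      unfolding pair[symmetric] by (rule Y.emeasure_pair_measure_alt) simp
    also have "\<dots> = (\<integral>\<^sup>+ x. indicator {..s} x * ennreal (exp (x - t)) \<partial>distr M borel X)"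
    proof (rule nn_integral_cong)
      fix x :: real
      show "emeasure (distr M borel Y) (Pair x -` ?A) = indicator {..s} x * ennreal (exp (x - t))"
      proof (cases "x \<le> s")
        case True
        have "emeasure (distr M borel Y) (Pair x -` ?A) = emeasure M {\<omega>\<in>space M. t - x < Y \<omega>}"
          using True by (subst emeasure_distr) (auto intro!: arg_cong[where f="emeasure M"])
        also have "\<dots> = ennreal (exp (x - t))"
          using exponential_distributedD_gt[OF Y, of "t - x"] True that by (simp add: emeasure_eq_measure)
        finally show ?thesis using True by simp
      next
        case False
        then have "Pair x -` ?A = {}" by auto
        then show ?thesis using False by simp
      qed
    qed
    finally show ?thesis .
  qed
  have "emeasure M {\<omega>\<in>space M. X \<omega> \<le> s \<and> t < X \<omega> + Y \<omega>}
      = (\<integral>\<^sup>+ x. ennreal (exp (s - t)) * (indicator {..s} x * ennreal (exp (x - s))) \<partial>distr M borel X)"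
    unfolding tail[OF \<open>s \<le> t\<close>]
  proof (rule nn_integral_cong)
    fix x :: real
    have "exp (x - t) = exp (s - t) * exp (x - s)" by (simp add: exp_add[symmetric])
    then show "indicator {..s} x * ennreal (exp (x - t))
        = ennreal (exp (s - t)) * (indicator {..s} x * ennreal (exp (x - s)))"
      by (simp add: ennreal_mult mult_ac)
  qed
  also have "\<dots> = ennreal (exp (s - t)) * emeasure M {\<omega>\<in>space M. X \<omega> \<le> s \<and> s < X \<omega> + Y \<omega>}"
    unfolding tail[OF order_refl] by (rule nn_integral_cmult) simp
  finally show ?thesis
    by (simp add: emeasure_eq_measure ennreal_mult[symmetric])
qed

end

text \<open>Partial sums of nonnegative gaps increase, so the rings up to s occupy an initial
  segment of indices. This turns the cardinality in \<open>ring_count\<close> into a condition on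
  one partial sum and the following gap.\<close>

lemma card_partial_sums_le:
  fixes g :: "nat \<Rightarrow> real"
  assumes nonneg: "\<And>i. 0 \<le> g i" and unbounded: "\<And>b. \<exists>n. b < (\<Sum>i\<le>n. g i)"
  shows "finite {n. (\<Sum>i\<le>n. g i) \<le> s}"
    and "0 \<le> s \<Longrightarrow> card {n. (\<Sum>i\<le>n. g i) \<le> s} = k \<longleftrightarrow> (\<Sum>i<k. g i) \<le> s \<and> s < (\<Sum>i<k. g i) + g k"
proof -
  define S where "S n = (\<Sum>i<n. g i)" for n
  have S: "(\<Sum>i\<le>n. g i) = S (Suc n)" for n by (simp add: S_def lessThan_Suc_atMost)
  have mono: "S m \<le> S n" if "m \<le> n" for m n
    unfolding S_def using that nonneg by (intro sum_mono2) auto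
  define k0 where "k0 = (LEAST n. s < S (Suc n))"
  have ex: "\<exists>n. s < S (Suc n)" using unbounded[of s] by (simp add: S)
  have k0: "s < S (Suc k0)" unfolding k0_def using ex by (rule LeastI_ex)
  have below: "S (Suc n) \<le> s" if "n < k0" for n
    using not_less_Least[of n "\<lambda>n. s < S (Suc n)"] that by (simp add: k0_def)
  have "{n. S (Suc n) \<le> s} = {..<k0}"
  proof (intro set_eqI iffI; simp)
    fix n assume "S (Suc n) \<le> s"
    show "n < k0"
    proof (rule ccontr)
      assume "\<not> n < k0"
      then have "S (Suc k0) \<le> S (Suc n)" by (intro mono) simp
      with k0 \<open>S (Suc n) \<le> s\<close> show False by simp
    qed
  qed (rule below)
  then have eq: "{n. (\<Sum>i\<le>n. g i) \<le> s} = {..<k0}" by (simp add: S)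
  show "finite {n. (\<Sum>i\<le>n. g i) \<le> s}" by (simp add: eq)
  assume "0 \<le> s"
  \<comment> \<open>If no ring has occurred, this is the empty sum; it is here that s >= 0
    matters.\<close>
  have "S k0 \<le> s" using below[of "k0 - 1"] \<open>0 \<le> s\<close> by (cases k0) (auto simp: S_def)
  have "k = k0 \<longleftrightarrow> S k \<le> s \<and> s < S (Suc k)"
  proof
    assume *: "S k \<le> s \<and> s < S (Suc k)"
    show "k = k0"
    proof (rule ccontr)
      assume "k \<noteq> k0"
      then consider "Suc k \<le> k0" | "Suc k0 \<le> k" by linarith
      then show False
      proof cases
        case 1
        then show False using mono[OF 1] * \<open>S k0 \<le> s\<close> by simp
      next
        case 2
        then show False using mono[OF 2] * k0 by simp
      qed
    qed
  qed (use k0 \<open>S k0 \<le> s\<close> in auto)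
  then show "card {n. (\<Sum>i\<le>n. g i) \<le> s} = k \<longleftrightarrow> (\<Sum>i<k. g i) \<le> s \<and> s < (\<Sum>i<k. g i) + g k"
    unfolding eq by (auto simp: S_def)
qed

section \<open>Independence of disjoint blocks of clocks and marks\<close>

context dynamical_discrete_web
begin

definition source :: "(site \<times> nat) + (site \<times> nat) \<Rightarrow> 'w \<Rightarrow> real" where
  "source i \<omega> = (case i of Inl (z, n) \<Rightarrow> gap z n \<omega> | Inr (z, n) \<Rightarrow> real_of_int (mark z n \<omega>))"

definition sources :: "((site \<times> nat) + (site \<times> nat)) set" where
  "sources = (even_lattice \<times> UNIV) <+> (even_lattice \<times> UNIV)"

text \<open>The sigma-algebra generated by the sources in I. With it every independence claim
  becomes the disjointness of two index sets.\<close>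

definition info :: "((site \<times> nat) + (site \<times> nat)) set \<Rightarrow> 'w measure" where
  "info I = vimage_algebra (space M) (\<lambda>\<omega>. restrict (\<lambda>i. source i \<omega>) I) (PiM I (\<lambda>_. borel))"

lemma space_info [simp]: "space (info I) = space M"
  by (simp add: info_def)

lemma indep_source: "indep_vars (\<lambda>_. borel) source sources"
  using independent unfolding sources_def source_def[abs_def] .

lemma measurable_source: "i \<in> sources \<Longrightarrow> source i \<in> borel_measurable M"
  using indep_source by (auto simp: indep_vars_def)

lemma measurable_info_source: "i \<in> I \<Longrightarrow> source i \<in> borel_measurable (info I)"
proof -
  assume "i \<in> I"
  have "(\<lambda>\<omega>. restrict (\<lambda>i. source i \<omega>) I) \<in> measurable (info I) (PiM I (\<lambda>_. borel))"
    unfolding info_def by (rule measurable_vimage_algebra1) (auto simp: space_PiM)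
  from measurable_compose[OF this measurable_component_singleton[OF \<open>i \<in> I\<close>]]
  show ?thesis using \<open>i \<in> I\<close> by simp
qed

lemma sets_info_mono: "I \<subseteq> J \<Longrightarrow> sets (info I) \<subseteq> sets (info J)"
  unfolding info_def[of I]
  by (intro sets_image_in_sets measurable_restrict measurable_info_source) auto

lemma sets_info_subset: "I \<subseteq> sources \<Longrightarrow> sets (info I) \<subseteq> sets M"
  unfolding info_def[of I]
  by (intro sets_image_in_sets measurable_restrict measurable_source) auto

lemma measurable_info_mono: "I \<subseteq> J \<Longrightarrow> Y \<in> measurable (info I) N \<Longrightarrow> Y \<in> measurable (info J) N"
  using sets_info_mono[of I J] by (auto simp: measurable_def)

lemma measurable_from_info: "I \<subseteq> sources \<Longrightarrow> Y \<in> measurable (info I) N \<Longrightarrow> Y \<in> measurable M N"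
  using sets_info_subset[of I] by (auto simp: measurable_def)

text \<open>The restrictions of an independent family to disjoint index sets are independent as
  random elements of product spaces, and functions of them inherit this.\<close>

lemma indep_var_info:
  assumes "I \<subseteq> sources" "J \<subseteq> sources" "I \<inter> J = {}"
    and Y: "Y \<in> measurable (info I) S" and Z: "Z \<in> measurable (info J) T"
  shows "indep_var S Y T Z"
proof -
  let ?K = "case_bool I J"
  have "indep_vars (\<lambda>j. PiM (?K j) (\<lambda>_. borel)) (\<lambda>j \<omega>. restrict (\<lambda>i. source i \<omega>) (?K j)) UNIV"
    using assms by (intro indep_vars_restrict[OF indep_source])
      (auto simp: disjoint_family_on_def split: bool.splits)
  then have "indep_sets (\<lambda>j. sets (info (?K j))) UNIV"
    by (simp add: indep_vars_def info_def sets_vimage_algebra)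
  then have sets: "indep_set (sets (info I)) (sets (info J))"
    unfolding indep_set_def by (rule iffD1[OF indep_sets_cong, rotated -1]) (auto split: bool.splits)
  have "sigma_sets (space M) {Y -` A \<inter> space M | A. A \<in> sets S} \<subseteq> sets (info I)"
    using sets.sigma_sets_subset[of "{Y -` A \<inter> space M | A. A \<in> sets S}" "info I"]
      measurable_sets[OF Y] by auto
  moreover have "sigma_sets (space M) {Z -` A \<inter> space M | A. A \<in> sets T} \<subseteq> sets (info J)"
    using sets.sigma_sets_subset[of "{Z -` A \<inter> space M | A. A \<in> sets T}" "info J"]
      measurable_sets[OF Z] by auto
  ultimately show ?thesis
    using sets measurable_from_info[OF assms(1) Y] measurable_from_info[OF assms(2) Z]
    unfolding indep_var_eq indep_sets2_eq by blast
qed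

lemma expectation_info_mult:
  fixes Y Z :: "'w \<Rightarrow> real"
  assumes IJ: "I \<subseteq> sources" "J \<subseteq> sources" "I \<inter> J = {}"
    and Y: "Y \<in> borel_measurable (info I)" "\<And>\<omega>. \<omega> \<in> space M \<Longrightarrow> \<bar>Y \<omega>\<bar> \<le> C"
    and Z: "Z \<in> borel_measurable (info J)" "\<And>\<omega>. \<omega> \<in> space M \<Longrightarrow> \<bar>Z \<omega>\<bar> \<le> D"
  shows "expectation (\<lambda>\<omega>. Y \<omega> * Z \<omega>) = expectation Y * expectation Z"
proof (rule indep_var_lebesgue_integral)
  show "indep_var borel Y borel Z" by (rule indep_var_info[OF IJ Y(1) Z(1)])
  show "integrable M Y" by (rule integrable_bounded[OF measurable_from_info[OF IJ(1) Y(1)] Y(2)])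
  show "integrable M Z" by (rule integrable_bounded[OF measurable_from_info[OF IJ(2) Z(1)] Z(2)])
qed

text \<open>Clocks and marks of one site are kept apart because the ring count depends on the gaps
  alone and is therefore independent of the marks among which it chooses.\<close>

definition gap_sources :: "site \<Rightarrow> ((site \<times> nat) + (site \<times> nat)) set" where
  "gap_sources z = Inl ` ({z} \<times> UNIV)"

definition mark_sources :: "site \<Rightarrow> ((site \<times> nat) + (site \<times> nat)) set" where
  "mark_sources z = Inr ` ({z} \<times> UNIV)"

definition site_sources :: "site set \<Rightarrow> ((site \<times> nat) + (site \<times> nat)) set" where
  "site_sources A = (\<Union>z\<in>A. gap_sources z \<union> mark_sources z)"

lemma sources_subset:
  "z \<in> even_lattice \<Longrightarrow> gap_sources z \<subseteq> sources"
  "z \<in> even_lattice \<Longrightarrow> mark_sources z \<subseteq> sources"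
  "A \<subseteq> even_lattice \<Longrightarrow> site_sources A \<subseteq> sources"
  by (auto simp: gap_sources_def mark_sources_def site_sources_def sources_def)

lemma site_sources_disjoint: "A \<inter> B = {} \<Longrightarrow> site_sources A \<inter> site_sources B = {}"
  by (auto simp: site_sources_def gap_sources_def mark_sources_def)

lemma site_sources_mono: "A \<subseteq> B \<Longrightarrow> site_sources A \<subseteq> site_sources B"
  by (auto simp: site_sources_def)

lemma measurable_gap: "Inl (z, n) \<in> I \<Longrightarrow> gap z n \<in> borel_measurable (info I)"
  using measurable_info_source[of "Inl (z, n)" I] by (simp add: source_def[abs_def])

lemma measurable_mark: "Inr (z, n) \<in> I \<Longrightarrow> mark z n \<in> measurable (info I) (count_space UNIV)"
proof -
  assume "Inr (z, n) \<in> I"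
  then have [measurable]: "(\<lambda>\<omega>. real_of_int (mark z n \<omega>)) \<in> borel_measurable (info I)"
    using measurable_info_source[of "Inr (z, n)" I] by (simp add: source_def[abs_def])
  \<comment> \<open>The floor undoes the embedding of the marks into the reals.\<close>
  have "(\<lambda>\<omega>. \<lfloor>real_of_int (mark z n \<omega>)\<rfloor>) \<in> measurable (info I) (count_space UNIV)" by measurable
  then show ?thesis by simp
qed

lemma measurable_ring_count: "ring_count gap z \<tau> \<in> measurable (info (gap_sources z)) (count_space UNIV)"
proof -
  have [measurable]: "gap z n \<in> borel_measurable (info (gap_sources z))" for n
    by (rule measurable_gap) (auto simp: gap_sources_def)
  show ?thesis unfolding ring_count_def[abs_def] ring_time_def by measurable
qed

lemma measurable_spin:
  assumes "z \<in> A"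
  shows "(\<lambda>\<omega>. spin gap mark \<tau> \<omega> z) \<in> measurable (info (site_sources A)) (count_space UNIV)"
  unfolding spin_def
proof (rule measurable_compose_countable[where f="mark z" and g="ring_count gap z \<tau>"])
  show "mark z i \<in> measurable (info (site_sources A)) (count_space UNIV)" for i
    using assms by (intro measurable_mark) (auto simp: site_sources_def mark_sources_def)
  show "ring_count gap z \<tau> \<in> measurable (info (site_sources A)) (count_space UNIV)"
    by (rule measurable_info_mono[OF _ measurable_ring_count]) (use assms in \<open>auto simp: site_sources_def\<close>)
qed

lemma spin_cases: "z \<in> even_lattice \<Longrightarrow> \<omega> \<in> space M \<Longrightarrow> spin gap mark \<tau> \<omega> z = 1 \<or> spin gap mark \<tau> \<omega> z = -1"
  using mark_range[of z \<omega>] by (auto simp: spin_def)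

section \<open>Almost sure behaviour of the clocks\<close>

text \<open>The event on which \<open>ring_count\<close> is a genuine count for every lattice site,
  rather than the default value of \<open>card\<close> on an infinite set.\<close>

definition regular :: "'w \<Rightarrow> bool" where
  "regular \<omega> \<longleftrightarrow> (\<forall>z\<in>even_lattice. (\<forall>n. 0 \<le> gap z n \<omega>) \<and> (\<forall>b. \<exists>n. b < ring_time gap z n \<omega>))"

lemma ring_count_eq_iff:
  assumes "regular \<omega>" "z \<in> even_lattice" "0 \<le> \<tau>"
  shows "ring_count gap z \<tau> \<omega> = k \<longleftrightarrow>
    (\<Sum>i<k. gap z i \<omega>) \<le> \<tau> \<and> \<tau> < (\<Sum>i<k. gap z i \<omega>) + gap z k \<omega>"
  unfolding ring_count_def ring_time_def
  by (rule card_partial_sums_le(2)) (use assms in \<open>auto simp: regular_def ring_time_def\<close>)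

lemma ring_count_mono:
  assumes "regular \<omega>" "z \<in> even_lattice" "\<sigma> \<le> \<tau>"
  shows "ring_count gap z \<sigma> \<omega> \<le> ring_count gap z \<tau> \<omega>"
  unfolding ring_count_def
proof (rule card_mono)
  show "finite {n. ring_time gap z n \<omega> \<le> \<tau>}"
    unfolding ring_time_def
    by (rule card_partial_sums_le(1)) (use assms in \<open>auto simp: regular_def ring_time_def\<close>)
qed (use assms in auto)

lemma gap_tail:
  assumes "z \<in> even_lattice" "0 \<le> b"
  shows "prob {\<omega>\<in>space M. b < gap z n \<omega>} = exp (- b)"
  using exponential_distributedD_gt[OF gap_exponential[OF assms(1)] assms(2)] by simp

lemma measurable_gap_M: "z \<in> even_lattice \<Longrightarrow> gap z n \<in> borel_measurable M"
  using gap_exponential[of z n] by (auto dest: distributed_measurable)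

text \<open>Each further gap is independent of the earlier ones and contributes the same factor
  below 1. Letting n grow shows that the gaps of a clock are almost surely unbounded.\<close>

lemma prob_all_gaps_le:
  assumes z: "z \<in> even_lattice" and "0 \<le> b"
  shows "prob {\<omega>\<in>space M. \<forall>i<n. gap z i \<omega> \<le> b} = (1 - exp (- b)) ^ n"
proof (induction n)
  case 0
  show ?case by (simp add: prob_space)
next
  case (Suc n)
  let ?I = "Inl ` ({z} \<times> {..<n})" and ?J = "{Inl (z, n)}"
  have [measurable]: "gap z i \<in> borel_measurable (info ?I)" if "i < n" for i
    using that by (intro measurable_gap) auto
  have m1: "(\<lambda>\<omega>. \<forall>i<n. gap z i \<omega> \<le> b) \<in> measurable (info ?I) (count_space UNIV)"
  proof -
    have "Measurable.pred (info ?I) (\<lambda>\<omega>. \<forall>i\<in>{..<n}. gap z i \<omega> \<le> b)"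
      by (rule pred_intros_finite(3)) auto
    then show ?thesis by (simp add: lessThan_iff Ball_def)
  qed
  have [measurable]: "gap z n \<in> borel_measurable (info ?J)"
    by (rule measurable_gap) auto
  have m2: "(\<lambda>\<omega>. gap z n \<omega> \<le> b) \<in> measurable (info ?J) (count_space UNIV)" by measurable
  have "indep_var (count_space UNIV) (\<lambda>\<omega>. \<forall>i<n. gap z i \<omega> \<le> b) (count_space UNIV) (\<lambda>\<omega>. gap z n \<omega> \<le> b)"
    using z by (intro indep_var_info[OF _ _ _ m1 m2]) (auto simp: sources_def)
  from prob_indep_random_variable[OF this, of "{True}" "{True}"]
  have "prob {\<omega>\<in>space M. (\<forall>i<n. gap z i \<omega> \<le> b) \<and> gap z n \<omega> \<le> b}
      = (1 - exp (- b)) ^ n * prob {\<omega>\<in>space M. gap z n \<omega> \<le> b}"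
    using Suc by simp
  also have "prob {\<omega>\<in>space M. gap z n \<omega> \<le> b} = 1 - exp (- b)"
  proof -
    have [measurable]: "gap z n \<in> borel_measurable M" by (rule measurable_gap_M[OF z])
    have "prob (space M - {\<omega>\<in>space M. b < gap z n \<omega>}) = 1 - exp (- b)"
      by (subst prob_compl) (auto simp: gap_tail[OF z \<open>0 \<le> b\<close>])
    moreover have "space M - {\<omega>\<in>space M. b < gap z n \<omega>} = {\<omega>\<in>space M. gap z n \<omega> \<le> b}" by auto
    ultimately show ?thesis by simp
  qed
  finally show ?case by (simp add: All_less_Suc conj_commute mult.commute)
qed

text \<open>Ring times are unbounded as soon as single gaps are: with nonnegative gaps, a ring time
  is at least its last gap.\<close>

lemma AE_regular: "AE \<omega> in M. regular \<omega>"
proof -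
  have nonneg: "AE \<omega> in M. 0 \<le> gap z n \<omega>" if z: "z \<in> even_lattice" for z n
  proof -
    have [measurable]: "gap z n \<in> borel_measurable M" by (rule measurable_gap_M[OF z])
    have "AE \<omega> in M. 0 < gap z n \<omega>"
      using gap_tail[OF z order_refl, of n] by (subst prob_Collect_eq_1[symmetric]) auto
    then show ?thesis by eventually_elim simp
  qed
  have large: "AE \<omega> in M. \<exists>n. real k < gap z n \<omega>" if z: "z \<in> even_lattice" for z k
  proof -
    have [measurable]: "gap z n \<in> borel_measurable M" for n by (rule measurable_gap_M[OF z])
    have "prob {\<omega>\<in>space M. \<forall>n. gap z n \<omega> \<le> real k} \<le> (1 - exp (- real k)) ^ n" for n
      unfolding prob_all_gaps_le[OF z of_nat_0_le_iff, symmetric]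
      by (intro finite_measure_mono) auto
    moreover have "(\<lambda>n. (1 - exp (- real k)) ^ n) \<longlonglongrightarrow> 0"
      by (rule LIMSEQ_power_zero) simp
    ultimately have "prob {\<omega>\<in>space M. \<forall>n. gap z n \<omega> \<le> real k} \<le> 0"
      by (intro LIMSEQ_le_const) auto
    then have "prob {\<omega>\<in>space M. \<forall>n. gap z n \<omega> \<le> real k} = 0" by (simp add: measure_le_0_iff)
    then have "AE \<omega> in M. \<not> (\<forall>n. gap z n \<omega> \<le> real k)"
      by (subst prob_Collect_eq_0[symmetric]) auto
    then show ?thesis by eventually_elim (auto simp: not_le)
  qed
  \<comment> \<open>Integer thresholds and a countable lattice leave only countably many null
    events.\<close>
  have "AE \<omega> in M. \<forall>z\<in>even_lattice. (\<forall>n. 0 \<le> gap z n \<omega>) \<and> (\<forall>k. \<exists>n. real k < gap z n \<omega>)"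
    using nonneg large by (subst AE_ball_countable) (auto simp: AE_all_countable)
  then show ?thesis
  proof eventually_elim
    case (elim \<omega>)
    show ?case unfolding regular_def
    proof (intro ballI conjI allI)
      fix z b assume z: "z \<in> even_lattice"
      obtain k :: nat where k: "b < real k" using reals_Archimedean2 by blast
      obtain n where n: "real k < gap z n \<omega>" using elim z by blast
      have "gap z n \<omega> \<le> (\<Sum>i\<le>n. gap z i \<omega>)"
        using elim z by (intro member_le_sum) auto
      with k n show "\<exists>n. b < ring_time gap z n \<omega>" unfolding ring_time_def by (intro exI[of _ n]) linarith
    qed (use elim in auto)
  qed
qed

text \<open>Split according to the number n of rings before sigma. On each cell memorylessness gives
  the same factor exp (sigma - tau), so the cells add up to that factor.\<close>

lemma prob_no_ring:
  assumes z: "z \<in> even_lattice" and "0 \<le> \<sigma>" "\<sigma> \<le> \<tau>"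
  shows "prob {\<omega>\<in>space M. ring_count gap z \<sigma> \<omega> = ring_count gap z \<tau> \<omega>} = exp (\<sigma> - \<tau>)"
proof -
  have cm [measurable]: "ring_count gap z t \<in> measurable M (count_space UNIV)" for t
    by (rule measurable_from_info[OF sources_subset(1)[OF z] measurable_ring_count])
  note [measurable] = measurable_gap_M[OF z]
  let ?N = "\<lambda>\<omega>. ring_count gap z \<sigma> \<omega>"
  \<comment> \<open>Of the four inequalities for the two counts, the lower one at sigma and the
    upper one at t imply the others. The case t = sigma describes the cell itself.\<close>
  have cell: "prob {\<omega>\<in>space M. ?N \<omega> = n \<and> ring_count gap z t \<omega> = n}
     = prob {\<omega>\<in>space M. (\<Sum>i<n. gap z i \<omega>) \<le> \<sigma> \<and> t < (\<Sum>i<n. gap z i \<omega>) + gap z n \<omega>}"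
    if "\<sigma> \<le> t" for n t
  proof (rule finite_measure_eq_AE)
    show "AE \<omega> in M. \<omega> \<in> {\<omega>\<in>space M. ?N \<omega> = n \<and> ring_count gap z t \<omega> = n} \<longleftrightarrow>
      \<omega> \<in> {\<omega>\<in>space M. (\<Sum>i<n. gap z i \<omega>) \<le> \<sigma> \<and> t < (\<Sum>i<n. gap z i \<omega>) + gap z n \<omega>}"
      using AE_regular
    proof eventually_elim
      case (elim \<omega>)
      then show ?case
        using ring_count_eq_iff[OF elim z, of \<sigma> n] ring_count_eq_iff[OF elim z, of t n] that \<open>0 \<le> \<sigma>\<close> by auto
    qed
  qed measurable
  have hold: "prob {\<omega>\<in>space M. ?N \<omega> = n \<and> ring_count gap z \<tau> \<omega> = n}
      = exp (\<sigma> - \<tau>) * prob {\<omega>\<in>space M. ?N \<omega> = n}" for n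
  proof -
    let ?I = "Inl ` ({z} \<times> {..<n})" and ?J = "{Inl (z, n)}"
    have [measurable]: "gap z i \<in> borel_measurable (info ?I)" if "i < n" for i
      using that by (intro measurable_gap) auto
    have m1: "(\<lambda>\<omega>. \<Sum>i<n. gap z i \<omega>) \<in> borel_measurable (info ?I)"
      by (rule borel_measurable_sum) auto
    have "indep_var borel (\<lambda>\<omega>. \<Sum>i<n. gap z i \<omega>) borel (gap z n)"
      using z by (intro indep_var_info[OF _ _ _ m1 measurable_gap[of z n ?J]]) (auto simp: sources_def)
    from exponential_overshoot[OF gap_exponential[OF z] this \<open>\<sigma> \<le> \<tau>\<close>]
    show ?thesis
      unfolding cell[OF \<open>\<sigma> \<le> \<tau>\<close>] using cell[OF order_refl, of n] by simp
  qed
  have "(\<lambda>n. prob {\<omega>\<in>space M. ?N \<omega> = n}) sums prob (\<Union>n. {\<omega>\<in>space M. ?N \<omega> = n})"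
    by (intro finite_measure_UNION) (auto simp: disjoint_family_on_def)
  also have "(\<Union>n. {\<omega>\<in>space M. ?N \<omega> = n}) = space M" by auto
  finally have "(\<lambda>n. exp (\<sigma> - \<tau>) * prob {\<omega>\<in>space M. ?N \<omega> = n}) sums (exp (\<sigma> - \<tau>) * 1)"
    by (intro sums_mult) (simp add: prob_space)
  moreover have "(\<lambda>n. prob {\<omega>\<in>space M. ?N \<omega> = n \<and> ring_count gap z \<tau> \<omega> = n})
      sums prob (\<Union>n. {\<omega>\<in>space M. ?N \<omega> = n \<and> ring_count gap z \<tau> \<omega> = n})"
    by (intro finite_measure_UNION) (auto simp: disjoint_family_on_def)
  moreover have "(\<Union>n. {\<omega>\<in>space M. ?N \<omega> = n \<and> ring_count gap z \<tau> \<omega> = n})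
      = {\<omega>\<in>space M. ?N \<omega> = ring_count gap z \<tau> \<omega>}" by auto
  ultimately show ?thesis using hold sums_unique2 by fastforce
qed

section \<open>Mean and covariance of the spins\<close>

lemma expectation_mark:
  assumes z: "z \<in> even_lattice"
  shows "expectation (\<lambda>\<omega>. real_of_int (mark z n \<omega>)) = 0"
proof -
  have [measurable]: "mark z n \<in> measurable M (count_space UNIV)"
    by (rule measurable_from_info[OF sources_subset(2)[OF z] measurable_mark]) (auto simp: mark_sources_def)
  have "expectation (\<lambda>\<omega>. real_of_int (mark z n \<omega>)) = expectation (\<lambda>\<omega>. 2 * of_bool (mark z n \<omega> = 1) - 1)"
  proof (rule Bochner_Integration.integral_cong[OF refl])
    show "real_of_int (mark z n \<omega>) = 2 * of_bool (mark z n \<omega> = 1) - 1" if "\<omega> \<in> space M" for \<omega>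
      using mark_range[OF z that, of n] by auto
  qed
  also have "\<dots> = 2 * expectation (\<lambda>\<omega>. of_bool (mark z n \<omega> = 1)) - 1"
    by (subst Bochner_Integration.integral_diff) (auto simp: prob_space intro!: integrable_bounded[of _ 2])
  also have "\<dots> = 2 * prob {\<omega>\<in>space M. mark z n \<omega> = 1} - 1"
    by (simp only: expectation_of_bool)
  finally show ?thesis using mark_uniform[OF z, of 1 n] by simp
qed

lemma expectation_mark_mult:
  assumes z: "z \<in> even_lattice"
  shows "expectation (\<lambda>\<omega>. real_of_int (mark z i \<omega>) * real_of_int (mark z j \<omega>)) = of_bool (i = j)"
proof (cases "i = j")
  case True
  have "expectation (\<lambda>\<omega>. real_of_int (mark z j \<omega>) * real_of_int (mark z j \<omega>)) = expectation (\<lambda>\<omega>. 1)"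
  proof (rule Bochner_Integration.integral_cong[OF refl])
    show "real_of_int (mark z j \<omega>) * real_of_int (mark z j \<omega>) = 1" if "\<omega> \<in> space M" for \<omega>
      using mark_range[OF z that, of j] by auto
  qed
  then show ?thesis using True by (simp add: prob_space)
next
  case False
  have m [measurable]: "mark z n \<in> measurable (info {Inr (z, n)}) (count_space UNIV)" for n
    by (rule measurable_mark) simp
  have r: "(\<lambda>\<omega>. real_of_int (mark z n \<omega>)) \<in> borel_measurable (info {Inr (z, n)})" for n by measurable
  have b: "\<omega> \<in> space M \<Longrightarrow> \<bar>real_of_int (mark z n \<omega>)\<bar> \<le> 1" for n \<omega>
    using mark_range[OF z, of \<omega> n] by auto
  have "expectation (\<lambda>\<omega>. real_of_int (mark z i \<omega>) * real_of_int (mark z j \<omega>))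
      = expectation (\<lambda>\<omega>. real_of_int (mark z i \<omega>)) * expectation (\<lambda>\<omega>. real_of_int (mark z j \<omega>))"
    using False z by (intro expectation_info_mult[OF _ _ _ r b r b]) (auto simp: sources_def)
  then show ?thesis using False by (simp add: expectation_mark[OF z])
qed

lemma expectation_mark_index:
  fixes N :: "'w \<Rightarrow> nat" and Z :: "nat \<Rightarrow> 'w \<Rightarrow> real"
  assumes z: "z \<in> even_lattice" and N: "N \<in> measurable (info (gap_sources z)) (count_space UNIV)"
    and Z: "\<And>n. Z n \<in> borel_measurable (info (mark_sources z))" "\<And>n \<omega>. \<omega> \<in> space M \<Longrightarrow> \<bar>Z n \<omega>\<bar> \<le> 1"
  shows "(\<lambda>n. prob {\<omega>\<in>space M. N \<omega> = n} * expectation (Z n)) sums expectation (\<lambda>\<omega>. Z (N \<omega>) \<omega>)"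
proof (rule expectation_random_index[OF _ _ Z(2)])
  note sub = sources_subset(1,2)[OF z]
  show N_M: "N \<in> measurable M (count_space UNIV)" by (rule measurable_from_info[OF sub(1) N])
  show "Z n \<in> borel_measurable M" for n by (rule measurable_from_info[OF sub(2) Z(1)])
  fix n
  note [measurable] = N
  have m: "(\<lambda>\<omega>. of_bool (N \<omega> = n) :: real) \<in> borel_measurable (info (gap_sources z))" by measurable
  have "expectation (\<lambda>\<omega>. of_bool (N \<omega> = n) * Z n \<omega>) = expectation (\<lambda>\<omega>. of_bool (N \<omega> = n)) * expectation (Z n)"
    by (rule expectation_info_mult[OF sub _ m _ Z(1) Z(2)]) (auto simp: gap_sources_def mark_sources_def)
  then show "expectation (\<lambda>\<omega>. of_bool (N \<omega> = n) * Z n \<omega>) = prob {\<omega>\<in>space M. N \<omega> = n} * expectation (Z n)"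
    by (simp only: expectation_of_bool)
qed

lemma expectation_spin:
  assumes z: "z \<in> even_lattice"
  shows "expectation (\<lambda>\<omega>. real_of_int (spin gap mark \<tau> \<omega> z)) = 0"
proof -
  have "(\<lambda>n. prob {\<omega>\<in>space M. ring_count gap z \<tau> \<omega> = n} * expectation (\<lambda>\<omega>. real_of_int (mark z n \<omega>)))
    sums expectation (\<lambda>\<omega>. real_of_int (mark z (ring_count gap z \<tau> \<omega>) \<omega>))"
  proof (rule expectation_mark_index[OF z measurable_ring_count])
    fix n
    have [measurable]: "mark z n \<in> measurable (info (mark_sources z)) (count_space UNIV)"
      by (rule measurable_mark) (auto simp: mark_sources_def)
    show "(\<lambda>\<omega>. real_of_int (mark z n \<omega>)) \<in> borel_measurable (info (mark_sources z))" by measurable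
    show "\<bar>real_of_int (mark z n \<omega>)\<bar> \<le> 1" if "\<omega> \<in> space M" for \<omega>
      using mark_range[OF z that, of n] by auto
  qed
  then show ?thesis by (simp add: expectation_mark[OF z] spin_def sums_iff)
qed

text \<open>Equal ring counts select the same mark, whose square is 1; different counts select
  independent centred marks. The mean is thus the probability of no ring between the two
  times.\<close>

lemma expectation_spin_mult:
  assumes z: "z \<in> even_lattice" and "0 \<le> \<sigma>" "\<sigma> \<le> \<tau>"
  shows "expectation (\<lambda>\<omega>. real_of_int (spin gap mark \<sigma> \<omega> z) * real_of_int (spin gap mark \<tau> \<omega> z)) = exp (\<sigma> - \<tau>)"
proof -
  \<comment> \<open>Both counts are packed into one natural number, since
    \<open>expectation_mark_index\<close> takes a single index.\<close>
  define N where "N \<omega> = prod_encode (ring_count gap z \<sigma> \<omega>, ring_count gap z \<tau> \<omega>)" for \<omega>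
  define i where "i n = fst (prod_decode n)" for n
  define j where "j n = snd (prod_decode n)" for n
  have N: "N \<in> measurable (info (gap_sources z)) (count_space UNIV)"
    unfolding N_def[abs_def]
    by (rule measurable_count_space_combine[where f="\<lambda>x y. prod_encode (x, y)"]) (rule measurable_ring_count)+
  have ij: "i (N \<omega>) = ring_count gap z \<sigma> \<omega>" "j (N \<omega>) = ring_count gap z \<tau> \<omega>" for \<omega>
    by (simp_all add: i_def j_def N_def)
  have "(\<lambda>n. prob {\<omega>\<in>space M. N \<omega> = n} * expectation (\<lambda>\<omega>. real_of_int (mark z (i n) \<omega>) * real_of_int (mark z (j n) \<omega>)))
    sums expectation (\<lambda>\<omega>. real_of_int (mark z (i (N \<omega>)) \<omega>) * real_of_int (mark z (j (N \<omega>)) \<omega>))"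
  proof (rule expectation_mark_index[OF z N])
    have [measurable]: "mark z n \<in> measurable (info (mark_sources z)) (count_space UNIV)" for n
      by (rule measurable_mark) (auto simp: mark_sources_def)
    show "(\<lambda>\<omega>. real_of_int (mark z (i n) \<omega>) * real_of_int (mark z (j n) \<omega>)) \<in> borel_measurable (info (mark_sources z))" for n
      by measurable
    show "\<bar>real_of_int (mark z (i n) \<omega>) * real_of_int (mark z (j n) \<omega>)\<bar> \<le> 1" if "\<omega> \<in> space M" for n \<omega>
      using mark_range[OF z that, of "i n"] mark_range[OF z that, of "j n"] by auto
  qed
  \<comment> \<open>The indicator of equal indices has the same mean for each fixed n as the product
    of marks. Both series thus agree term by term, and so do their sums.\<close>
  moreover have "(\<lambda>n. prob {\<omega>\<in>space M. N \<omega> = n} * expectation (\<lambda>\<omega>. of_bool (i n = j n)))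
    sums expectation (\<lambda>\<omega>. of_bool (i (N \<omega>) = j (N \<omega>)))"
    by (rule expectation_mark_index[OF z N]) auto
  ultimately have "expectation (\<lambda>\<omega>. real_of_int (spin gap mark \<sigma> \<omega> z) * real_of_int (spin gap mark \<tau> \<omega> z))
      = expectation (\<lambda>\<omega>. of_bool (ring_count gap z \<sigma> \<omega> = ring_count gap z \<tau> \<omega>))"
    by (simp add: expectation_mark_mult[OF z] prob_space ij spin_def sums_iff)
  also have "\<dots> = exp (\<sigma> - \<tau>)"
    unfolding expectation_of_bool by (rule prob_no_ring[OF assms])
  finally show ?thesis .
qed

end

section \<open>The web at two dynamical times\<close>

lemma snd_follow_arrow: "snd ((follow_arrow \<xi> ^^ t) (0, 0)) = int t"
  by (induction t) (auto simp: follow_arrow_def split: prod.splits)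

lemma follow_arrow_funpow: "(follow_arrow \<xi> ^^ t) (0, 0) = (position \<xi> (0, 0) t, int t)"
  by (simp add: prod_eq_iff position_def snd_follow_arrow)

lemma position_0: "position \<xi> (0, 0) 0 = 0"
  by (simp add: position_def)

lemma position_Suc:
  "position \<xi> (0, 0) (Suc t) = position \<xi> (0, 0) t + \<xi> (position \<xi> (0, 0) t, int t)"
proof -
  have "position \<xi> (0, 0) (Suc t) = fst (follow_arrow \<xi> ((follow_arrow \<xi> ^^ t) (0, 0)))"
    by (simp add: position_def)
  then show ?thesis unfolding follow_arrow_funpow by (simp add: follow_arrow_def)
qed

text \<open>Supplies the hypothesis \<open>d / 2 \<le> 1 - rho\<close> for rho = exp (-d).\<close>

lemma half_le_one_minus_exp:
  fixes d :: real
  assumes "0 \<le> d" "d \<le> 1"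
  shows "d / 2 \<le> 1 - exp (- d)"
proof -
  have "exp (- d) \<le> 1 / (1 + d)"
    using exp_ge_add_one_self[of d] assms by (simp add: exp_minus divide_inverse le_imp_inverse_le)
  also have "\<dots> \<le> 1 - d / 2"
    using assms mult_left_mono[of d 1 d] by (simp add: field_simps)
  finally show ?thesis by simp
qed

text \<open>The base is 16 * 4: the cone has order 16^m sites, and the remaining 4^-m must be
  summable even after multiplication by the bound 2^m for the weights.\<close>

definition margin :: "nat \<Rightarrow> real" where
  "margin m = 1 / 64 ^ Suc m"

text \<open>All sites whose arrows a path from the origin could use up to time 4^(m+1). The set is
  deterministic, which permits a union bound; its last row is 4^(m+1) - 1, as the arrow from there
  leads to the end of window m.\<close>

definition cone :: "nat \<Rightarrow> site set" where
  "cone m = {(x, s). (x, s) \<in> even_lattice \<and> 0 \<le> s \<and> s < 4 ^ Suc m \<and> \<bar>x\<bar> \<le> s}"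

lemma finite_cone: "finite (cone m)"
  and card_cone_le: "card (cone m) \<le> 3 * 16 ^ Suc m"
proof -
  define n :: nat where "n = 4 ^ Suc m"
  have n: "(4::int) ^ Suc m = int n" by (simp add: n_def)
  have "1 \<le> n" by (simp add: n_def)
  have sub: "cone m \<subseteq> {- int n..int n} \<times> {0..<int n}"
    unfolding cone_def n by auto
  then show "finite (cone m)" by (rule finite_subset) simp
  have "card (cone m) \<le> card ({- int n..int n} \<times> {0..<int n})"
    using sub by (intro card_mono) auto
  also have "\<dots> = (2 * n + 1) * n"
    by (simp add: card_cartesian_product nat_add_distrib nat_mult_distrib)
  also have "\<dots> \<le> (3 * n) * n" using \<open>1 \<le> n\<close> by (intro mult_right_mono) auto
  also have "\<dots> = 3 * 16 ^ Suc m"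
    unfolding n_def mult.assoc power_mult_distrib[symmetric] by simp
  finally show "card (cone m) \<le> 3 * 16 ^ Suc m" .
qed

lemma margin_bounds: "0 < margin m" "margin m \<le> 1 / 2"
proof -
  show "0 < margin m" by (simp add: margin_def)
  have "(1::real) \<le> 64 ^ m" by simp
  then have "(1::real) \<le> 32 * 64 ^ m" by linarith
  then show "margin m \<le> 1 / 2" by (simp add: margin_def field_simps)
qed

context dynamical_discrete_web
begin

definition web_path :: "real \<Rightarrow> nat \<Rightarrow> 'w \<Rightarrow> int" where
  "web_path \<tau> t \<omega> = position (spin gap mark \<tau> \<omega>) (0, 0) t"

definition past :: "nat \<Rightarrow> site set" where
  "past t = {(x, s). (x, s) \<in> even_lattice \<and> s < int t}"

definition layer :: "nat \<Rightarrow> site set" where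
  "layer t = {(x, s). (x, s) \<in> even_lattice \<and> s = int t}"

text \<open>A filtration in random walk time. It holds the entire dynamical evolution of the rows
  below t, so the paths at all dynamical times are adapted to it together.\<close>

definition history :: "nat \<Rightarrow> 'w measure" where
  "history t = info (site_sources (past t))"

lemma past_layer:
  "past t \<subseteq> even_lattice" "layer t \<subseteq> even_lattice" "past t \<inter> layer t = {}"
  by (auto simp: past_def layer_def)

lemma space_history [simp]: "space (history t) = space M"
  by (simp add: history_def)

lemma path_0: "web_path \<tau> 0 \<omega> = 0"
  by (simp add: web_path_def position_0)

lemma path_Suc: "web_path \<tau> (Suc t) \<omega> = web_path \<tau> t \<omega> + spin gap mark \<tau> \<omega> (web_path \<tau> t \<omega>, int t)"
  by (simp add: web_path_def position_Suc)

lemma path_even_bound: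
  "\<omega> \<in> space M \<Longrightarrow> (web_path \<tau> t \<omega>, int t) \<in> even_lattice \<and> \<bar>web_path \<tau> t \<omega>\<bar> \<le> int t"
proof (induction t)
  case (Suc t)
  then show ?case
    using spin_cases[of "(web_path \<tau> t \<omega>, int t)" \<omega> \<tau>] by (auto simp: path_Suc even_lattice_def)
qed (simp add: path_0 even_lattice_def)

lemma path_step: "\<omega> \<in> space M \<Longrightarrow> \<bar>web_path \<tau> (Suc t) \<omega> - web_path \<tau> t \<omega>\<bar> = 1"
  using path_even_bound[of \<omega> \<tau> t] spin_cases[of "(web_path \<tau> t \<omega>, int t)" \<omega> \<tau>] by (auto simp: path_Suc)

lemma subalgebra_history: "subalgebra M (history t)"
  using sets_info_subset[OF sources_subset(3)[OF past_layer(1)]]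
  by (simp add: subalgebra_def history_def)

lemma history_mono: "s \<le> t \<Longrightarrow> sets (history s) \<subseteq> sets (history t)"
  unfolding history_def by (intro sets_info_mono site_sources_mono) (auto simp: past_def)

lemma measurable_history_mono: "s \<le> t \<Longrightarrow> Y \<in> measurable (history s) N \<Longrightarrow> Y \<in> measurable (history t) N"
  using history_mono[of s t] by (auto simp: measurable_def)

lemma measurable_from_history: "Y \<in> measurable (history s) N \<Longrightarrow> Y \<in> measurable M N"
  using subalgebra_history[of s] by (auto simp: measurable_def subalgebra_def)

lemma measurable_path: "web_path \<tau> t \<in> measurable (history t) (count_space UNIV)"
proof (induction t)
  case 0
  show ?case by (simp add: path_0[abs_def])
next
  case (Suc t)
  \<comment> \<open>\<open>past\<close> consists of lattice sites only, so
    \<open>measurable_spin\<close> does not apply off the lattice. The default 0 is harmless because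
    the path stays on the lattice.\<close>
  let ?g = "\<lambda>x \<omega>. if (x, int t) \<in> even_lattice then x + spin gap mark \<tau> \<omega> (x, int t) else 0"
  have P: "web_path \<tau> t \<in> measurable (history (Suc t)) (count_space UNIV)"
    by (rule measurable_history_mono[OF _ Suc]) simp
  have "(\<lambda>\<omega>. ?g (web_path \<tau> t \<omega>) \<omega>) \<in> measurable (history (Suc t)) (count_space UNIV)"
  proof (rule measurable_compose_countable[where f="?g" and g="web_path \<tau> t", OF _ P])
    fix x
    show "?g x \<in> measurable (history (Suc t)) (count_space UNIV)"
    proof (cases "(x, int t) \<in> even_lattice")
      case True
      then have "(\<lambda>\<omega>. spin gap mark \<tau> \<omega> (x, int t)) \<in> measurable (history (Suc t)) (count_space UNIV)"
        unfolding history_def by (intro measurable_spin) (simp add: past_def)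
      from measurable_compose[OF this, of "\<lambda>y. x + y"] True show ?thesis by simp
    qed simp
  qed
  then show ?case
    by (rule measurable_cong[THEN iffD1, rotated]) (use path_even_bound in \<open>auto simp: path_Suc\<close>)
qed

lemma expectation_history_layer:
  fixes Y Z :: "'w \<Rightarrow> real"
  assumes "Y \<in> borel_measurable (history t)" "\<And>\<omega>. \<omega> \<in> space M \<Longrightarrow> \<bar>Y \<omega>\<bar> \<le> C"
    and "Z \<in> borel_measurable (info (site_sources (layer t)))" "\<And>\<omega>. \<omega> \<in> space M \<Longrightarrow> \<bar>Z \<omega>\<bar> \<le> D"
  shows "expectation (\<lambda>\<omega>. Y \<omega> * Z \<omega>) = expectation Y * expectation Z"
  using assms unfolding history_def
  by (intro expectation_info_mult[of "site_sources (past t)" "site_sources (layer t)"]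
      sources_subset past_layer site_sources_disjoint)

definition reachable :: "nat \<Rightarrow> int set" where
  "reachable t = {x \<in> {- int t..int t}. (x, int t) \<in> even_lattice}"

lemma finite_reachable: "finite (reachable t)"
  by (rule finite_subset[of _ "{- int t..int t}"]) (auto simp: reachable_def)

lemma path_reachable: "\<omega> \<in> space M \<Longrightarrow> web_path \<tau> t \<omega> \<in> reachable t"
  using path_even_bound[of \<omega> \<tau> t] by (auto simp: reachable_def)

lemma sum_over_path:
  fixes g :: "int \<Rightarrow> real"
  assumes "\<omega> \<in> space M"
  shows "(\<Sum>x\<in>reachable t. of_bool (web_path \<tau> t \<omega> = x) * g x) = g (web_path \<tau> t \<omega>)"
proof -
  have "(\<Sum>x\<in>reachable t. of_bool (web_path \<tau> t \<omega> = x) * g x) = (\<Sum>x\<in>reachable t. if web_path \<tau> t \<omega> = x then g x else 0)"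
    by (intro sum.cong) auto
  then show ?thesis using path_reachable[OF assms] finite_reachable by simp
qed

lemma measurable_spin_layer:
  assumes "x \<in> reachable t"
  shows "(\<lambda>\<omega>. real_of_int (spin gap mark \<tau> \<omega> (x, int t))) \<in> borel_measurable (info (site_sources (layer t)))"
proof -
  have [measurable]: "(\<lambda>\<omega>. spin gap mark \<tau> \<omega> (x, int t)) \<in> measurable (info (site_sources (layer t))) (count_space UNIV)"
    using assms by (intro measurable_spin) (auto simp: layer_def reachable_def)
  show ?thesis by measurable
qed

lemma abs_spin_le:
  "x \<in> reachable t \<Longrightarrow> \<omega> \<in> space M \<Longrightarrow> \<bar>real_of_int (spin gap mark \<tau> \<omega> (x, int t))\<bar> \<le> 1"
  using spin_cases[of "(x, int t)" \<omega> \<tau>] by (auto simp: reachable_def)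

lemma measurable_of_bool_path:
  "(\<lambda>\<omega>. of_bool (web_path \<tau> t \<omega> = x) :: real) \<in> borel_measurable (history t)"
  using measurable_path[of \<tau> t] by measurable

text \<open>Conditioning on the position becomes a finite sum over \<open>reachable\<close>: for
  each x, Y times the indicator of x depends on the rows below t, while the spin at x belongs to row
  t, is independent of them and has mean 0.\<close>

lemma expectation_path_step:
  fixes Y :: "'w \<Rightarrow> real"
  assumes Y [measurable]: "Y \<in> borel_measurable (history t)" and C: "\<And>\<omega>. \<omega> \<in> space M \<Longrightarrow> \<bar>Y \<omega>\<bar> \<le> C"
  shows "expectation (\<lambda>\<omega>. Y \<omega> * of_int (web_path \<tau> (Suc t) \<omega> - web_path \<tau> t \<omega>)) = 0"
proof -
  note [measurable] = measurable_of_bool_path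
  have C0: "0 \<le> C" using C not_empty by force
  let ?Y = "\<lambda>x \<omega>. Y \<omega> * of_bool (web_path \<tau> t \<omega> = x)"
  let ?Z = "\<lambda>x \<omega>. real_of_int (spin gap mark \<tau> \<omega> (x, int t))"
  have Yb: "\<bar>?Y x \<omega>\<bar> \<le> C" if "\<omega> \<in> space M" for x \<omega>
    using C[OF that] C0 by (auto simp: abs_mult)
  have Ym: "?Y x \<in> borel_measurable (history t)" for x by measurable
  have "expectation (\<lambda>\<omega>. Y \<omega> * of_int (web_path \<tau> (Suc t) \<omega> - web_path \<tau> t \<omega>))
      = expectation (\<lambda>\<omega>. \<Sum>x\<in>reachable t. ?Y x \<omega> * ?Z x \<omega>)"
  proof (rule Bochner_Integration.integral_cong[OF refl])
    fix \<omega> assume \<omega>: "\<omega> \<in> space M"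
    from sum_over_path[OF \<omega>, of \<tau> t "\<lambda>x. ?Z x \<omega>"]
    show "Y \<omega> * of_int (web_path \<tau> (Suc t) \<omega> - web_path \<tau> t \<omega>) = (\<Sum>x\<in>reachable t. ?Y x \<omega> * ?Z x \<omega>)"
      by (simp add: path_Suc mult.assoc sum_distrib_left[symmetric])
  qed
  also have "\<dots> = (\<Sum>x\<in>reachable t. expectation (\<lambda>\<omega>. ?Y x \<omega> * ?Z x \<omega>))"
  proof (rule Bochner_Integration.integral_sum)
    fix x assume x: "x \<in> reachable t"
    have "(\<lambda>\<omega>. ?Y x \<omega> * ?Z x \<omega>) \<in> borel_measurable M"
      by (intro borel_measurable_times measurable_from_history[OF Ym]
          measurable_from_info[OF _ measurable_spin_layer[OF x]] sources_subset past_layer)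
    then show "integrable M (\<lambda>\<omega>. ?Y x \<omega> * ?Z x \<omega>)"
    proof (rule integrable_bounded)
      fix \<omega> assume \<omega>: "\<omega> \<in> space M"
      show "\<bar>?Y x \<omega> * ?Z x \<omega>\<bar> \<le> C * 1"
        unfolding abs_mult[of "?Y x \<omega>"] using Yb[OF \<omega>] abs_spin_le[OF x \<omega>] C0 by (intro mult_mono) auto
    qed
  qed
  also have "\<dots> = 0"
  proof (intro sum.neutral ballI)
    fix x assume x: "x \<in> reachable t"
    have "expectation (\<lambda>\<omega>. ?Y x \<omega> * ?Z x \<omega>) = expectation (?Y x) * expectation (?Z x)"
      by (rule expectation_history_layer[OF Ym Yb measurable_spin_layer[OF x] abs_spin_le[OF x]])
    then show "expectation (\<lambda>\<omega>. ?Y x \<omega> * ?Z x \<omega>) = 0"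
      using x expectation_spin[of "(x, int t)"] by (simp add: reachable_def)
  qed
  finally show ?thesis .
qed

lemma expectation_spin_pair:
  assumes "0 \<le> \<sigma>" "\<sigma> \<le> \<tau>" "x \<in> reachable t" "y \<in> reachable t"
  shows "expectation (\<lambda>\<omega>. real_of_int (spin gap mark \<sigma> \<omega> (x, int t)) * real_of_int (spin gap mark \<tau> \<omega> (y, int t)))
    = exp (\<sigma> - \<tau>) * of_bool (x = y)"
proof (cases "x = y")
  case True
  then show ?thesis using assms expectation_spin_mult[of "(x, int t)" \<sigma> \<tau>] by (simp add: reachable_def)
next
  case False
  have m: "(\<lambda>\<omega>. real_of_int (spin gap mark \<upsilon> \<omega> z)) \<in> borel_measurable (info (site_sources {z}))" for z \<upsilon>
  proof -
    have [measurable]: "(\<lambda>\<omega>. spin gap mark \<upsilon> \<omega> z) \<in> measurable (info (site_sources {z})) (count_space UNIV)"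
      by (rule measurable_spin) simp
    show ?thesis by measurable
  qed
  have "expectation (\<lambda>\<omega>. real_of_int (spin gap mark \<sigma> \<omega> (x, int t)) * real_of_int (spin gap mark \<tau> \<omega> (y, int t)))
    = expectation (\<lambda>\<omega>. real_of_int (spin gap mark \<sigma> \<omega> (x, int t))) * expectation (\<lambda>\<omega>. real_of_int (spin gap mark \<tau> \<omega> (y, int t)))"
    using assms False
    by (intro expectation_info_mult[OF _ _ _ m abs_spin_le m abs_spin_le] sources_subset site_sources_disjoint)
       (auto simp: reachable_def)
  then show ?thesis
    using False assms expectation_spin[of "(x, int t)"] by (simp add: reachable_def)
qed

text \<open>As for a single step, now summing over the pair of positions. By
  \<open>expectation_spin_pair\<close> only equal positions contribute, with the factor exp (sigma -
  tau).\<close>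

lemma expectation_path_step_mult:
  fixes Y :: "'w \<Rightarrow> real"
  assumes Y [measurable]: "Y \<in> borel_measurable (history t)" and C: "\<And>\<omega>. \<omega> \<in> space M \<Longrightarrow> \<bar>Y \<omega>\<bar> \<le> C"
    and st: "0 \<le> \<sigma>" "\<sigma> \<le> \<tau>"
  shows "expectation (\<lambda>\<omega>. Y \<omega> * (of_int (web_path \<sigma> (Suc t) \<omega> - web_path \<sigma> t \<omega>) * of_int (web_path \<tau> (Suc t) \<omega> - web_path \<tau> t \<omega>)))
    = exp (\<sigma> - \<tau>) * expectation (\<lambda>\<omega>. Y \<omega> * of_bool (web_path \<sigma> t \<omega> = web_path \<tau> t \<omega>))"
proof -
  note [measurable] = measurable_of_bool_path
  have C0: "0 \<le> C" using C not_empty by force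
  let ?R = "reachable t"
  let ?Y = "\<lambda>x y \<omega>. Y \<omega> * of_bool (web_path \<sigma> t \<omega> = x) * of_bool (web_path \<tau> t \<omega> = y)"
  let ?Z = "\<lambda>x y \<omega>. real_of_int (spin gap mark \<sigma> \<omega> (x, int t)) * real_of_int (spin gap mark \<tau> \<omega> (y, int t))"
  have Yb: "\<bar>?Y x y \<omega>\<bar> \<le> C" if "\<omega> \<in> space M" for x y \<omega>
    using C[OF that] C0 by (auto simp: abs_mult)
  have Ym: "?Y x y \<in> borel_measurable (history t)" for x y by measurable
  have Zm: "?Z x y \<in> borel_measurable (info (site_sources (layer t)))" if "x \<in> ?R" "y \<in> ?R" for x y
    by (intro borel_measurable_times measurable_spin_layer that)
  have Zb: "\<bar>?Z x y \<omega>\<bar> \<le> 1" if "x \<in> ?R" "y \<in> ?R" "\<omega> \<in> space M" for x y \<omega>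
    unfolding abs_mult using abs_spin_le[OF that(1,3), of \<sigma>] abs_spin_le[OF that(2,3), of \<tau>]
    by (intro mult_le_one) auto
  have double: "Y \<omega> * G (web_path \<sigma> t \<omega>) (web_path \<tau> t \<omega>) = (\<Sum>x\<in>?R. \<Sum>y\<in>?R. ?Y x y \<omega> * G x y)"
    if \<omega>: "\<omega> \<in> space M" for \<omega> and G :: "int \<Rightarrow> int \<Rightarrow> real"
  proof -
    have "(\<Sum>x\<in>?R. \<Sum>y\<in>?R. ?Y x y \<omega> * G x y)
        = Y \<omega> * (\<Sum>x\<in>?R. of_bool (web_path \<sigma> t \<omega> = x) * (\<Sum>y\<in>?R. of_bool (web_path \<tau> t \<omega> = y) * G x y))"
      by (simp only: sum_distrib_left mult.assoc)
    then show ?thesis by (simp only: sum_over_path[OF \<omega>])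
  qed
  \<comment> \<open>Applied twice: forwards with the spins, and backwards with the constant
    indicator of x = y to fold the double sum into the meeting event.\<close>
  have expand: "expectation (\<lambda>\<omega>. \<Sum>x\<in>?R. \<Sum>y\<in>?R. ?Y x y \<omega> * G x y \<omega>)
      = (\<Sum>x\<in>?R. \<Sum>y\<in>?R. expectation (?Y x y) * expectation (G x y))"
    if G: "\<And>x y. x \<in> ?R \<Longrightarrow> y \<in> ?R \<Longrightarrow> G x y \<in> borel_measurable (info (site_sources (layer t)))"
      "\<And>x y \<omega>. x \<in> ?R \<Longrightarrow> y \<in> ?R \<Longrightarrow> \<omega> \<in> space M \<Longrightarrow> \<bar>G x y \<omega>\<bar> \<le> 1" for G :: "int \<Rightarrow> int \<Rightarrow> 'w \<Rightarrow> real"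
  proof -
    have int: "integrable M (\<lambda>\<omega>. ?Y x y \<omega> * G x y \<omega>)" if x: "x \<in> ?R" and y: "y \<in> ?R" for x y
    proof (rule integrable_bounded)
      show "(\<lambda>\<omega>. ?Y x y \<omega> * G x y \<omega>) \<in> borel_measurable M"
        by (intro borel_measurable_times measurable_from_history[OF Ym]
            measurable_from_info[OF _ G(1)[OF x y]] sources_subset past_layer)
      show "\<bar>?Y x y \<omega> * G x y \<omega>\<bar> \<le> C * 1" if \<omega>: "\<omega> \<in> space M" for \<omega>
        unfolding abs_mult[of "?Y x y \<omega>"] using Yb[OF \<omega>] G(2)[OF x y \<omega>] C0 by (intro mult_mono) auto
    qed
    have "expectation (\<lambda>\<omega>. \<Sum>x\<in>?R. \<Sum>y\<in>?R. ?Y x y \<omega> * G x y \<omega>)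
        = (\<Sum>x\<in>?R. \<Sum>y\<in>?R. expectation (\<lambda>\<omega>. ?Y x y \<omega> * G x y \<omega>))"
      using int by (subst Bochner_Integration.integral_sum; intro Bochner_Integration.integrable_sum sum.cong refl Bochner_Integration.integral_sum) auto
    also have "\<dots> = (\<Sum>x\<in>?R. \<Sum>y\<in>?R. expectation (?Y x y) * expectation (G x y))"
      by (intro sum.cong refl expectation_history_layer[OF Ym Yb G(1) G(2)])
    finally show ?thesis .
  qed
  have "expectation (\<lambda>\<omega>. Y \<omega> * (of_int (web_path \<sigma> (Suc t) \<omega> - web_path \<sigma> t \<omega>) * of_int (web_path \<tau> (Suc t) \<omega> - web_path \<tau> t \<omega>)))
      = expectation (\<lambda>\<omega>. \<Sum>x\<in>?R. \<Sum>y\<in>?R. ?Y x y \<omega> * ?Z x y \<omega>)"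
    by (intro Bochner_Integration.integral_cong refl)
      (simp only: double[symmetric, of _ "\<lambda>x y. ?Z x y _"] path_Suc add_diff_cancel_left')
  also have "\<dots> = (\<Sum>x\<in>?R. \<Sum>y\<in>?R. expectation (?Y x y) * expectation (?Z x y))"
    by (rule expand[OF Zm Zb])
  also have "\<dots> = (\<Sum>x\<in>?R. \<Sum>y\<in>?R. exp (\<sigma> - \<tau>) * (expectation (?Y x y) * expectation (\<lambda>\<omega>. of_bool (x = y))))"
    using st by (intro sum.cong refl) (simp add: expectation_spin_pair prob_space)
  also have "\<dots> = exp (\<sigma> - \<tau>) * (\<Sum>x\<in>?R. \<Sum>y\<in>?R. expectation (?Y x y) * expectation (\<lambda>\<omega>. of_bool (x = y)))"
    by (simp only: sum_distrib_left)
  also have "(\<Sum>x\<in>?R. \<Sum>y\<in>?R. expectation (?Y x y) * expectation (\<lambda>\<omega>. of_bool (x = y)))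
      = expectation (\<lambda>\<omega>. \<Sum>x\<in>?R. \<Sum>y\<in>?R. ?Y x y \<omega> * of_bool (x = y))"
    by (rule expand[symmetric]) auto
  also have "\<dots> = expectation (\<lambda>\<omega>. Y \<omega> * of_bool (web_path \<sigma> t \<omega> = web_path \<tau> t \<omega>))"
    by (intro Bochner_Integration.integral_cong refl) (simp only: double[symmetric, of _ "\<lambda>x y. of_bool (x = y)"])
  finally show ?thesis .
qed

lemma walk_pair_path:
  assumes "0 \<le> \<sigma>" "\<sigma> \<le> \<tau>"
  shows "walk_pair M history (web_path \<sigma>) (web_path \<tau>) (exp (\<sigma> - \<tau>))"
proof
qed (use assms in \<open>auto intro: subalgebra_history measurable_path expectation_path_step expectation_path_step_mult
      simp: path_0 path_step dest: history_mono[THEN subsetD] simp del: of_int_diff\<close>)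


section \<open>Good dynamical times\<close>

definition quiet :: "nat \<Rightarrow> real \<Rightarrow> 'w \<Rightarrow> bool" where
  "quiet m \<tau> \<omega> \<longleftrightarrow> (\<forall>z\<in>cone m. ring_count gap z (\<tau> - margin m) \<omega> = ring_count gap z (\<tau> + margin m) \<omega>)"

definition good :: "nat \<Rightarrow> nat \<Rightarrow> real \<Rightarrow> 'w \<Rightarrow> bool" where
  "good l n \<tau> \<omega> \<longleftrightarrow> (\<forall>m\<in>{l..<n}. quiet m \<tau> \<omega> \<and> alive m (\<lambda>t. web_path \<tau> t \<omega>) (3 * 4 ^ m))"

definition good_weight :: "nat \<Rightarrow> nat \<Rightarrow> real \<Rightarrow> 'w \<Rightarrow> real" where
  "good_weight l n \<tau> \<omega> = total_weight l n (\<lambda>t. web_path \<tau> t \<omega>) * of_bool (\<forall>m\<in>{l..<n}. quiet m \<tau> \<omega>)"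

lemma cone_even: "cone m \<subseteq> even_lattice"
  by (auto simp: cone_def)

lemma measurable_quiet: "quiet m \<tau> \<in> measurable (history (4 ^ Suc m)) (count_space UNIV)"
proof -
  have "Measurable.pred (history (4 ^ Suc m))
      (\<lambda>\<omega>. \<forall>z\<in>cone m. ring_count gap z (\<tau> - margin m) \<omega> = ring_count gap z (\<tau> + margin m) \<omega>)"
  proof (rule pred_intros_finite(3)[OF finite_cone])
    fix z assume "z \<in> cone m"
    then have "z \<in> past (4 ^ Suc m)" by (auto simp: cone_def past_def)
    then have "gap_sources z \<subseteq> site_sources (past (4 ^ Suc m))" by (auto simp: site_sources_def)
    note c = measurable_info_mono[OF this measurable_ring_count]
    show "Measurable.pred (history (4 ^ Suc m)) (\<lambda>\<omega>. ring_count gap z (\<tau> - margin m) \<omega> = ring_count gap z (\<tau> + margin m) \<omega>)"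
      unfolding history_def by (rule measurable_count_space_combine[OF c c])
  qed
  then show ?thesis unfolding quiet_def[abs_def] .
qed

text \<open>Union bound over the cone: at most 3 * 16^(m+1) sites, each ringing in an interval of
  length 2 * margin with probability at most that length.\<close>

lemma prob_not_quiet_le:
  assumes "1 / 2 \<le> \<tau>"
  shows "prob {\<omega>\<in>space M. \<not> quiet m \<tau> \<omega>} \<le> 6 / 4 ^ Suc m"
proof -
  let ?E = "\<lambda>z. {\<omega>\<in>space M. ring_count gap z (\<tau> - margin m) \<omega> \<noteq> ring_count gap z (\<tau> + margin m) \<omega>}"
  have cm: "z \<in> cone m \<Longrightarrow> ring_count gap z t \<in> measurable M (count_space UNIV)" for z t
    by (rule measurable_from_info[OF sources_subset(1)[OF subsetD[OF cone_even]] measurable_ring_count])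
  have E: "?E z \<in> events" if "z \<in> cone m" for z
  proof -
    have "Measurable.pred M (\<lambda>\<omega>. ring_count gap z (\<tau> - margin m) \<omega> \<noteq> ring_count gap z (\<tau> + margin m) \<omega>)"
      by (rule measurable_count_space_combine[OF cm[OF that] cm[OF that]])
    then show ?thesis by (simp add: pred_def)
  qed
  have "prob (?E z) \<le> 2 * margin m" if z: "z \<in> cone m" for z
  proof -
    have "Measurable.pred M (\<lambda>\<omega>. ring_count gap z (\<tau> - margin m) \<omega> = ring_count gap z (\<tau> + margin m) \<omega>)"
      by (rule measurable_count_space_combine[OF cm[OF z] cm[OF z]])
    then have events: "{\<omega>\<in>space M. ring_count gap z (\<tau> - margin m) \<omega> = ring_count gap z (\<tau> + margin m) \<omega>} \<in> events"
      by (simp add: pred_def)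
    have "prob (?E z) = prob (space M - {\<omega>\<in>space M. ring_count gap z (\<tau> - margin m) \<omega> = ring_count gap z (\<tau> + margin m) \<omega>})"
      by (intro arg_cong[where f=prob]) auto
    also have "\<dots> = 1 - prob {\<omega>\<in>space M. ring_count gap z (\<tau> - margin m) \<omega> = ring_count gap z (\<tau> + margin m) \<omega>}"
      by (rule prob_compl[OF events])
    also have "\<dots> = 1 - exp ((\<tau> - margin m) - (\<tau> + margin m))"
      \<comment> \<open>As margin m <= 1/2 <= tau, the earlier time is nonnegative.\<close>
      using assms margin_bounds[of m] by (subst prob_no_ring[OF subsetD[OF cone_even z]]) auto
    also have "(\<tau> - margin m) - (\<tau> + margin m) = - (2 * margin m)" by simp
    also have "1 - exp (- (2 * margin m)) \<le> 2 * margin m"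
      using exp_ge_add_one_self[of "- (2 * margin m)"] by linarith
    finally show ?thesis .
  qed
  then have sum: "(\<Sum>z\<in>cone m. prob (?E z)) \<le> real (card (cone m)) * (2 * margin m)"
    by (intro sum_bounded_above)
  have union: "{\<omega>\<in>space M. \<not> quiet m \<tau> \<omega>} = (\<Union>z\<in>cone m. ?E z)"
    unfolding quiet_def by blast
  have "prob {\<omega>\<in>space M. \<not> quiet m \<tau> \<omega>} \<le> (\<Sum>z\<in>cone m. prob (?E z))"
    unfolding union by (rule finite_measure_subadditive_finite[OF finite_cone]) (rule image_subsetI[OF E])
  also note sum
  also have "real (card (cone m)) * (2 * margin m) \<le> (3 * 16 ^ Suc m) * (2 * margin m)"
  proof (rule mult_right_mono)
    have "real (card (cone m)) \<le> real (3 * 16 ^ Suc m)" using card_cone_le by (rule of_nat_mono)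
    also have "\<dots> = 3 * 16 ^ Suc m" by simp
    finally show "real (card (cone m)) \<le> 3 * 16 ^ Suc m" .
    show "0 \<le> 2 * margin m" using margin_bounds(1)[of m] by simp
  qed
  also have "\<dots> = 6 / 4 ^ Suc m"
  proof -
    have "(64::real) ^ Suc m = 4 ^ Suc m * 16 ^ Suc m"
      by (simp add: power_mult_distrib[symmetric] del: power_Suc)
    then show ?thesis unfolding margin_def by simp
  qed
  finally show ?thesis .
qed

lemma walk_pair_single: "0 \<le> \<tau> \<Longrightarrow> walk_pair M history (web_path \<tau>) (web_path \<tau>) 1"
  using walk_pair_path[of \<tau> \<tau>] unfolding diff_self exp_zero by blast

lemma measurable_total_weight:
  assumes "0 \<le> \<tau>" "l \<le> n"
  shows "(\<lambda>\<omega>. total_weight l n (\<lambda>t. web_path \<tau> t \<omega>)) \<in> borel_measurable (history (4 ^ n))"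
proof -
  interpret W: walk_pair M history "web_path \<tau>" "web_path \<tau>" 1
    by (rule walk_pair_single[OF assms(1)])
  show ?thesis using W.adapted_total_weight[OF assms(2)] by (simp add: W.adapted_def)
qed

text \<open>Quietness in window m is decided by time 4^(m+1), so the later windows integrate to 1
  and the bound does not depend on n. The windows up to m are bounded by (10/9)^(m+1) <= 2^(m+1),
  which the factor 4^-(m+1) beats.\<close>

lemma expectation_weight_not_quiet_le:
  assumes \<tau>: "1 / 2 \<le> \<tau>" and m: "l \<le> m" "m < n"
  shows "expectation (\<lambda>\<omega>. total_weight l n (\<lambda>t. web_path \<tau> t \<omega>) * of_bool (\<not> quiet m \<tau> \<omega>)) \<le> 6 / 2 ^ Suc m"
proof -
  interpret W: walk_pair M history "web_path \<tau>" "web_path \<tau>" 1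
    using \<tau> by (intro walk_pair_single) simp
  let ?Y = "\<lambda>\<omega>. total_weight l (Suc m) (\<lambda>t. web_path \<tau> t \<omega>) * of_bool (\<not> quiet m \<tau> \<omega>)"
  note [measurable] = measurable_quiet[of m \<tau>]
  have q: "W.adapted (4 ^ Suc m) (\<lambda>\<omega>. of_bool (\<not> quiet m \<tau> \<omega>))"
  proof -
    have "(\<lambda>\<omega>. of_bool (\<not> quiet m \<tau> \<omega>) :: real) \<in> borel_measurable (history (4 ^ Suc m))" by measurable
    then show ?thesis unfolding W.adapted_def by (auto intro!: exI[of _ 1])
  qed
  have Y: "W.adapted (4 ^ Suc m) ?Y"
    using m by (intro W.adapted_mult W.adapted_total_weight q) simp
  have split: "total_weight l n p = total_weight l (Suc m) p * total_weight (Suc m) n p" for p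
    unfolding total_weight_def using m by (intro prod.atLeastLessThan_concat[symmetric]) auto
  have "expectation (\<lambda>\<omega>. total_weight l n (\<lambda>t. web_path \<tau> t \<omega>) * of_bool (\<not> quiet m \<tau> \<omega>))
      = expectation (\<lambda>\<omega>. ?Y \<omega> * total_weight (Suc m) n (\<lambda>t. web_path \<tau> t \<omega>))"
    by (simp only: split mult_ac)
  also have "\<dots> = expectation ?Y"
    using m by (intro W.expectation_total_weight Y) simp
  also have "\<dots> \<le> expectation (\<lambda>\<omega>. 2 ^ Suc m * of_bool (\<not> quiet m \<tau> \<omega>))"
  proof (rule integral_mono)
    show "integrable M ?Y" by (rule W.adapted_integrable[OF Y])
    show "integrable M (\<lambda>\<omega>. 2 ^ Suc m * of_bool (\<not> quiet m \<tau> \<omega>) :: real)"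
      by (rule W.adapted_integrable[OF W.adapted_mult[OF W.adapted_const q]])
    fix \<omega>
    have "total_weight l (Suc m) (\<lambda>t. web_path \<tau> t \<omega>) \<le> (10 / 9) ^ (Suc m - l)" by (rule total_weight_le)
    also have "\<dots> \<le> (10 / 9) ^ Suc m" by (rule power_increasing) auto
    also have "\<dots> \<le> 2 ^ Suc m" by (rule power_mono) auto
    finally show "?Y \<omega> \<le> 2 ^ Suc m * of_bool (\<not> quiet m \<tau> \<omega>)" by (rule mult_right_mono) simp
  qed
  also have "\<dots> = 2 ^ Suc m * prob {\<omega>\<in>space M. \<not> quiet m \<tau> \<omega>}"
    by (simp only: integral_mult_right_zero expectation_of_bool)
  also have "\<dots> \<le> 2 ^ Suc m * (6 / 4 ^ Suc m)"
    by (intro mult_left_mono prob_not_quiet_le \<tau>) simp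
  also have "\<dots> = 6 / 2 ^ Suc m"
  proof -
    have "(4::real) ^ Suc m = 2 ^ Suc m * 2 ^ Suc m" by (simp only: power_mult_distrib[symmetric]) simp
    then show ?thesis by simp
  qed
  finally show ?thesis .
qed

lemma measurable_all_quiet:
  "(\<lambda>\<omega>. \<forall>m\<in>{l..<n}. quiet m \<tau> \<omega>) \<in> measurable M (count_space UNIV)"
  by (rule pred_intros_finite(3)) (auto intro: measurable_from_history[OF measurable_quiet])

lemma measurable_good_weight:
  assumes "0 \<le> \<tau>" "l \<le> n"
  shows "good_weight l n \<tau> \<in> borel_measurable M"
proof -
  note [measurable] = measurable_from_history[OF measurable_total_weight[OF assms]] measurable_all_quiet
  show ?thesis unfolding good_weight_def[abs_def] by measurable
qed

lemma good_weight_bounds: "0 \<le> good_weight l n \<tau> \<omega>" "good_weight l n \<tau> \<omega> \<le> total_weight l n (\<lambda>t. web_path \<tau> t \<omega>)"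
  "good_weight l n \<tau> \<omega> \<le> 2 ^ n"
proof -
  show "0 \<le> good_weight l n \<tau> \<omega>" by (simp add: good_weight_def total_weight_nonneg)
  show *: "good_weight l n \<tau> \<omega> \<le> total_weight l n (\<lambda>t. web_path \<tau> t \<omega>)"
    by (simp add: good_weight_def total_weight_nonneg)
  also have "\<dots> \<le> (10 / 9) ^ (n - l)" by (rule total_weight_le)
  also have "\<dots> \<le> (10 / 9) ^ n" by (rule power_increasing) auto
  also have "\<dots> \<le> 2 ^ n" by (rule power_mono) auto
  finally show "good_weight l n \<tau> \<omega> \<le> 2 ^ n" .
qed

lemma good_weight_pos_imp_good: "0 < good_weight l n \<tau> \<omega> \<Longrightarrow> good l n \<tau> \<omega>"
  using total_weight_pos_imp_alive[of l n "\<lambda>t. web_path \<tau> t \<omega>"] total_weight_nonneg[of l n "\<lambda>t. web_path \<tau> t \<omega>"]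
  unfolding good_def good_weight_def by (auto simp: zero_less_mult_iff of_bool_def split: if_splits)

lemma integrable_good_weight_mult:
  assumes "0 \<le> \<sigma>" "0 \<le> \<tau>" "l \<le> n"
  shows "integrable M (\<lambda>\<omega>. good_weight l n \<sigma> \<omega> * good_weight l n \<tau> \<omega>)"
proof (rule integrable_bounded)
  show "(\<lambda>\<omega>. good_weight l n \<sigma> \<omega> * good_weight l n \<tau> \<omega>) \<in> borel_measurable M"
    by (intro borel_measurable_times measurable_good_weight assms)
  show "\<bar>good_weight l n \<sigma> \<omega> * good_weight l n \<tau> \<omega>\<bar> \<le> 2 ^ n * 2 ^ n" for \<omega>
    unfolding abs_mult using good_weight_bounds[of l n] by (intro mult_mono) auto
qed

lemma integrable_good_weight: "0 \<le> \<tau> \<Longrightarrow> l \<le> n \<Longrightarrow> integrable M (good_weight l n \<tau>)"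
  using good_weight_bounds[of l n \<tau>] by (intro integrable_bounded[of _ "2 ^ n"] measurable_good_weight) auto


text \<open>Total mass 1 minus the mass lost in each window that is not quiet; the losses form a
  geometric series.\<close>

lemma expectation_good_weight_ge:
  assumes \<tau>: "1 / 2 \<le> \<tau>" and "l \<le> n"
  shows "1 - 6 / 2 ^ l \<le> expectation (good_weight l n \<tau>)"
proof -
  interpret W: walk_pair M history "web_path \<tau>" "web_path \<tau>" 1
    using \<tau> by (intro walk_pair_single) simp
  let ?w = "\<lambda>\<omega>. total_weight l n (\<lambda>t. web_path \<tau> t \<omega>)"
  have w: "integrable M ?w" by (rule W.adapted_integrable[OF W.adapted_total_weight[OF \<open>l \<le> n\<close>]])
  have wq: "integrable M (\<lambda>\<omega>. ?w \<omega> * of_bool (\<not> quiet m \<tau> \<omega>))" for m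
  proof -
    note [measurable] = measurable_from_history[OF measurable_quiet[of m \<tau>]]
    show ?thesis
      by (rule Bochner_Integration.integrable_bound[OF w]) (use w in \<open>auto simp: of_bool_def\<close>)
  qed
  have "1 - 6 / 2 ^ l \<le> 1 - (\<Sum>m=l..<n. 6 / 2 ^ Suc m :: real)"
  proof -
    have "(\<Sum>m=l..<n. 6 / 2 ^ Suc m) = 6 / 2 ^ l - (6 / 2 ^ n :: real)"
      using \<open>l \<le> n\<close> by (induction rule: dec_induct) auto
    then show ?thesis by simp
  qed
  also have "\<dots> \<le> 1 - (\<Sum>m=l..<n. expectation (\<lambda>\<omega>. ?w \<omega> * of_bool (\<not> quiet m \<tau> \<omega>)))"
    using expectation_weight_not_quiet_le[OF \<tau>] by (intro diff_left_mono sum_mono) auto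
  also have "\<dots> = expectation (\<lambda>\<omega>. ?w \<omega> - (\<Sum>m=l..<n. ?w \<omega> * of_bool (\<not> quiet m \<tau> \<omega>)))"
  proof -
    have "expectation ?w = 1"
      using W.expectation_total_weight[OF \<open>l \<le> n\<close> W.adapted_const[of _ 1]] by (simp add: prob_space)
    then show ?thesis
      by (simp only: Bochner_Integration.integral_diff[OF w Bochner_Integration.integrable_sum[OF wq]]
          Bochner_Integration.integral_sum[OF wq])
  qed
  also have "\<dots> \<le> expectation (good_weight l n \<tau>)"
  proof (rule integral_mono)
    show "integrable M (\<lambda>\<omega>. ?w \<omega> - (\<Sum>m=l..<n. ?w \<omega> * of_bool (\<not> quiet m \<tau> \<omega>)))"
      by (intro Bochner_Integration.integrable_diff Bochner_Integration.integrable_sum w wq)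
    show "integrable M (good_weight l n \<tau>)" using \<tau> \<open>l \<le> n\<close> by (intro integrable_good_weight) auto
    fix \<omega>
    show "?w \<omega> - (\<Sum>m=l..<n. ?w \<omega> * of_bool (\<not> quiet m \<tau> \<omega>)) \<le> good_weight l n \<tau> \<omega>"
    proof (cases "\<forall>m\<in>{l..<n}. quiet m \<tau> \<omega>")
      case True
      then show ?thesis by (simp add: good_weight_def)
    next
      case False
      then obtain m where m: "m \<in> {l..<n}" "\<not> quiet m \<tau> \<omega>" by blast
      have "?w \<omega> * of_bool (\<not> quiet m \<tau> \<omega>) \<le> (\<Sum>m=l..<n. ?w \<omega> * of_bool (\<not> quiet m \<tau> \<omega>))"
        using m(1) by (intro member_le_sum) (auto simp: total_weight_nonneg)
      then show ?thesis using m(2) good_weight_bounds(1)[of l n \<tau> \<omega>] by simp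
    qed
  qed
  finally show ?thesis .
qed

text \<open>The indicators of quietness can only lower the second moment, so the bound for the full
  weights carries over.\<close>

lemma expectation_good_weight_mult_le:
  assumes "0 \<le> \<sigma>" "\<sigma> < \<tau>" "\<tau> \<le> 1" "l \<le> n"
  shows "expectation (\<lambda>\<omega>. good_weight l n \<sigma> \<omega> * good_weight l n \<tau> \<omega>) \<le> 1 + 3 * sqrt (1 / 2 ^ l / (\<tau> - \<sigma>))"
proof -
  interpret W: walk_pair M history "web_path \<sigma>" "web_path \<tau>" "exp (\<sigma> - \<tau>)"
    using assms by (intro walk_pair_path) auto
  have "expectation (\<lambda>\<omega>. good_weight l n \<sigma> \<omega> * good_weight l n \<tau> \<omega>)
      \<le> expectation (\<lambda>\<omega>. total_weight l n (\<lambda>t. web_path \<sigma> t \<omega>) * total_weight l n (\<lambda>t. web_path \<tau> t \<omega>))"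
  proof (rule integral_mono)
    show "integrable M (\<lambda>\<omega>. good_weight l n \<sigma> \<omega> * good_weight l n \<tau> \<omega>)"
      using assms by (intro integrable_good_weight_mult) auto
    show "integrable M (\<lambda>\<omega>. total_weight l n (\<lambda>t. web_path \<sigma> t \<omega>) * total_weight l n (\<lambda>t. web_path \<tau> t \<omega>))"
      by (rule W.adapted_integrable[OF W.adapted_mult[OF
            W.adapted_total_weight[OF assms(4)] W.adapted_total_weight_Q[OF assms(4)]]])
    show "good_weight l n \<sigma> \<omega> * good_weight l n \<tau> \<omega>
        \<le> total_weight l n (\<lambda>t. web_path \<sigma> t \<omega>) * total_weight l n (\<lambda>t. web_path \<tau> t \<omega>)" for \<omega>
      by (intro mult_mono good_weight_bounds total_weight_nonneg)
  qed
  also have "\<dots> \<le> 1 + 3 * sqrt (1 / 2 ^ l / (\<tau> - \<sigma>))"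
    using assms half_le_one_minus_exp[of "\<tau> - \<sigma>"]
    by (intro W.expectation_total_weight_pair_le) auto
  finally show ?thesis .
qed

section \<open>The second moment argument over many dynamical times\<close>

text \<open>Restricting to rational times makes this a countable union of events. The sampled times
  below are rational, and irrational times return in the passage to an accumulation point.\<close>

definition reached :: "nat \<Rightarrow> nat \<Rightarrow> 'w set" where
  "reached l n = {\<omega>\<in>space M. \<exists>\<tau>\<in>\<rat> \<inter> {1/2..1}. good l n \<tau> \<omega>}"

lemma measurable_good: "0 \<le> \<tau> \<Longrightarrow> good l n \<tau> \<in> measurable M (count_space UNIV)"
proof -
  assume "0 \<le> \<tau>"
  then interpret W: walk_pair M history "web_path \<tau>" "web_path \<tau>" 1 by (rule walk_pair_single)
  have "Measurable.pred M (\<lambda>\<omega>. \<forall>m\<in>{l..<n}. quiet m \<tau> \<omega> \<and> alive m (\<lambda>t. web_path \<tau> t \<omega>) (3 * 4 ^ m))"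
  proof (rule pred_intros_finite(3))
    fix m
    note [measurable] = measurable_from_history[OF measurable_quiet[of m \<tau>]]
      measurable_from_history[OF W.measurable_alive[of m "3 * 4 ^ m"]]
    show "Measurable.pred M (\<lambda>\<omega>. quiet m \<tau> \<omega> \<and> alive m (\<lambda>t. web_path \<tau> t \<omega>) (3 * 4 ^ m))" by measurable
  qed simp
  then show ?thesis unfolding good_def[abs_def] .
qed

lemma sets_reached: "reached l n \<in> events"
proof -
  have eq: "reached l n = (\<Union>\<tau>\<in>\<rat> \<inter> {1/2..1}. {\<omega>\<in>space M. good l n \<tau> \<omega>})"
    by (auto simp: reached_def)
  show ?thesis unfolding eq
  proof (rule sets.countable_UN'')
    show "countable (\<rat> \<inter> {1/2..1 :: real})" by (intro countable_Int1 countable_rat)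
    fix \<tau> :: real assume "\<tau> \<in> \<rat> \<inter> {1/2..1}"
    then have [measurable]: "good l n \<tau> \<in> measurable M (count_space UNIV)" by (intro measurable_good) auto
    show "{\<omega>\<in>space M. good l n \<tau> \<omega>} \<in> events" by measurable
  qed
qed


text \<open>The average X of the good weights over N equally spaced times vanishes unless a good
  time exists. Its mean is at least 1 - 6 / 2^l and its second moment barely exceeds 1, both
  uniformly in n.\<close>

lemma prob_reached_ge:
  assumes "l \<le> n"
  shows "1 - 13 / 2 ^ l - 12 * sqrt (2 / 2 ^ l) \<le> prob (reached l n)"
proof -
  \<comment> \<open>Each diagonal term of the second moment is at most 4^n, so together they
    contribute at most 4^n / N = 1 / 2^l. N may depend on n because the final bound does not involve
    it.\<close>
  define N :: nat where "N = 4 ^ n * 2 ^ l"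
  define t where "t i = (1 + real i / real N) / 2" for i
  define U where "U i = good_weight l n (t i)" for i
  have N: "0 < N" by (simp add: N_def)
  have t: "1 / 2 \<le> t i" "t i \<in> \<rat>" for i by (auto simp: t_def)
  have t1: "t i \<le> 1" if "i < N" for i using that N by (simp add: t_def field_simps)
  have t0: "0 \<le> t i" for i using t(1)[of i] by simp
  have iU: "integrable M (U i)" for i unfolding U_def by (intro integrable_good_weight t0 assms)
  have iUU: "integrable M (\<lambda>\<omega>. U i \<omega> * U j \<omega>)" for i j
    unfolding U_def by (intro integrable_good_weight_mult t0 assms)
  define X where "X \<omega> = (\<Sum>i<N. U i \<omega>) / real N" for \<omega>
  have X2: "(X \<omega>)\<^sup>2 = (\<Sum>i<N. \<Sum>j<N. U i \<omega> * U j \<omega>) / (real N)\<^sup>2" for \<omega>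
    unfolding X_def power_divide power2_eq_square[of "sum _ _"] sum_product ..
  have iX: "integrable M X" unfolding X_def[abs_def]
    by (intro integrable_divide Bochner_Integration.integrable_sum iU)
  have iX2: "integrable M (\<lambda>\<omega>. (X \<omega>)\<^sup>2)" unfolding X2
    by (intro integrable_divide Bochner_Integration.integrable_sum iUU)
  have first: "1 - 6 / 2 ^ l \<le> expectation X"
  proof -
    have "real N * (1 - 6 / 2 ^ l) \<le> (\<Sum>i<N. expectation (U i))"
      using sum_bounded_below[of "{..<N}" "1 - 6 / 2 ^ l" "\<lambda>i. expectation (U i)"]
        expectation_good_weight_ge[OF t(1) assms] by (simp add: U_def)
    then show ?thesis
      unfolding X_def[abs_def] using N iU by (simp add: Bochner_Integration.integral_sum field_simps)
  qed
  have diag: "expectation (\<lambda>\<omega>. U i \<omega> * U i \<omega>) \<le> 4 ^ n" for i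
  proof -
    have "expectation (\<lambda>\<omega>. U i \<omega> * U i \<omega>) \<le> expectation (\<lambda>\<omega>. 4 ^ n)"
    proof (rule integral_mono[OF iUU])
      have four: "(4::real) ^ n = 2 ^ n * 2 ^ n" by (simp only: power_mult_distrib[symmetric]) simp
      show "U i \<omega> * U i \<omega> \<le> 4 ^ n" for \<omega>
        unfolding four U_def by (intro mult_mono good_weight_bounds) simp
    qed simp
    then show ?thesis by (simp add: prob_space)
  qed
  have off: "expectation (\<lambda>\<omega>. U i \<omega> * U j \<omega>)
      \<le> 1 + 3 * sqrt (2 / 2 ^ l) * sqrt (real N / \<bar>real i - real j\<bar>)" if ij: "i < N" "j < N" "i \<noteq> j" for i j
  proof -
    have *: "expectation (\<lambda>\<omega>. U i \<omega> * U j \<omega>)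
      \<le> 1 + 3 * sqrt (2 / 2 ^ l) * sqrt (real N / \<bar>real i - real j\<bar>)" if "i < j" "j < N" for i j
    proof -
      have d: "t j - t i = (real j - real i) / (2 * real N)" using N by (simp add: t_def field_simps)
      have "0 < t j - t i" unfolding d using that N by simp
      then have "expectation (\<lambda>\<omega>. U i \<omega> * U j \<omega>) \<le> 1 + 3 * sqrt (1 / 2 ^ l / (t j - t i))"
        unfolding U_def using that by (intro expectation_good_weight_mult_le t0 t1 assms) auto
      \<comment> \<open>The times fill an interval of length 1/2, hence the factor 2 under the
        root.\<close>
      also have "1 / 2 ^ l / (t j - t i) = (2 / 2 ^ l) * (real N / \<bar>real i - real j\<bar>)"
        unfolding d using that N by (simp add: field_simps)
      finally show ?thesis by (simp only: real_sqrt_mult mult.assoc)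
    qed
    show ?thesis
    proof (cases "i < j")
      case True
      then show ?thesis using * ij by blast
    next
      case False
      then have "j < i" using ij by simp
      from *[OF this \<open>i < N\<close>] show ?thesis by (simp only: mult.commute[of "U i _"] abs_minus_commute)
    qed
  qed
  have second: "expectation (\<lambda>\<omega>. (X \<omega>)\<^sup>2) \<le> 1 + 1 / 2 ^ l + 12 * sqrt (2 / 2 ^ l)"
  proof -
    let ?s = "3 * sqrt (2 / 2 ^ l)"
    have "(\<Sum>i<N. \<Sum>j<N. expectation (\<lambda>\<omega>. U i \<omega> * U j \<omega>))
        = (\<Sum>i<N. expectation (\<lambda>\<omega>. U i \<omega> * U i \<omega>) + (\<Sum>j\<in>{..<N} - {i}. expectation (\<lambda>\<omega>. U i \<omega> * U j \<omega>)))"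
      by (intro sum.cong refl sum.remove) auto
    also have "\<dots> \<le> (\<Sum>i<N. 4 ^ n + (\<Sum>j\<in>{..<N} - {i}. 1 + ?s * sqrt (real N / \<bar>real i - real j\<bar>)))"
      by (intro sum_mono add_mono diag off) auto
    also have "\<dots> = real N * 4 ^ n + (\<Sum>i<N. real (card ({..<N} - {i})))
        + ?s * (\<Sum>i<N. \<Sum>j\<in>{..<N} - {i}. sqrt (real N / \<bar>real i - real j\<bar>))"
      by (simp only: sum.distrib sum_distrib_left sum_constant card_lessThan of_nat_id mult_1_right add.assoc)
    also have "\<dots> \<le> real N * 4 ^ n + (\<Sum>i<N. real N) + ?s * (4 * (real N)\<^sup>2)"
      by (intro add_mono mult_left_mono sum_offdiagonal_le sum_mono order_refl)
        (auto simp: card_Diff_singleton_if)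
    also have "\<dots> = (1 + 1 / 2 ^ l + 12 * sqrt (2 / 2 ^ l)) * (real N)\<^sup>2"
      by (simp add: N_def power2_eq_square algebra_simps)
    finally have "(\<Sum>i<N. \<Sum>j<N. expectation (\<lambda>\<omega>. U i \<omega> * U j \<omega>)) / (real N)\<^sup>2
        \<le> 1 + 1 / 2 ^ l + 12 * sqrt (2 / 2 ^ l)"
      using N by (simp add: divide_le_eq)
    moreover have "expectation (\<lambda>\<omega>. (X \<omega>)\<^sup>2) = (\<Sum>i<N. \<Sum>j<N. expectation (\<lambda>\<omega>. U i \<omega> * U j \<omega>)) / (real N)\<^sup>2"
      unfolding X2 using iUU by (simp add: Bochner_Integration.integral_sum Bochner_Integration.integrable_sum)
    ultimately show ?thesis by simp
  qed
  \<comment> \<open>From (X - 1)^2 >= 0 one gets 2 * X - X^2 <= 1, and the left side is 0 where X =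
    0. Taking means gives 2 * (1 - 6 / 2^l) minus the second moment, hence the 13 in the
    claim.\<close>
  have "2 * expectation X - expectation (\<lambda>\<omega>. (X \<omega>)\<^sup>2) = expectation (\<lambda>\<omega>. 2 * X \<omega> - (X \<omega>)\<^sup>2)"
    using iX iX2 by simp
  also have "\<dots> \<le> expectation (\<lambda>\<omega>. of_bool (\<omega> \<in> reached l n))"
  proof (rule integral_mono)
    show "integrable M (\<lambda>\<omega>. 2 * X \<omega> - (X \<omega>)\<^sup>2)" using iX iX2 by simp
    note [measurable] = sets_reached[of l n]
    show "integrable M (\<lambda>\<omega>. of_bool (\<omega> \<in> reached l n) :: real)"
      by (rule integrable_bounded[of _ 1]) auto
    fix \<omega> assume \<omega>: "\<omega> \<in> space M"
    show "2 * X \<omega> - (X \<omega>)\<^sup>2 \<le> of_bool (\<omega> \<in> reached l n)"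
    proof (cases "\<omega> \<in> reached l n")
      case True
      then show ?thesis using zero_le_power2[of "X \<omega> - 1"] by (simp add: power2_eq_square algebra_simps)
    next
      case False
      have "U i \<omega> = 0" if "i < N" for i
      proof (rule ccontr)
        assume "U i \<omega> \<noteq> 0"
        then have "good l n (t i) \<omega>"
          using good_weight_bounds(1)[of l n "t i" \<omega>] by (intro good_weight_pos_imp_good) (simp add: U_def)
        with False \<omega> t[of i] t1[OF that] show False by (auto simp: reached_def)
      qed
      then have "X \<omega> = 0" by (simp add: X_def)
      then show ?thesis by simp
    qed
  qed
  also have "\<dots> = prob (reached l n)"
  proof -
    have "{\<omega>\<in>space M. \<omega> \<in> reached l n} = reached l n" by (auto simp: reached_def)
    then show ?thesis by (simp only: expectation_of_bool)
  qed
  finally show ?thesis using first second by simp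
qed


lemma reached_decreasing: "decseq (reached l)"
  by (auto simp: decseq_def reached_def good_def) fastforce

lemma prob_always_reached_ge:
  "1 - 13 / 2 ^ l - 12 * sqrt (2 / 2 ^ l) \<le> prob (\<Inter>n. reached l n)"
proof (rule LIMSEQ_le_const)
  show "(\<lambda>n. prob (reached l n)) \<longlonglongrightarrow> prob (\<Inter>n. reached l n)"
    using sets_reached reached_decreasing by (intro finite_Lim_measure_decseq) auto
  show "\<exists>N. \<forall>n\<ge>N. 1 - 13 / 2 ^ l - 12 * sqrt (2 / 2 ^ l) \<le> prob (reached l n)"
    using prob_reached_ge by blast
qed

text \<open>The lower bound tends to 1 as l grows, so the union over l has probability 1; the
  starting window l depends on the outcome.\<close>

lemma AE_always_reached: "AE \<omega> in M. \<exists>l. \<forall>n. \<omega> \<in> reached l n"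
proof -
  let ?G = "\<Union>l. \<Inter>n. reached l n"
  have sets [measurable]: "(\<Inter>n. reached l n) \<in> events" for l
    using sets_reached by blast
  have half: "(\<lambda>l. 1 / 2 ^ l :: real) \<longlonglongrightarrow> 0"
    using LIMSEQ_power_zero[of "1 / 2 :: real"] by (simp add: power_divide)
  have "(\<lambda>l. 1 - 13 * (1 / 2 ^ l) - 12 * sqrt (2 * (1 / 2 ^ l)) :: real) \<longlonglongrightarrow> 1 - 13 * 0 - 12 * sqrt (2 * 0)"
    by (intro tendsto_intros half)
  then have "1 \<le> prob ?G"
  proof (intro LIMSEQ_le_const2)
    have "1 - 13 * (1 / 2 ^ l) - 12 * sqrt (2 * (1 / 2 ^ l)) \<le> prob ?G" for l
    proof -
      have "prob (\<Inter>n. reached l n) \<le> prob ?G" by (intro finite_measure_mono) auto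
      with prob_always_reached_ge[of l] show ?thesis by simp
    qed
    then show "\<exists>N. \<forall>l\<ge>N. 1 - 13 * (1 / 2 ^ l) - 12 * sqrt (2 * (1 / 2 ^ l)) \<le> prob ?G" by blast
  qed simp
  then have "prob ?G = 1" using prob_le_1[of ?G] by linarith
  then have "AE \<omega> in M. \<omega> \<in> ?G" by (subst AE_in_set_eq_1) auto
  then show ?thesis by eventually_elim auto
qed

text \<open>
  The quiet intervals make the path locally constant in dynamical time, so that the good times may be
  replaced by an accumulation point although the set of good times is not closed.
\<close>

lemma reached_imp_alive:
  assumes reg: "regular \<omega>" and \<omega>: "\<omega> \<in> space M" and "\<And>n. \<omega> \<in> reached l n"
  shows "\<exists>\<tau>\<in>{1/2..1}. \<forall>m\<ge>l. alive m (\<lambda>t. web_path \<tau> t \<omega>) (3 * 4 ^ m)"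
proof -
  have "\<exists>\<sigma>. \<sigma> \<in> {1/2..1} \<and> good l n \<sigma> \<omega>" for n
    using assms(3)[of n] by (auto simp: reached_def)
  then have "\<exists>\<sigma>. \<forall>n. \<sigma> n \<in> {1/2..1} \<and> good l n (\<sigma> n) \<omega>"
    by (intro choice) blast
  then obtain \<sigma> where \<sigma>: "\<And>n. \<sigma> n \<in> {1/2..1}" "\<And>n. good l n (\<sigma> n) \<omega>" by blast
  have "seq_compact {1/2..1::real}" by (intro compact_imp_seq_compact compact_Icc)
  then obtain \<tau> r where \<tau>: "\<tau> \<in> {1/2..1}" and r: "strict_mono r" and lim: "(\<sigma> \<circ> r) \<longlonglongrightarrow> \<tau>"
    using \<sigma>(1) unfolding seq_compact_def by meson
  show ?thesis
  proof (intro bexI[OF _ \<tau>] allI impI)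
    fix m assume "l \<le> m"
    from LIMSEQ_D[OF lim margin_bounds(1)[of m]]
    obtain k where k: "\<And>j. k \<le> j \<Longrightarrow> \<bar>\<sigma> (r j) - \<tau>\<bar> < margin m" by auto
    \<comment> \<open>Large enough for the selected time to be close to the limit, and for window m
      to be among those at which that time is good.\<close>
    define j where "j = max k (Suc m)"
    define s where "s = \<sigma> (r j)"
    have "m < r j" using seq_suble[OF r, of j] by (simp add: j_def)
    then have q: "quiet m s \<omega>" and a: "alive m (\<lambda>t. web_path s t \<omega>) (3 * 4 ^ m)"
      using \<sigma>(2)[of "r j"] \<open>l \<le> m\<close> by (auto simp: good_def s_def)
    have near: "\<bar>s - \<tau>\<bar> < margin m" using k[of j] by (simp add: s_def j_def)
    \<comment> \<open>Both s and tau lie within the margin of s. Counts are monotone and agree at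
      the two ends of that interval, so they are constant on it.\<close>
    have count: "ring_count gap z s \<omega> = ring_count gap z \<tau> \<omega>" if z: "z \<in> cone m" for z
    proof -
      have ze: "z \<in> even_lattice" using cone_even z by blast
      have "ring_count gap z (s - margin m) \<omega> = ring_count gap z (s + margin m) \<omega>"
        using q z by (simp add: quiet_def)
      moreover have "ring_count gap z (s - margin m) \<omega> \<le> ring_count gap z u \<omega> \<and>
          ring_count gap z u \<omega> \<le> ring_count gap z (s + margin m) \<omega>" if "\<bar>s - u\<bar> < margin m" for u
        using that by (intro conjI ring_count_mono[OF reg ze]) auto
      ultimately show ?thesis using near margin_bounds(1)[of m]
        by (metis abs_zero diff_self le_antisym)
    qed
    \<comment> \<open>The arrow out of row t is read at a site of the cone as long as t < 4^(m+1),
      so the two paths agree up to and including the end of window m.\<close>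
    have same: "t \<le> 4 ^ Suc m \<Longrightarrow> web_path s t \<omega> = web_path \<tau> t \<omega>" for t
    proof (induction t)
      case (Suc t)
      then have "int t < int (4 ^ Suc m)" by (simp only: of_nat_less_iff Suc_le_eq)
      then have "(web_path s t \<omega>, int t) \<in> cone m"
        using path_even_bound[OF \<omega>, of s t] by (auto simp: cone_def)
      then show ?case using Suc count by (simp add: path_Suc spin_def)
    qed (simp add: path_0)
    show "alive m (\<lambda>t. web_path \<tau> t \<omega>) (3 * 4 ^ m)"
      unfolding alive_def
    proof (intro allI impI)
      fix i :: nat assume i: "i \<le> 3 * 4 ^ m"
      have "web_path \<tau> (4 ^ m + i) \<omega> = web_path s (4 ^ m + i) \<omega>" "web_path \<tau> (4 ^ m) \<omega> = web_path s (4 ^ m) \<omega>"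
        using i by (intro same[symmetric]; simp)+
      then show "\<bar>web_path \<tau> (4 ^ m + i) \<omega> - web_path \<tau> (4 ^ m) \<omega>\<bar> < 8 * 2 ^ m"
        using a i by (simp add: alive_def)
    qed
  qed
qed

end

section \<open>From confined windows to the limsup\<close>

text \<open>The displacements of windows l, ..., m - 1 add up to at most 8 * 2^m, and the current
  window adds another 8 * 2^m. What happens before time 4^l is bounded trivially by 4^l.\<close>

lemma alive_imp_sqrt_bound:
  assumes p0: "\<bar>p (4 ^ l)\<bar> \<le> 4 ^ l" and alive: "\<And>m. l \<le> m \<Longrightarrow> alive m p (3 * 4 ^ m)"
    and m: "l \<le> m" "4 ^ m \<le> t" "t \<le> 4 ^ Suc m"
  shows "\<bar>p t\<bar> \<le> 4 ^ l + 16 * 2 ^ m"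
proof -
  have window: "\<bar>p t - p (4 ^ m)\<bar> < 8 * 2 ^ m" if "l \<le> m" "4 ^ m \<le> t" "t \<le> 4 ^ Suc m" for m t
  proof -
    have "4 ^ m + (t - 4 ^ m) = t" "t - 4 ^ m \<le> 3 * 4 ^ m" using that by auto
    then show ?thesis
      using alive[OF \<open>l \<le> m\<close>, unfolded alive_def, rule_format, of "t - 4 ^ m"] by simp
  qed
  have "\<bar>p (4 ^ m)\<bar> \<le> 4 ^ l + 8 * 2 ^ m"
    using m(1)
  proof (induction rule: dec_induct)
    case base
    then show ?case using p0 zero_le_power[of "2::int" l] by linarith
  next
    case (step m)
    have "\<bar>p (4 ^ Suc m) - p (4 ^ m)\<bar> < 8 * 2 ^ m" using step(1) by (intro window) auto
    with step(3) show ?case by (simp add: abs_if split: if_splits)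
  qed
  with window[OF m] show ?thesis by linarith
qed

text \<open>For t >= 4^m one has 2^m <= sqrt t, so 16 * 2^m turns into 16 * sqrt t, while the fixed
  term 4^l disappears after division by sqrt t.\<close>

lemma limsup_le_of_alive:
  assumes p0: "\<bar>position \<xi> (0, 0) (4 ^ l)\<bar> \<le> 4 ^ l"
    and alive: "\<And>m. l \<le> m \<Longrightarrow> alive m (position \<xi> (0, 0)) (3 * 4 ^ m)"
  shows "Limsup at_top (\<lambda>t::real. ereal (\<bar>arrow_path \<xi> (0, 0) t\<bar> / sqrt t)) \<le> ereal 16"
proof -
  let ?p = "position \<xi> (0, 0)"
  have bound: "\<bar>arrow_path \<xi> (0, 0) t\<bar> / sqrt t \<le> 4 ^ l / sqrt t + 16" if t: "4 ^ l \<le> t" for t :: real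
  proof -
    define n where "n = nat \<lfloor>t\<rfloor>"
    have "(1::real) \<le> 4 ^ l" by simp
    with t have t1: "1 \<le> t" by linarith
    have n: "real n \<le> t" "t < real n + 1" using t1 unfolding n_def by linarith+
    have "real (4 ^ l) < real (Suc n)" using t n by simp
    then have ln: "4 ^ l \<le> n" by (simp only: of_nat_less_iff less_Suc_eq_le)
    have "1 \<le> n" using ln one_le_power[of "4::nat" l] by linarith
    then obtain m where m: "4 ^ m \<le> n" "n < 4 ^ (m + 1)" using ex_power_ivl1[of 4 n] by auto
    have "(4::nat) ^ l < 4 ^ (m + 1)" using ln m(2) by (rule le_less_trans)
    then have "l < m + 1" by (rule power_less_imp_less_exp[rotated]) simp
    then have lm: "l \<le> m" by simp
    have b: "\<bar>real_of_int (?p k)\<bar> \<le> 4 ^ l + 16 * 2 ^ m" if "4 ^ m \<le> k" "k \<le> 4 ^ Suc m" for k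
    proof -
      have "\<bar>?p k\<bar> \<le> 4 ^ l + 16 * 2 ^ m"
        by (rule alive_imp_sqrt_bound[OF p0 alive lm that])
      then have "real_of_int \<bar>?p k\<bar> \<le> real_of_int (4 ^ l + 16 * 2 ^ m)" by (simp only: of_int_le_iff)
      then show ?thesis by simp
    qed
    \<comment> \<open>The endpoint \<open>Suc n\<close> of the interpolation may equal 4^(m+1),
      which still belongs to the closed window m.\<close>
    have bn: "\<bar>real_of_int (?p n)\<bar> \<le> 4 ^ l + 16 * 2 ^ m" "\<bar>real_of_int (?p (Suc n))\<bar> \<le> 4 ^ l + 16 * 2 ^ m"
      using m by (auto intro!: b)
    define f where "f = frac t"
    have f: "0 \<le> f" "f \<le> 1" using frac_lt_1[of t] by (auto simp: f_def)
    have "arrow_path \<xi> (0, 0) t = (1 - f) * of_int (?p n) + f * of_int (?p (Suc n))"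
      by (simp add: arrow_path_def Let_def n_def f_def)
    also have "\<bar>\<dots>\<bar> \<le> (1 - f) * \<bar>of_int (?p n)\<bar> + f * \<bar>of_int (?p (Suc n))\<bar>"
      using f by (intro abs_triangle_ineq[THEN order.trans]) (simp add: abs_mult)
    also have "\<dots> \<le> (1 - f) * (4 ^ l + 16 * 2 ^ m) + f * (4 ^ l + 16 * 2 ^ m)"
      using f bn by (intro add_mono mult_left_mono) auto
    also have "\<dots> = 4 ^ l + 16 * 2 ^ m" by (simp add: algebra_simps)
    also have "\<dots> \<le> 4 ^ l + 16 * sqrt t"
    proof -
      have "(2 ^ m)\<^sup>2 = real (4 ^ m)" by (simp add: power2_eq_square power_mult_distrib[symmetric])
      also have "\<dots> \<le> t" using m(1) n(1) by (meson of_nat_mono order.trans)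
      finally show ?thesis using real_le_rsqrt by simp
    qed
    finally have "\<bar>arrow_path \<xi> (0, 0) t\<bar> / sqrt t \<le> (4 ^ l + 16 * sqrt t) / sqrt t"
      using t1 by (intro divide_right_mono) auto
    then show ?thesis using t1 by (simp add: add_divide_distrib)
  qed
  have "Limsup at_top (\<lambda>t::real. ereal (\<bar>arrow_path \<xi> (0, 0) t\<bar> / sqrt t))
      \<le> Limsup at_top (\<lambda>t::real. ereal (4 ^ l / sqrt t + 16))"
    by (intro Limsup_mono eventually_mono[OF eventually_ge_at_top[of "4 ^ l :: real"]]) (simp add: bound)
  also have "\<dots> = ereal 16"
  proof (rule lim_imp_Limsup)
    have "((\<lambda>t::real. 4 ^ l / sqrt t) \<longlongrightarrow> 0) at_top"
      by (intro tendsto_divide_0[OF tendsto_const] filterlim_at_top_imp_at_infinity sqrt_at_top)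
    then have "((\<lambda>t::real. 4 ^ l / sqrt t + 16) \<longlongrightarrow> 0 + 16) at_top" by (intro tendsto_intros)
    then show "((\<lambda>t::real. ereal (4 ^ l / sqrt t + 16)) \<longlongrightarrow> ereal 16) at_top" by simp
  qed simp
  finally show ?thesis .
qed

theorem corollary1:
  fixes M :: "'w measure"
    and gap :: "site \<Rightarrow> nat \<Rightarrow> 'w \<Rightarrow> real"
    and mark :: "site \<Rightarrow> nat \<Rightarrow> 'w \<Rightarrow> int"
  assumes "dynamical_discrete_web M gap mark"
  shows "\<exists>K\<^sub>0::real. \<forall>K\<ge>K\<^sub>0. AE \<omega> in M. \<exists>\<tau>\<in>{0..1}.
           Limsup at_top (\<lambda>t::real. ereal (\<bar>dydw_path gap mark (0, 0) \<tau> \<omega> t\<bar> / sqrt t)) \<le> ereal K"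
proof (intro exI[of _ 16] allI impI)
  fix K :: real assume "16 \<le> K"
  interpret dynamical_discrete_web M gap mark by fact
  show "AE \<omega> in M. \<exists>\<tau>\<in>{0..1}.
           Limsup at_top (\<lambda>t::real. ereal (\<bar>dydw_path gap mark (0, 0) \<tau> \<omega> t\<bar> / sqrt t)) \<le> ereal K"
    using AE_always_reached AE_regular AE_space
  proof eventually_elim
    case (elim \<omega>)
    then obtain l where "\<And>n. \<omega> \<in> reached l n" by blast
    from reached_imp_alive[OF elim(2,3) this] obtain \<tau>
      where \<tau>: "\<tau> \<in> {1/2..1}" and alive: "\<And>m. l \<le> m \<Longrightarrow> alive m (\<lambda>t. web_path \<tau> t \<omega>) (3 * 4 ^ m)"
      by blast
    have "\<bar>web_path \<tau> (4 ^ l) \<omega>\<bar> \<le> 4 ^ l" using path_even_bound[OF elim(3), of \<tau> "4 ^ l"] by simp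
    then have "Limsup at_top (\<lambda>t::real. ereal (\<bar>dydw_path gap mark (0, 0) \<tau> \<omega> t\<bar> / sqrt t)) \<le> ereal 16"
      unfolding dydw_path_def using alive by (intro limsup_le_of_alive) (simp_all add: web_path_def)
    also have "\<dots> \<le> ereal K" using \<open>16 \<le> K\<close> by simp
    finally show ?case using \<tau> by (intro bexI[of _ \<tau>]) auto
  qed
qed

end
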